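(* Suppose that $r(t,u)=\Phi(t-u)$, $t,u\in\mathbb{R}$, is a translation-invariant symmetric positive-definite kernel on $\mathbb{R}$ with $\Phi\in C(\mathbb{R})\cap\mathscr{L}_1(\mathbb{R})$. Let $I$ be a countably infinite index set, let $\{\varphi_m\}_{m\in I}$ be an orthonormal basis of $\mathscr{L}_2(\mathbb{R})$, and let $h$ be a function such that $|\hat h(\omega)|=\hat\Phi(\omega)^{1/2}$. Then the functions $$\psi_m(t)=\int_{-\infty}^\infty h(t-\tau)\varphi_m(\tau)\,d\tau\quad\text{with Fourier transforms}\quad \hat\psi_m(\omega)=\hat h(\omega)\hat\varphi_m(\omega),\qquad m\in I,$$ form an orthonormal basis of the reproducing kernel Hilbert space $\mathscr{H}_r(\mathbb{R})$, and the kernel $r$ has the pointwise convergent expansion $$r(t,u)=\sum_{m\in I}\psi_m^*(t)\psi_m(u)\quad\text{for all } t,u\in\mathbb{R}.$$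
   Context: $\mathscr{L}_2(\mathbb{R})$ is the space of square-integrable functions $f:\mathbb{R}\to\mathbb{C}$ with inner product $\langle f,g\rangle=\int_{-\infty}^\infty f^*(t)g(t)\,dt$, where $z^*$ is the complex conjugate of $z\in\mathbb{C}$. The Fourier transform of an integrable or square-integrable function $f$ is $\hat f(\omega)=\int_{-\infty}^\infty f(t)e^{-i\omega t}\,dt$, with inverse $f(t)=\frac{1}{2\pi}\int_{-\infty}^\infty\hat f(\omega)e^{i\omega t}\,d\omega$ (extended to $\mathscr{L}_2(\mathbb{R})$ in the usual Plancherel sense). A symmetric kernel $r:\mathbb{R}\times\mathbb{R}\to\mathbb{R}$ is translation-invariant if $r(t,u)=\Phi(t-u)$ for some $\Phi:\mathbb{R}\to\mathbb{R}$. $\mathscr{H}_r(\mathbb{R})$ denotes the unique reproducing kernel Hilbert space (of complex-valued functions on $\mathbb{R}$) with reproducing kernel $r$.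
   Formalization: The orthonormal-basis claim is proved under the added, necessary assumption that the Fourier transform of Φ is nonzero almost everywhere; otherwise some ψ_m can vanish (e.g. Φ(t)=(sin(t/2)/(t/2))²). The transform formula and kernel expansion need no such assumption. *)

theory Defs
  imports "HOL-Analysis.Analysis"
begin

section \<open>Square-integrable functions and the Fourier transform\<close>

text \<open>Functions are used as representatives of their almost-everywhere classes, so
  \<^term>\<open>l2_inner\<close> below is only positive semidefinite on \<open>l2_space\<close>.\<close>

definition l2_space :: "(real \<Rightarrow> complex) set" where
  "l2_space = {f. f \<in> borel_measurable lebesgue \<and> integrable lebesgue (\<lambda>t. (cmod (f t))\<^sup>2)}"

definition l2_inner :: "(real \<Rightarrow> complex) \<Rightarrow> (real \<Rightarrow> complex) \<Rightarrow> complex" where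
  "l2_inner f g = (LINT t|lebesgue. cnj (f t) * g t)"

definition fourier_integral :: "(real \<Rightarrow> complex) \<Rightarrow> real \<Rightarrow> complex" where
  "fourier_integral f \<omega> =
     (LINT t|lebesgue. f t * exp (- (\<i> * complex_of_real \<omega> * complex_of_real t)))"

text \<open>\<open>F\<close> is (a representative of) the Fourier transform of \<open>f\<close>: given by the Fourier integral
  if \<open>f\<close> is integrable, and by the mean-square limit of the Fourier integrals of the truncations
  of \<open>f\<close> to \<open>[-n, n]\<close> if \<open>f\<close> is square-integrable. By Plancherel the two clauses agree almost
  everywhere when both apply.\<close>

definition has_fourier_transform :: "(real \<Rightarrow> complex) \<Rightarrow> (real \<Rightarrow> complex) \<Rightarrow> bool" where
  "has_fourier_transform f F \<longleftrightarrow>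
     (integrable lebesgue f \<and> (AE \<omega> in lebesgue. F \<omega> = fourier_integral f \<omega>)) \<or>
     (f \<in> l2_space \<and> F \<in> l2_space \<and>
      (\<lambda>n::nat. LINT \<omega>|lebesgue.
          (cmod (F \<omega> - fourier_integral (\<lambda>t. indicator {- real n..real n} t * f t) \<omega>))\<^sup>2)
        \<longlonglongrightarrow> 0)"


section \<open>Inner product spaces of functions\<close>

text \<open>Inner products are conjugate-linear in the first argument.\<close>

definition ip_norm :: "(('a \<Rightarrow> complex) \<Rightarrow> ('a \<Rightarrow> complex) \<Rightarrow> complex) \<Rightarrow> ('a \<Rightarrow> complex) \<Rightarrow> real"
  where "ip_norm ip f = sqrt (Re (ip f f))"

text \<open>An orthonormal family whose finite linear combinations are dense.\<close>

definition orthonormal_basis ::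
    "('a \<Rightarrow> complex) set \<Rightarrow> (('a \<Rightarrow> complex) \<Rightarrow> ('a \<Rightarrow> complex) \<Rightarrow> complex) \<Rightarrow>
     'i set \<Rightarrow> ('i \<Rightarrow> 'a \<Rightarrow> complex) \<Rightarrow> bool" where
  "orthonormal_basis V ip I e \<longleftrightarrow>
     (\<forall>m\<in>I. e m \<in> V) \<and>
     (\<forall>m\<in>I. \<forall>n\<in>I. ip (e m) (e n) = (if m = n then 1 else 0)) \<and>
     (\<forall>f\<in>V. \<forall>\<epsilon>>0. \<exists>J c. finite J \<and> J \<subseteq> I \<and>
        ip_norm ip (\<lambda>x. f x - (\<Sum>m\<in>J. c m * e m x)) < \<epsilon>)"


section \<open>Positive-definite kernels and reproducing kernel Hilbert spaces\<close>

text \<open>Positive definiteness is meant in the non-strict sense customary for reproducing kernels.\<close>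

definition symmetric_kernel :: "('a \<Rightarrow> 'a \<Rightarrow> real) \<Rightarrow> bool" where
  "symmetric_kernel r \<longleftrightarrow> (\<forall>t u. r t u = r u t)"

definition positive_definite_kernel :: "('a \<Rightarrow> 'a \<Rightarrow> real) \<Rightarrow> bool" where
  "positive_definite_kernel r \<longleftrightarrow>
     (\<forall>S a. finite S \<longrightarrow> (\<Sum>t\<in>S. \<Sum>u\<in>S. a t * a u * r t u) \<ge> 0)"

locale rkhs =
  fixes H :: "('a \<Rightarrow> complex) set"
    and ip :: "('a \<Rightarrow> complex) \<Rightarrow> ('a \<Rightarrow> complex) \<Rightarrow> complex"
    and k :: "'a \<Rightarrow> 'a \<Rightarrow> complex"
  assumes zero_mem: "(\<lambda>x. 0) \<in> H"
    and add_mem: "\<lbrakk>f \<in> H; g \<in> H\<rbrakk> \<Longrightarrow> (\<lambda>x. f x + g x) \<in> H"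
    and scale_mem: "f \<in> H \<Longrightarrow> (\<lambda>x. c * f x) \<in> H"
    and ip_commute: "\<lbrakk>f \<in> H; g \<in> H\<rbrakk> \<Longrightarrow> ip f g = cnj (ip g f)"
    and ip_add_right: "\<lbrakk>f \<in> H; g \<in> H; g' \<in> H\<rbrakk> \<Longrightarrow> ip f (\<lambda>x. g x + g' x) = ip f g + ip f g'"
    and ip_scale_right: "\<lbrakk>f \<in> H; g \<in> H\<rbrakk> \<Longrightarrow> ip f (\<lambda>x. c * g x) = c * ip f g"
    and ip_ge_zero: "f \<in> H \<Longrightarrow> Re (ip f f) \<ge> 0"
    and ip_eq_zero: "\<lbrakk>f \<in> H; ip f f = 0\<rbrakk> \<Longrightarrow> f = (\<lambda>x. 0)"
    and complete: "\<lbrakk>\<And>n::nat. s n \<in> H;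
          \<And>\<epsilon>. \<epsilon> > 0 \<Longrightarrow> \<exists>N. \<forall>m\<ge>N. \<forall>n\<ge>N. ip_norm ip (\<lambda>x. s m x - s n x) < \<epsilon>\<rbrakk>
        \<Longrightarrow> \<exists>f\<in>H. (\<lambda>n. ip_norm ip (\<lambda>x. s n x - f x)) \<longlonglongrightarrow> 0"
    and kernel_mem: "(\<lambda>s. k s t) \<in> H"
    and reproducing: "f \<in> H \<Longrightarrow> ip (\<lambda>s. k s t) f = f t"

definition convolution :: "(real \<Rightarrow> complex) \<Rightarrow> (real \<Rightarrow> complex) \<Rightarrow> real \<Rightarrow> complex" where
  "convolution h g t = (LINT \<tau>|lebesgue. h (t - \<tau>) * g \<tau>)"

end

theory Submission
  imports "HOL-Probability.Levy" Defs
begin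

text \<open>
  The kernel factors through \<^const>\<open>l2_space\<close>. Put \<open>\<eta> t \<tau> = cnj (h (t - \<tau>))\<close>; then the convolution of \<open>h\<close>
  with \<open>f\<close> at \<open>t\<close> is the inner product of \<open>\<eta> t\<close> with \<open>f\<close>. By Plancherel's identity, the inner product of
  \<open>\<eta> t\<close> with \<open>\<eta> u\<close> is \<open>1 / (2 * pi)\<close> times the integral of \<open>\<bar>h_hat \<omega>\<bar>\<^sup>2 * exp (i \<omega> (t - u))\<close>. Since
  \<open>\<bar>h_hat\<bar>\<^sup>2\<close> is the Fourier transform of \<open>\<Phi>\<close>, this is \<open>\<Phi> (t - u) = r t u\<close> (\<open>reflected_conjugate_inner\<close>).

  The expansion of the kernel is then Parseval's identity for \<open>\<eta> t\<close> and \<open>\<eta> u\<close> in the basis \<open>\<phi>\<close>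
  (\<open>kernel_expansion\<close>). The vectors \<open>\<eta> u\<close> and the kernel sections \<open>r \<cdot> u\<close> have the same inner products, and
  convolution with \<open>h\<close> maps the former to the latter. If the transform of \<open>\<Phi>\<close> vanishes almost nowhere,
  the \<open>\<eta> t\<close> are total, since a function whose convolution with \<open>h\<close> is zero has transform zero;
  convolution with \<open>h\<close> is then an isometry onto a dense part of \<open>H\<close> and carries the orthonormal basis
  \<open>\<phi>\<close> to one of \<open>H\<close> (\<open>transform_orthonormal_basis\<close>). The transform of the convolution is a product
  because the convolution is the inverse transform of \<open>h_hat * \<phi>_hat\<close> (\<open>plancherel_pair_convolution\<close>).

  The Fourier analysis rests on Gaussians. An integrable function is determined by its Fourier
  integral, by Levy's uniqueness theorem for characteristic functions; hence modulated Gaussians are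
  total among the square-integrable functions, and, the latter forming a complete space, their span
  is dense. On this span Plancherel's identity is a computation, and it extends by continuity. All
  identifications of transforms (of an integrable function, of an inverse transform, of a function
  only known to be integrable) compare pairings with modulated Gaussians through the multiplication
  formula. Damping with a Gaussian also shows that a nonnegative Fourier transform of a bounded
  integrable function is integrable (\<open>nonneg_fourier_integral_integrable\<close>). This puts \<open>h\<close> into
  \<^const>\<open>l2_space\<close> when \<open>h\<close> is only assumed integrable, and it justifies the inversion formula for \<open>\<Phi>\<close>.
\<close>

section \<open>Semi-inner product spaces of functions\<close>

lemma orthonormal_basisD:
  assumes "orthonormal_basis V ip I e"
  shows "m \<in> I \<Longrightarrow> e m \<in> V"
    and "\<lbrakk>m \<in> I; n \<in> I\<rbrakk> \<Longrightarrow> ip (e m) (e n) = (if m = n then 1 else 0)"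
    and "\<lbrakk>f \<in> V; \<epsilon> > 0\<rbrakk> \<Longrightarrow> \<exists>J c. finite J \<and> J \<subseteq> I \<and> ip_norm ip (\<lambda>x. f x - (\<Sum>m\<in>J. c m * e m x)) < \<epsilon>"
proof -
  note onb = assms[unfolded orthonormal_basis_def]
  show "m \<in> I \<Longrightarrow> e m \<in> V" by (rule bspec[OF conjunct1[OF onb]])
  show "\<lbrakk>m \<in> I; n \<in> I\<rbrakk> \<Longrightarrow> ip (e m) (e n) = (if m = n then 1 else 0)"
    by (rule bspec[OF bspec[OF conjunct1[OF conjunct2[OF onb]]]])
  show "\<lbrakk>f \<in> V; \<epsilon> > 0\<rbrakk> \<Longrightarrow> \<exists>J c. finite J \<and> J \<subseteq> I \<and> ip_norm ip (\<lambda>x. f x - (\<Sum>m\<in>J. c m * e m x)) < \<epsilon>"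
    by (rule bspec[OF conjunct2[OF conjunct2[OF onb]], rule_format])
qed

text \<open>The form is only semidefinite: square-integrable functions are representatives of their
  almost-everywhere classes, so that a nonzero function may have norm zero. The same development
  then serves both \<^const>\<open>l2_space\<close> and a reproducing kernel Hilbert space.\<close>

locale semi_inner_space =
  fixes X :: "('a \<Rightarrow> complex) set"
    and ip :: "('a \<Rightarrow> complex) \<Rightarrow> ('a \<Rightarrow> complex) \<Rightarrow> complex"
  assumes zero_in: "(\<lambda>x. 0) \<in> X"
    and add_in: "\<lbrakk>f \<in> X; g \<in> X\<rbrakk> \<Longrightarrow> (\<lambda>x. f x + g x) \<in> X"
    and scale_in: "f \<in> X \<Longrightarrow> (\<lambda>x. c * f x) \<in> X"
    and ip_sym: "\<lbrakk>f \<in> X; g \<in> X\<rbrakk> \<Longrightarrow> ip f g = cnj (ip g f)"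
    and add_right: "\<lbrakk>f \<in> X; g \<in> X; g' \<in> X\<rbrakk> \<Longrightarrow> ip f (\<lambda>x. g x + g' x) = ip f g + ip f g'"
    and scale_right: "\<lbrakk>f \<in> X; g \<in> X\<rbrakk> \<Longrightarrow> ip f (\<lambda>x. c * g x) = c * ip f g"
    and ge_zero: "f \<in> X \<Longrightarrow> Re (ip f f) \<ge> 0"
begin

lemma diff_in: "\<lbrakk>f \<in> X; g \<in> X\<rbrakk> \<Longrightarrow> (\<lambda>x. f x - g x) \<in> X"
  using add_in[of f "\<lambda>x. - 1 * g x"] scale_in[of g "-1"] by simp

lemma diff_right: "\<lbrakk>f \<in> X; g \<in> X; g' \<in> X\<rbrakk> \<Longrightarrow> ip f (\<lambda>x. g x - g' x) = ip f g - ip f g'"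
  using add_right[of f g "\<lambda>x. - 1 * g' x"] scale_in[of g' "-1"] scale_right[of f g' "-1"] by simp

lemma zero_right: "f \<in> X \<Longrightarrow> ip f (\<lambda>x. 0) = 0"
  using scale_right[of f "\<lambda>x. 0" 0] zero_in by simp

lemma add_left: "\<lbrakk>f \<in> X; g \<in> X; g' \<in> X\<rbrakk> \<Longrightarrow> ip (\<lambda>x. g x + g' x) f = ip g f + ip g' f"
  using add_in[of g g'] add_right[of f g g'] ip_sym[of "\<lambda>x. g x + g' x" f] ip_sym[of g f]
    ip_sym[of g' f] by simp

lemma diff_left: "\<lbrakk>f \<in> X; g \<in> X; g' \<in> X\<rbrakk> \<Longrightarrow> ip (\<lambda>x. g x - g' x) f = ip g f - ip g' f"
  using diff_in[of g g'] diff_right[of f g g'] ip_sym[of "\<lambda>x. g x - g' x" f] ip_sym[of g f]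
    ip_sym[of g' f] by simp

lemma scale_left: "\<lbrakk>f \<in> X; g \<in> X\<rbrakk> \<Longrightarrow> ip (\<lambda>x. c * g x) f = cnj c * ip g f"
  using scale_in[of g c] scale_right[of f g c] ip_sym[of "\<lambda>x. c * g x" f] ip_sym[of g f]
  by simp

lemma zero_left: "f \<in> X \<Longrightarrow> ip (\<lambda>x. 0) f = 0"
  using ip_sym[of "\<lambda>x. 0" f] zero_right zero_in by simp

lemma self_real: "f \<in> X \<Longrightarrow> ip f f = of_real (Re (ip f f))"
  using ip_sym[of f f] by (simp add: complex_eq_iff)

lemma norm_nonneg: "f \<in> X \<Longrightarrow> ip_norm ip f \<ge> 0"
  by (simp add: ip_norm_def ge_zero)

lemma norm_sq: "f \<in> X \<Longrightarrow> (ip_norm ip f)\<^sup>2 = Re (ip f f)"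
  by (simp add: ip_norm_def ge_zero)

lemma self_eq_norm_sq: "f \<in> X \<Longrightarrow> ip f f = of_real ((ip_norm ip f)\<^sup>2)"
  by (simp only: norm_sq) (rule self_real)

lemma norm_sq_diff_scale:
  assumes "f \<in> X" "g \<in> X"
  shows "(ip_norm ip (\<lambda>x. f x - c * g x))\<^sup>2 =
    (ip_norm ip f)\<^sup>2 - 2 * Re (c * ip f g) + (cmod c)\<^sup>2 * (ip_norm ip g)\<^sup>2"
proof -
  have cg: "(\<lambda>x. c * g x) \<in> X" using assms scale_in by blast
  have "ip (\<lambda>x. f x - c * g x) (\<lambda>x. f x - c * g x)
      = ip f f - c * ip f g - cnj c * ip g f + (cnj c * c) * ip g g"
    using assms cg diff_in[OF assms(1) cg]
    by (simp add: diff_right diff_left scale_right scale_left algebra_simps)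
  moreover have "cnj c * ip g f = cnj (c * ip f g)"
    using ip_sym[OF assms(2,1)] by simp
  moreover have "cnj c * c = of_real ((cmod c)\<^sup>2)"
    using complex_norm_square[of c] by (simp add: mult.commute)
  moreover note self_eq_norm_sq[OF assms(1)] self_eq_norm_sq[OF assms(2)]
  ultimately have "Re (ip (\<lambda>x. f x - c * g x) (\<lambda>x. f x - c * g x)) =
    (ip_norm ip f)\<^sup>2 - 2 * Re (c * ip f g) + (cmod c)\<^sup>2 * (ip_norm ip g)\<^sup>2"
    by simp
  thus ?thesis using norm_sq[OF diff_in[OF assms(1) cg]] by simp
qed

text \<open>With \<open>a = \<langle>u, p\<rangle>\<close>, subtracting \<open>s a u\<close> from \<open>p\<close> changes the squared norm of \<open>p\<close> by
  \<open>- 2 s \<bar>a\<bar>\<^sup>2 + s\<^sup>2 \<bar>a\<bar>\<^sup>2 \<parallel>u\<parallel>\<^sup>2\<close>, which is negative for small positive \<open>s\<close> unless \<open>a = 0\<close>.\<close>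

lemma orthogonal_if_shortest:
  assumes "p \<in> X" "u \<in> X"
    and shortest: "\<And>c. ip_norm ip p \<le> ip_norm ip (\<lambda>x. p x - c * u x)"
  shows "ip u p = 0"
proof (rule ccontr)
  assume ne: "ip u p \<noteq> 0"
  define a where "a = ip u p"
  define Q where "Q = (ip_norm ip u)\<^sup>2"
  have Q: "Q \<ge> 0" by (simp add: Q_def)
  have a: "ip p u = cnj a" using ip_sym[OF assms(1,2)] by (simp add: a_def)
  \<comment> \<open>any positive \<open>s\<close> with \<open>s * Q < 2\<close> serves; the summand 1 covers the case \<open>Q = 0\<close>\<close>
  define s where "s = 1 / (1 + Q)"
  have s: "s > 0" using Q by (simp add: s_def)
  have "(ip_norm ip p)\<^sup>2 \<le> (ip_norm ip (\<lambda>x. p x - (of_real s * a) * u x))\<^sup>2"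
    using shortest[of "of_real s * a"] norm_nonneg[OF assms(1)] by (rule power_mono)
  also have "\<dots> = (ip_norm ip p)\<^sup>2 - 2 * (s * (cmod a)\<^sup>2) + s\<^sup>2 * (cmod a)\<^sup>2 * Q"
  proof -
    have "of_real s * a * ip p u = of_real (s * (cmod a)\<^sup>2)"
      unfolding a using complex_norm_square[of a] by (simp add: mult.assoc)
    hence "Re (of_real s * a * ip p u) = s * (cmod a)\<^sup>2"
      by (simp only: Re_complex_of_real)
    moreover have "(cmod (of_real s * a))\<^sup>2 = s\<^sup>2 * (cmod a)\<^sup>2"
      by (simp add: norm_mult power_mult_distrib)
    ultimately show ?thesis
      using norm_sq_diff_scale[OF assms(1,2), of "of_real s * a"] by (simp only: Q_def)
  qed
  finally have "2 * (s * (cmod a)\<^sup>2) \<le> s\<^sup>2 * (cmod a)\<^sup>2 * Q" by simp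
  hence "s * (cmod a)\<^sup>2 * 2 \<le> s * (cmod a)\<^sup>2 * (s * Q)" by (simp add: power2_eq_square ac_simps)
  moreover have "s * (cmod a)\<^sup>2 > 0" using s ne by (simp add: a_def)
  ultimately have "2 \<le> s * Q" by (simp only: mult_le_cancel_left_pos)
  moreover have "s * Q \<le> 1" using Q by (simp add: s_def)
  ultimately show False by simp
qed

lemma Cauchy_Schwarz:
  assumes "f \<in> X" "g \<in> X"
  shows "cmod (ip f g) \<le> ip_norm ip f * ip_norm ip g"
proof (cases "ip_norm ip g = 0")
  case True
  \<comment> \<open>a vector of norm zero need not vanish, but it is shortest on every line through it\<close>
  have "ip f g = 0"
    by (rule orthogonal_if_shortest[OF assms(2,1)])
       (use True norm_nonneg[OF diff_in[OF assms(2) scale_in[OF assms(1)]]] in simp)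
  thus ?thesis using True by simp
next
  case False
  \<comment> \<open>expand the nonnegative squared norm of \<open>f - (cnj a / Q) g\<close>, the part of \<open>f\<close> orthogonal to \<open>g\<close>\<close>
  define Q where "Q = (ip_norm ip g)\<^sup>2"
  have Q: "Q > 0" using False by (simp add: Q_def)
  define a where "a = ip f g"
  have eq: "cnj a / of_real Q * a = of_real ((cmod a)\<^sup>2 / Q)"
    using complex_norm_square[of a] by (simp add: mult.commute)
  have "0 \<le> (ip_norm ip f)\<^sup>2 - 2 * Re (cnj a / of_real Q * a) + (cmod (cnj a / of_real Q))\<^sup>2 * Q"
    unfolding Q_def a_def by (subst norm_sq_diff_scale[OF assms, symmetric]) (rule zero_le_power2)
  also have "\<dots> = (ip_norm ip f)\<^sup>2 - (cmod a)\<^sup>2 / Q"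
    unfolding eq using Q by (simp add: norm_divide power_divide power2_eq_square field_simps)
  finally have "(cmod a)\<^sup>2 / Q \<le> (ip_norm ip f)\<^sup>2" by simp
  hence "(cmod a)\<^sup>2 \<le> (ip_norm ip f)\<^sup>2 * Q" by (simp only: pos_divide_le_eq[OF Q])
  hence "(cmod a)\<^sup>2 \<le> (ip_norm ip f * ip_norm ip g)\<^sup>2"
    by (simp only: Q_def power_mult_distrib)
  thus ?thesis unfolding a_def
    by (rule power2_le_imp_le) (intro mult_nonneg_nonneg norm_nonneg assms)
qed

lemma norm_scale: "f \<in> X \<Longrightarrow> ip_norm ip (\<lambda>x. c * f x) = cmod c * ip_norm ip f"
proof -
  assume f: "f \<in> X"
  have "(ip_norm ip (\<lambda>x. c * f x))\<^sup>2 = (cmod c * ip_norm ip f)\<^sup>2"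
    using norm_sq_diff_scale[OF zero_in f, of "-c"] zero_left[OF f] zero_left[OF zero_in]
    by (simp add: ip_norm_def power_mult_distrib)
  thus ?thesis
    using norm_nonneg[OF f] norm_nonneg[OF scale_in[OF f]] by (simp add: power2_eq_iff_nonneg)
qed

lemma norm_minus_commute:
  assumes "f \<in> X" "g \<in> X"
  shows "ip_norm ip (\<lambda>x. f x - g x) = ip_norm ip (\<lambda>x. g x - f x)"
  using norm_scale[OF diff_in[OF assms], of "-1"] by simp

lemma norm_triangle:
  assumes "f \<in> X" "g \<in> X"
  shows "ip_norm ip (\<lambda>x. f x + g x) \<le> ip_norm ip f + ip_norm ip g"
proof -
  have "(ip_norm ip (\<lambda>x. f x + g x))\<^sup>2 = (ip_norm ip f)\<^sup>2 + 2 * Re (ip f g) + (ip_norm ip g)\<^sup>2"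
    using norm_sq_diff_scale[OF assms, of "-1"] by simp
  also have "\<dots> \<le> (ip_norm ip f)\<^sup>2 + 2 * (ip_norm ip f * ip_norm ip g) + (ip_norm ip g)\<^sup>2"
    using Cauchy_Schwarz[OF assms] complex_Re_le_cmod[of "ip f g"] by linarith
  also have "\<dots> = (ip_norm ip f + ip_norm ip g)\<^sup>2" by (simp add: power2_eq_square algebra_simps)
  finally show ?thesis
    by (rule power2_le_imp_le) (intro add_nonneg_nonneg norm_nonneg assms)
qed

lemma norm_triangle_diff:
  assumes "f \<in> X" "g \<in> X" "k \<in> X"
  shows "ip_norm ip (\<lambda>x. f x - g x) \<le> ip_norm ip (\<lambda>x. f x - k x) + ip_norm ip (\<lambda>x. k x - g x)"
proof -
  have "(\<lambda>x. f x - g x) = (\<lambda>x. (f x - k x) + (k x - g x))" by (simp add: fun_eq_iff)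
  thus ?thesis using norm_triangle[OF diff_in[OF assms(1,3)] diff_in[OF assms(3,2)]] by (simp only:)
qed

definition converges_to :: "(nat \<Rightarrow> 'a \<Rightarrow> complex) \<Rightarrow> ('a \<Rightarrow> complex) \<Rightarrow> bool" where
  "converges_to s f \<longleftrightarrow> (\<forall>n. s n \<in> X) \<and> f \<in> X \<and> (\<lambda>n. ip_norm ip (\<lambda>x. s n x - f x)) \<longlonglongrightarrow> 0"

lemma converges_to_diff:
  assumes "converges_to s f" "converges_to s' f'"
  shows "converges_to (\<lambda>n x. s n x - s' n x) (\<lambda>x. f x - f' x)"
proof -
  have m: "s n \<in> X" "s' n \<in> X" "f \<in> X" "f' \<in> X" for n
    using assms by (auto simp: converges_to_def)
  have "(\<lambda>n. ip_norm ip (\<lambda>x. s n x - s' n x - (f x - f' x))) \<longlonglongrightarrow> 0"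
  proof (rule tendsto_sandwich[where f = "\<lambda>_. 0"])
    show "\<forall>\<^sub>F n in sequentially. ip_norm ip (\<lambda>x. s n x - s' n x - (f x - f' x)) \<le>
      ip_norm ip (\<lambda>x. s n x - f x) + ip_norm ip (\<lambda>x. s' n x - f' x)"
    proof (rule always_eventually, rule allI)
      fix n
      have "ip_norm ip (\<lambda>x. (s n x - f x) + (f' x - s' n x)) \<le>
          ip_norm ip (\<lambda>x. s n x - f x) + ip_norm ip (\<lambda>x. f' x - s' n x)"
        by (intro norm_triangle diff_in m)
      thus "ip_norm ip (\<lambda>x. s n x - s' n x - (f x - f' x)) \<le>
          ip_norm ip (\<lambda>x. s n x - f x) + ip_norm ip (\<lambda>x. s' n x - f' x)"
        unfolding norm_minus_commute[OF m(4) m(2)[of n]]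
        by (rule back_subst[where P = "\<lambda>f. ip_norm ip f \<le> _"]) auto
    qed
    show "(\<lambda>n. ip_norm ip (\<lambda>x. s n x - f x) + ip_norm ip (\<lambda>x. s' n x - f' x)) \<longlonglongrightarrow> 0"
      using tendsto_add[of _ 0 _ _ 0] assms by (auto simp: converges_to_def)
  qed (auto intro!: always_eventually norm_nonneg diff_in m)
  thus ?thesis using m by (auto simp: converges_to_def intro: diff_in)
qed

lemma converges_to_ip:
  assumes "converges_to s f" "converges_to s' f'"
  shows "(\<lambda>n. ip (s n) (s' n)) \<longlonglongrightarrow> ip f f'"
proof -
  have m: "s n \<in> X" "s' n \<in> X" "f \<in> X" "f' \<in> X" for n
    using assms by (auto simp: converges_to_def)
  let ?d = "\<lambda>n x. s n x - f x" and ?d' = "\<lambda>n x. s' n x - f' x"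
  have lim: "(\<lambda>n. ip_norm ip (?d n)) \<longlonglongrightarrow> 0" "(\<lambda>n. ip_norm ip (?d' n)) \<longlonglongrightarrow> 0"
    using assms by (auto simp: converges_to_def)
  have tri: "norm (a + b + c) \<le> norm a + norm b + norm c" for a b c :: complex
    using norm_triangle_ineq[of "a + b" c] norm_triangle_ineq[of a b] by linarith
  have "(\<lambda>n. ip (s n) (s' n) - ip f f') \<longlonglongrightarrow> 0"
  proof (rule Lim_null_comparison)
    show "\<forall>\<^sub>F n in sequentially. norm (ip (s n) (s' n) - ip f f') \<le>
      ip_norm ip (?d n) * ip_norm ip (?d' n) + ip_norm ip (?d n) * ip_norm ip f'
          + ip_norm ip f * ip_norm ip (?d' n)"
    proof (rule always_eventually, rule allI)
      fix n
      have d: "?d n \<in> X" "?d' n \<in> X" by (intro diff_in m)+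
      have eq: "ip (s n) (s' n) - ip f f' = ip (?d n) (?d' n) + ip (?d n) f' + ip f (?d' n)"
        using m d by (simp add: diff_left diff_right)
      show "norm (ip (s n) (s' n) - ip f f') \<le>
          ip_norm ip (?d n) * ip_norm ip (?d' n) + ip_norm ip (?d n) * ip_norm ip f' +
          ip_norm ip f * ip_norm ip (?d' n)"
        unfolding eq
        by (rule order_trans[OF tri
              add_mono[OF add_mono[OF Cauchy_Schwarz[OF d] Cauchy_Schwarz[OF d(1) m(4)]]
                Cauchy_Schwarz[OF m(3) d(2)]]])
    qed
    show "(\<lambda>n. ip_norm ip (?d n) * ip_norm ip (?d' n) + ip_norm ip (?d n) * ip_norm ip f'
        + ip_norm ip f * ip_norm ip (?d' n)) \<longlonglongrightarrow> 0"
      using lim by (auto intro!: tendsto_eq_intros)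
  qed
  thus ?thesis by (simp only: LIM_zero_iff)
qed

lemma converges_to_const: "f \<in> X \<Longrightarrow> converges_to (\<lambda>n. f) f"
  using zero_left[OF zero_in] by (simp add: converges_to_def ip_norm_def)

lemma converges_to_norm:
  assumes "converges_to s f"
  shows "(\<lambda>n. ip_norm ip (s n)) \<longlonglongrightarrow> ip_norm ip f"
  unfolding ip_norm_def using converges_to_ip[OF assms assms] by (intro tendsto_intros)

lemma Cauchy_if_converges_to:
  assumes s: "converges_to s f" and e: "\<epsilon> > 0"
  shows "\<exists>N. \<forall>m\<ge>N. \<forall>n\<ge>N. ip_norm ip (\<lambda>x. s m x - s n x) < \<epsilon>"
proof -
  have m: "s n \<in> X" "f \<in> X" for n
    using assms by (auto simp: converges_to_def)
  have "\<forall>\<^sub>F n in sequentially. ip_norm ip (\<lambda>x. s n x - f x) < \<epsilon> / 2"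
    using s e by (intro order_tendstoD(2)[where y = 0]) (auto simp: converges_to_def)
  then obtain N where N: "ip_norm ip (\<lambda>x. s n x - f x) < \<epsilon> / 2" if "n \<ge> N" for n
    by (auto simp: eventually_sequentially)
  have "ip_norm ip (\<lambda>x. s i x - s j x) < \<epsilon>" if "i \<ge> N" "j \<ge> N" for i j
    using norm_triangle_diff[OF m(1)[of i] m(1)[of j] m(2)] N[OF that(1)] N[OF that(2)]
      norm_minus_commute[OF m(2) m(1)[of j]] by linarith
  thus ?thesis by blast
qed

lemma lincomb_in:
  assumes "finite J" "\<And>m. m \<in> J \<Longrightarrow> e m \<in> X"
  shows "(\<lambda>x. \<Sum>m\<in>J. c m * e m x) \<in> X"
  using assms by (induction J) (auto intro!: zero_in add_in scale_in)

lemma lincomb_right: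
  assumes "finite J" "\<And>m. m \<in> J \<Longrightarrow> e m \<in> X" "f \<in> X"
  shows "ip f (\<lambda>x. \<Sum>m\<in>J. c m * e m x) = (\<Sum>m\<in>J. c m * ip f (e m))"
  using assms
  by (induction J) (simp_all add: zero_right add_right scale_right lincomb_in scale_in)

lemma lincomb_left:
  assumes "finite J" "\<And>m. m \<in> J \<Longrightarrow> e m \<in> X" "f \<in> X"
  shows "ip (\<lambda>x. \<Sum>m\<in>J. c m * e m x) f = (\<Sum>m\<in>J. cnj (c m) * ip (e m) f)"
  using assms
  by (induction J) (simp_all add: zero_left add_left scale_left lincomb_in scale_in)

text \<open>The residual of the partial Fourier sum over \<open>J'\<close> is orthogonal to every \<open>e m\<close> with \<open>m \<in> J'\<close>,
  so any other combination of these vectors has a longer residual by Pythagoras. A combination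
  over \<open>J \<subseteq> J'\<close> is one over \<open>J'\<close> with zero coefficients outside \<open>J\<close>.\<close>

lemma Fourier_coefficients_optimal:
  assumes onb: "orthonormal_basis X ip I e" and J: "finite J" "J \<subseteq> J'" "finite J'" "J' \<subseteq> I"
    and f: "f \<in> X"
  shows "ip_norm ip (\<lambda>x. f x - (\<Sum>m\<in>J'. ip (e m) f * e m x)) \<le>
         ip_norm ip (\<lambda>x. f x - (\<Sum>m\<in>J. c m * e m x))"
proof -
  have e: "e m \<in> X" if "m \<in> J'" for m
    by (rule orthonormal_basisD(1)[OF onb]) (use J(4) that in auto)
  have ee: "ip (e m) (e n) = (if m = n then 1 else 0)" if "m \<in> J'" "n \<in> J'" for m n
    by (rule orthonormal_basisD(2)[OF onb]) (use J(4) that in auto)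
  define P where "P = (\<lambda>x. \<Sum>m\<in>J'. ip (e m) f * e m x)"
  define w where "w = (\<lambda>x. f x - P x)"
  define v where "v = (\<lambda>x. \<Sum>m\<in>J'. ((if m \<in> J then c m else 0) - ip (e m) f) * e m x)"
  have P: "P \<in> X" and v: "v \<in> X" unfolding P_def v_def by (intro lincomb_in J e; simp)+
  have w: "w \<in> X" unfolding w_def by (intro diff_in f P)
  have we: "ip w (e n) = 0" if n: "n \<in> J'" for n
  proof -
    have "ip P (e n) = (\<Sum>m\<in>J'. cnj (ip (e m) f) * ip (e m) (e n))"
      unfolding P_def using lincomb_left[OF J(3) e e[OF n]] by simp
    also have "\<dots> = (\<Sum>m\<in>J'. if m = n then cnj (ip (e n) f) else 0)"
      by (intro sum.cong) (auto simp: ee n)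
    also have "\<dots> = ip f (e n)" using n J(3) ip_sym[OF f e[OF n]] by simp
    finally show ?thesis unfolding w_def using diff_left[OF e[OF n] f P] by simp
  qed
  have "ip w v = 0"
    unfolding v_def using lincomb_right[OF J(3) e w] by (simp add: we)
  hence "(ip_norm ip (\<lambda>x. w x - 1 * v x))\<^sup>2 = (ip_norm ip w)\<^sup>2 + (ip_norm ip v)\<^sup>2"
    using norm_sq_diff_scale[OF w v, of 1] by simp
  moreover have "(\<lambda>x. w x - 1 * v x) = (\<lambda>x. f x - (\<Sum>m\<in>J. c m * e m x))"
  proof
    fix x
    have "(\<Sum>m\<in>J'. (if m \<in> J then c m else 0) * e m x) = (\<Sum>m\<in>J. c m * e m x)"
      using J by (intro sum.mono_neutral_cong_right) auto
    thus "w x - 1 * v x = f x - (\<Sum>m\<in>J. c m * e m x)"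
      by (simp add: w_def v_def P_def left_diff_distrib sum_subtractf)
  qed
  ultimately have "(ip_norm ip w)\<^sup>2 \<le> (ip_norm ip (\<lambda>x. f x - (\<Sum>m\<in>J. c m * e m x)))\<^sup>2"
    by simp
  moreover have "ip_norm ip (\<lambda>x. f x - (\<Sum>m\<in>J. c m * e m x)) \<ge> 0"
    using J e by (intro norm_nonneg diff_in f lincomb_in) (auto intro: finite_subset)
  ultimately have "ip_norm ip w \<le> ip_norm ip (\<lambda>x. f x - (\<Sum>m\<in>J. c m * e m x))"
    by (rule power2_le_imp_le)
  thus ?thesis by (simp add: w_def P_def)
qed

text \<open>The error of a finite partial sum is the inner product of \<open>g\<close> with a residual of \<open>f\<close>. Density
  makes one residual small, and optimality of the Fourier coefficients keeps the residuals of all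
  larger index sets small; this yields the unconditional sum.\<close>

lemma Parseval:
  assumes onb: "orthonormal_basis X ip I e" and f: "f \<in> X" and g: "g \<in> X"
  shows "((\<lambda>m. ip f (e m) * ip (e m) g) has_sum ip f g) I"
  unfolding has_sum_def
proof (rule tendstoI)
  fix \<epsilon> :: real assume \<epsilon>: "\<epsilon> > 0"
  have e: "e m \<in> X" if "m \<in> I" for m
    by (rule orthonormal_basisD(1)[OF onb that])
  define \<delta> where "\<delta> = \<epsilon> / (1 + ip_norm ip g)"
  have \<delta>: "\<delta> > 0" using \<epsilon> norm_nonneg[OF g] by (simp add: \<delta>_def)
  obtain J c where J: "finite J" "J \<subseteq> I" "ip_norm ip (\<lambda>x. f x - (\<Sum>m\<in>J. c m * e m x)) < \<delta>"
    using orthonormal_basisD(3)[OF onb f \<delta>] by blast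
  have "dist (\<Sum>m\<in>J'. ip f (e m) * ip (e m) g) (ip f g) < \<epsilon>"
    if J': "finite J'" "J \<subseteq> J'" "J' \<subseteq> I" for J'
  proof -
    define P where "P = (\<lambda>x. \<Sum>m\<in>J'. ip (e m) f * e m x)"
    have P: "P \<in> X" unfolding P_def using J' e by (intro lincomb_in) auto
    have "ip P g = (\<Sum>m\<in>J'. cnj (ip (e m) f) * ip (e m) g)"
      unfolding P_def using J' e g by (intro lincomb_left) auto
    also have "\<dots> = (\<Sum>m\<in>J'. ip f (e m) * ip (e m) g)"
      using J' e f by (intro sum.cong refl arg_cong2[where f = "(*)"] ip_sym[symmetric]) auto
    finally have "ip f g - (\<Sum>m\<in>J'. ip f (e m) * ip (e m) g) = ip (\<lambda>x. f x - P x) g"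
      using diff_left[OF g f P] by simp
    hence "dist (\<Sum>m\<in>J'. ip f (e m) * ip (e m) g) (ip f g) \<le> ip_norm ip (\<lambda>x. f x - P x) * ip_norm ip g"
      using Cauchy_Schwarz[OF diff_in[OF f P] g] by (simp add: dist_commute dist_norm)
    also have "\<dots> \<le> \<delta> * ip_norm ip g"
      using Fourier_coefficients_optimal[OF onb J(1) J'(2,1,3) f, of c] J(3) norm_nonneg[OF g]
      unfolding P_def by (intro mult_right_mono) auto
    also have "\<dots> < \<epsilon>" using \<epsilon> norm_nonneg[OF g] unfolding \<delta>_def by (simp add: field_simps)
    finally show ?thesis .
  qed
  thus "\<forall>\<^sub>F J in finite_subsets_at_top I. dist (\<Sum>m\<in>J. ip f (e m) * ip (e m) g) (ip f g) < \<epsilon>"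
    unfolding eventually_finite_subsets_at_top using J by blast
qed

end

section \<open>Spans and density in complete spaces\<close>

text \<open>Building linear combinations one term at a time turns bilinear identities on the span into
  inductions.\<close>

inductive_set fun_span :: "'i set \<Rightarrow> ('i \<Rightarrow> 'a \<Rightarrow> complex) \<Rightarrow> ('a \<Rightarrow> complex) set"
  for I e where
  zero: "(\<lambda>x. 0) \<in> fun_span I e"
| step: "\<lbrakk>w \<in> fun_span I e; i \<in> I\<rbrakk> \<Longrightarrow> (\<lambda>x. w x + c * e i x) \<in> fun_span I e"

lemma fun_span_add: "v \<in> fun_span I e \<Longrightarrow> w \<in> fun_span I e \<Longrightarrow> (\<lambda>x. w x + v x) \<in> fun_span I e"
proof (induction rule: fun_span.induct)
  case (step v i c)
  show ?case using fun_span.step[OF step.IH[OF step.prems] step.hyps(2), of c] by (simp add: add.assoc)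
qed simp

lemma fun_span_scale: "w \<in> fun_span I e \<Longrightarrow> (\<lambda>x. a * w x) \<in> fun_span I e"
proof (induction rule: fun_span.induct)
  case (step v i c)
  show ?case using fun_span.step[OF step.IH step.hyps(2), of "a * c"]
    by (simp add: distrib_left mult.assoc)
qed (simp add: fun_span.zero)

lemma fun_span_imp_lincomb:
  "w \<in> fun_span I e \<Longrightarrow> \<exists>J c. finite J \<and> J \<subseteq> I \<and> w = (\<lambda>x. \<Sum>m\<in>J. c m * e m x)"
proof (induction rule: fun_span.induct)
  case zero
  show ?case by (rule exI[of _ "{}"]) simp
next
  case (step w i d)
  then obtain J and c :: "_ \<Rightarrow> complex"
    where J: "finite J" "J \<subseteq> I" "w = (\<lambda>x. \<Sum>m\<in>J. c m * e m x)" by blast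
  define c' where "c' = (\<lambda>m. (if m \<in> J then c m else 0) + (if m = i then d else 0))"
  have "(\<Sum>m\<in>insert i J. c' m * e m x) = w x + d * e i x" for x
  proof -
    have "(\<Sum>m\<in>insert i J. c' m * e m x) =
        (\<Sum>m\<in>insert i J. (if m \<in> J then c m else 0) * e m x) + (\<Sum>m\<in>insert i J. (if m =
            i then d * e m x else 0))"
      unfolding c'_def by (subst sum.distrib[symmetric], intro sum.cong) (auto simp: distrib_right)
    also have "(\<Sum>m\<in>insert i J. (if m \<in> J then c m else 0) * e m x) = w x"
      unfolding J(3) using J(1) by (intro sum.mono_neutral_cong_right) auto
    also have "(\<Sum>m\<in>insert i J. (if m = i then d * e m x else 0)) = d * e i x"
      using J(1) by simp
    finally show ?thesis .
  qed
  thus ?case using J step.hyps(2) by (intro exI[of _ "insert i J"] exI[of _ c']) auto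
qed

context semi_inner_space
begin

lemma fun_span_subset: "(\<And>i. i \<in> I \<Longrightarrow> e i \<in> X) \<Longrightarrow> fun_span I e \<subseteq> X"
proof
  fix w assume e: "\<And>i. i \<in> I \<Longrightarrow> e i \<in> X" and "w \<in> fun_span I e"
  from this(2) show "w \<in> X"
  proof induction
    case (step w i c)
    show ?case by (rule add_in[OF step.IH scale_in[OF e[OF step.hyps(2)]]])
  qed (rule zero_in)
qed

end

locale semi_hilbert_space = semi_inner_space +
  assumes complete: "\<lbrakk>\<And>n::nat. s n \<in> X;
          \<And>\<epsilon>. \<epsilon> > 0 \<Longrightarrow> \<exists>N. \<forall>m\<ge>N. \<forall>n\<ge>N. ip_norm ip (\<lambda>x. s m x - s n x) < \<epsilon>\<rbrakk>
        \<Longrightarrow> \<exists>f\<in>X. (\<lambda>n. ip_norm ip (\<lambda>x. s n x - f x)) \<longlonglongrightarrow> 0"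
begin

lemma converges_to_if_Cauchy:
  assumes "\<And>n::nat. s n \<in> X"
      "\<And>\<epsilon>. \<epsilon> > 0 \<Longrightarrow> \<exists>N. \<forall>m\<ge>N. \<forall>n\<ge>N. ip_norm ip (\<lambda>x. s m x - s n x) < \<epsilon>"
  shows "\<exists>f. converges_to s f"
  using complete[OF assms] assms(1) by (auto simp: converges_to_def)

text \<open>The projection theorem in the form needed here. Residuals of a minimising sequence from the
  span are Cauchy by the parallelogram law; their limit \<open>p\<close> is shortest in every direction
  \<open>e i\<close>, hence orthogonal to the family, hence null.\<close>

lemma total_imp_dense:
  assumes e': "\<forall>i\<in>I. e i \<in> X"
    and total: "\<forall>p\<in>X. (\<forall>i\<in>I. ip (e i) p = 0) \<longrightarrow> ip_norm ip p = 0"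
    and f: "f \<in> X"
  shows "\<exists>v. (\<forall>n. v n \<in> fun_span I e) \<and> converges_to v f"
proof -
  have e: "e i \<in> X" if "i \<in> I" for i using e' that by blast
  define V where "V = fun_span I e"
  have V_X: "v \<in> X" if "v \<in> V" for v using fun_span_subset[of I e] e that by (auto simp: V_def)
  define N where "N = (\<lambda>v. (ip_norm ip (\<lambda>x. f x - v x))\<^sup>2)"
  define d where "d = Inf (N ` V)"
  have bdd: "bdd_below (N ` V)" unfolding N_def by (rule bdd_belowI2[of _ 0]) simp
  have ne: "N ` V \<noteq> {}" using fun_span.zero[of I e] by (auto simp: V_def)
  have d_le: "d \<le> N v" if "v \<in> V" for v
    unfolding d_def using that bdd by (intro cInf_lower) auto
  have "\<exists>v\<in>V. N v < d + 1 / (real n + 1)" for n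
  proof -
    have "d < d + 1 / (real n + 1)" by simp
    then obtain y where "y \<in> N ` V" "y < d + 1 / (real n + 1)"
      using ne cInf_lessD[of "N ` V"] unfolding d_def by blast
    thus ?thesis by auto
  qed
  then obtain v where v: "\<And>n. v n \<in> V" "\<And>n. N (v n) < d + 1 / (real n + 1)" by metis
  define s where "s = (\<lambda>n x. f x - v n x)"
  have s: "s n \<in> X" for n unfolding s_def using f V_X v(1) diff_in by auto
  have sN: "(ip_norm ip (s n))\<^sup>2 = N (v n)" for n by (simp add: s_def N_def)
  have par: "(ip_norm ip (\<lambda>x. s i x - s j x))\<^sup>2 \<le> 2 / (real i + 1) + 2 / (real j + 1)" for i j
  proof -
    \<comment> \<open>the midpoint of two competitors is again a competitor\<close>
    let ?m = "\<lambda>x. (1/2) * (v i x + v j x)"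
    have m: "?m \<in> V" unfolding V_def
      by (intro fun_span_scale fun_span_add) (use v(1) in \<open>auto simp: V_def\<close>)
    have sum_in: "(\<lambda>x. s i x + s j x) \<in> X" by (intro add_in s)
    have "(\<lambda>x. f x - ?m x) = (\<lambda>x. (1/2) * (s i x + s j x))"
      by (auto simp: s_def fun_eq_iff field_simps)
    hence "N ?m = (ip_norm ip (\<lambda>x. s i x + s j x))\<^sup>2 / 4"
      unfolding N_def using norm_scale[OF sum_in, of "1/2"] by (simp only:) (simp add: power_divide)
    hence "4 * d \<le> (ip_norm ip (\<lambda>x. s i x + s j x))\<^sup>2" using d_le[OF m] by simp
    moreover have "(ip_norm ip (\<lambda>x. s i x - s j x))\<^sup>2 + (ip_norm ip (\<lambda>x. s i x + s j x))\<^sup>2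
        = 2 * N (v i) + 2 * N (v j)"
      using norm_sq_diff_scale[OF s s, of i 1 j] norm_sq_diff_scale[OF s s, of i "-1" j] sN
      by simp
    ultimately show ?thesis using v(2)[of i] v(2)[of j] by simp
  qed
  have "\<exists>p. converges_to s p"
  proof (rule converges_to_if_Cauchy[OF s])
    fix \<epsilon> :: real assume \<epsilon>: "\<epsilon> > 0"
    obtain M :: nat where M: "4 / \<epsilon>\<^sup>2 < real M" using reals_Archimedean2 by blast
    have "ip_norm ip (\<lambda>x. s i x - s j x) < \<epsilon>" if "i \<ge> M" "j \<ge> M" for i j
    proof (rule power2_less_imp_less)
      have M0: "4 < \<epsilon>\<^sup>2 * (real M + 1)" using M \<epsilon> by (simp add: field_simps add_strict_increasing2)
      have "2 / (real i + 1) + 2 / (real j + 1) \<le> 2 / (real M + 1) + 2 / (real M + 1)"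
        using that by (intro add_mono divide_left_mono) auto
      also have "\<dots> = 4 / (real M + 1)" by (simp add: add_divide_distrib[symmetric])
      also have "\<dots> < \<epsilon>\<^sup>2" using M0 by (simp add: pos_divide_less_eq)
      finally show "(ip_norm ip (\<lambda>x. s i x - s j x))\<^sup>2 < \<epsilon>\<^sup>2" using par[of i j] by simp
    qed (use \<epsilon> in simp)
    thus "\<exists>M. \<forall>i\<ge>M. \<forall>j\<ge>M. ip_norm ip (\<lambda>x. s i x - s j x) < \<epsilon>" by blast
  qed
  then obtain p where p: "converges_to s p" ..
  have pX: "p \<in> X" using p by (simp add: converges_to_def)
  have "(\<lambda>n. N (v n)) \<longlonglongrightarrow> d"
  proof (rule tendsto_sandwich[where f = "\<lambda>_. d"])
    show "(\<lambda>n. d + 1 / (real n + 1)) \<longlonglongrightarrow> d"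
      using tendsto_add[OF tendsto_const[of d] LIMSEQ_inverse_real_of_nat]
      by (simp add: inverse_eq_divide add.commute)
  qed (use less_imp_le[OF v(2)] d_le[OF v(1)] in auto)
  moreover have "(\<lambda>n. N (v n)) \<longlonglongrightarrow> (ip_norm ip p)\<^sup>2"
    unfolding sN[symmetric] by (intro tendsto_intros converges_to_norm p)
  ultimately have pd: "(ip_norm ip p)\<^sup>2 = d" using LIMSEQ_unique by blast
  have "ip_norm ip p = 0"
  proof (rule total[rule_format, OF pX])
    fix i assume i: "i \<in> I"
    show "ip (e i) p = 0"
    proof (rule orthogonal_if_shortest[OF pX e[OF i]])
      fix c
      have ce: "(\<lambda>x. c * e i x) \<in> X" using e[OF i] scale_in by blast
      have lim: "(\<lambda>n. (ip_norm ip (\<lambda>x. s n x - c * e i x))\<^sup>2) \<longlonglongrightarrow> (ip_norm ip (\<lambda>x. p x - c * e i x))\<^sup>2"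
        by (intro tendsto_intros converges_to_norm converges_to_diff p converges_to_const ce)
      have "d \<le> (ip_norm ip (\<lambda>x. s n x - c * e i x))\<^sup>2" for n
        using d_le[of "\<lambda>x. v n x + c * e i x"] fun_span.step[of "v n" I e i c] v(1) i
        by (simp add: V_def N_def s_def diff_diff_eq)
      hence "(ip_norm ip p)\<^sup>2 \<le> (ip_norm ip (\<lambda>x. p x - c * e i x))\<^sup>2"
        unfolding pd by (intro LIMSEQ_le_const[OF lim]) auto
      thus "ip_norm ip p \<le> ip_norm ip (\<lambda>x. p x - c * e i x)"
        by (rule power2_le_imp_le) (intro norm_nonneg diff_in pX ce)
    qed
  qed
  hence "(\<lambda>n. ip_norm ip (s n)) \<longlonglongrightarrow> 0" using converges_to_norm[OF p] by simp
  moreover have "ip_norm ip (s n) = ip_norm ip (\<lambda>x. v n x - f x)" for n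
    unfolding s_def by (rule norm_minus_commute[OF f V_X[OF v(1)]])
  ultimately have "converges_to v f" using f V_X v(1) by (simp add: converges_to_def)
  thus ?thesis using v(1) by (auto simp: V_def)
qed

end

section \<open>Reproducing kernels from feature maps\<close>

lemma (in rkhs) semi_hilbert_space: "semi_hilbert_space H ip"
proof
  show "(\<lambda>x. 0) \<in> H" by (fact zero_mem)
  show "(\<lambda>x. f x + g x) \<in> H" if "f \<in> H" "g \<in> H" for f g by (rule add_mem[OF that])
  show "(\<lambda>x. c * f x) \<in> H" if "f \<in> H" for c f by (rule scale_mem[OF that])
  show "ip f g = cnj (ip g f)" if "f \<in> H" "g \<in> H" for f g by (rule ip_commute[OF that])
  show "ip f (\<lambda>x. g x + g' x) = ip f g + ip f g'" if "f \<in> H" "g \<in> H" "g' \<in> H" for f g g'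
    by (rule ip_add_right[OF that])
  show "ip f (\<lambda>x. c * g x) = c * ip f g" if "f \<in> H" "g \<in> H" for f c g
    by (rule ip_scale_right[OF that])
  show "Re (ip f f) \<ge> 0" if "f \<in> H" for f by (rule ip_ge_zero[OF that])
  show "\<exists>f\<in>H. (\<lambda>n. ip_norm ip (\<lambda>x. s n x - f x)) \<longlonglongrightarrow> 0"
    if "\<And>n. s n \<in> H"
      "\<And>\<epsilon>. \<epsilon> > 0 \<Longrightarrow> \<exists>N. \<forall>m\<ge>N. \<forall>n\<ge>N. ip_norm ip (\<lambda>x. s m x - s n x) < \<epsilon>"
    for s :: "nat \<Rightarrow> 'a \<Rightarrow> complex" by (rule complete[OF that])
qed

sublocale rkhs \<subseteq> hilbert: semi_hilbert_space H ip
  by (rule semi_hilbert_space)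

text \<open>A factorisation of the kernel \<open>k\<close> through a complete space \<open>X\<close>. Pairing with the feature vectors
  turns an element of \<open>X\<close> into a function on the index set of the kernel.\<close>

locale feature_map =
  X: semi_hilbert_space X xip + rkhs H ip k
  for X :: "('b \<Rightarrow> complex) set" and xip
    and H :: "('a \<Rightarrow> complex) set" and ip and k +
  fixes \<eta> :: "'a \<Rightarrow> 'b \<Rightarrow> complex"
  assumes feature_in: "\<eta> t \<in> X"
    and kernel_eq: "k t u = xip (\<eta> t) (\<eta> u)"
begin

definition transform :: "('b \<Rightarrow> complex) \<Rightarrow> 'a \<Rightarrow> complex" where
  "transform f = (\<lambda>t. xip (\<eta> t) f)"

text \<open>This is Parseval's identity for the inner product of two feature vectors.\<close>

lemma kernel_expansion:
  assumes "orthonormal_basis X xip I e"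
  shows "((\<lambda>m. cnj (transform (e m) t) * transform (e m) u) has_sum k u t) I"
proof -
  have "((\<lambda>m. xip (\<eta> u) (e m) * xip (e m) (\<eta> t)) has_sum k u t) I"
    unfolding kernel_eq by (rule X.Parseval[OF assms feature_in feature_in])
  moreover have "xip (\<eta> u) (e m) * xip (e m) (\<eta> t) = cnj (transform (e m) t) * transform (e m) u"
    if "m \<in> I" for m
  proof -
    have "e m \<in> X" by (rule orthonormal_basisD(1)[OF assms that])
    note sym = X.ip_sym[OF this feature_in[of t]]
    show ?thesis unfolding transform_def sym by (rule mult.commute)
  qed
  ultimately show ?thesis by (rule has_sum_cong[THEN iffD1, rotated])
qed

lemma transform_feature: "transform (\<eta> u) = (\<lambda>t. k t u)"
  by (simp add: transform_def kernel_eq)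

lemma transform_diff:
  assumes "f \<in> X" "g \<in> X"
  shows "transform (\<lambda>x. f x - g x) = (\<lambda>t. transform f t - transform g t)"
  using X.diff_right[OF feature_in assms] by (simp add: transform_def)

lemma transform_lincomb:
  assumes "finite J" "\<And>m. m \<in> J \<Longrightarrow> e m \<in> X"
  shows "transform (\<lambda>x. \<Sum>m\<in>J. c m * e m x) = (\<lambda>t. \<Sum>m\<in>J. c m * transform (e m) t)"
  using X.lincomb_right[OF assms feature_in] by (simp add: transform_def)

lemma span_in: "w \<in> fun_span UNIV \<eta> \<Longrightarrow> w \<in> X"
  using X.fun_span_subset[of UNIV \<eta>] feature_in by blast

lemma transform_span_step:
  assumes "w \<in> X"
  shows "transform (\<lambda>x. w x + c * \<eta> u x) = (\<lambda>t. transform w t + c * k t u)"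
proof
  fix t
  show "transform (\<lambda>x. w x + c * \<eta> u x) t = transform w t + c * k t u"
    unfolding transform_def kernel_eq
    using X.add_right[OF feature_in[of t] assms X.scale_in[OF feature_in[of u], of c]]
      X.scale_right[OF feature_in[of t] feature_in[of u], of c] by simp
qed

lemma transform_span_in:
  assumes "w \<in> fun_span UNIV \<eta>"
  shows "transform w \<in> H"
  using assms
proof induction
  case zero
  show ?case using zero_mem X.zero_right[OF feature_in] by (simp add: transform_def)
next
  case (step w u c)
  show ?case unfolding transform_span_step[OF span_in[OF step.hyps(1)]]
    by (rule add_mem[OF step.IH scale_mem[OF kernel_mem]])
qed

text \<open>The vectors \<open>\<eta> u\<close> in \<open>X\<close> and the kernel sections \<open>k \<cdot> u\<close> in \<open>H\<close> have the same Gram matrix \<open>k\<close>,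
  and the transform maps the former to the latter.\<close>

lemma transform_span_isometric:
  assumes w: "w \<in> fun_span UNIV \<eta>" and w': "w' \<in> fun_span UNIV \<eta>"
  shows "ip (transform w) (transform w') = xip w w'"
  using w'
proof induction
  case zero
  have "transform (\<lambda>x. 0) = (\<lambda>t. 0)" using X.zero_right[OF feature_in] by (simp add: transform_def)
  thus ?case using hilbert.zero_right[OF transform_span_in[OF w]] X.zero_right[OF span_in[OF w]]
    by simp
next
  case (step w' u c)
  note Tw = transform_span_in[OF w] and Tw' = transform_span_in[OF step.hyps(1)]
    and wX = span_in[OF w] and wX' = span_in[OF step.hyps(1)]
  have "ip (transform w) (\<lambda>s. k s u) = cnj (transform w u)"
    using ip_commute[OF Tw kernel_mem] reproducing[OF Tw] by simp
  also have "\<dots> = xip w (\<eta> u)"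
    unfolding transform_def by (rule X.ip_sym[OF wX feature_in, symmetric])
  finally have *: "ip (transform w) (\<lambda>s. k s u) = xip w (\<eta> u)" .
  have "ip (transform w) (transform (\<lambda>x. w' x + c * \<eta> u x)) =
      ip (transform w) (transform w') + c * xip w (\<eta> u)"
    unfolding transform_span_step[OF wX'] ip_add_right[OF Tw Tw' scale_mem[OF kernel_mem]]
      ip_scale_right[OF Tw kernel_mem] * ..
  thus ?case
    unfolding step.IH X.add_right[OF wX wX' X.scale_in[OF feature_in]]
      X.scale_right[OF wX feature_in] .
qed

text \<open>Approximants of \<open>f\<close> from the span of the features have Cauchy transforms by isometry. The limit
  in \<open>H\<close> is identified pointwise, because evaluation at \<open>t\<close> is the inner product with the kernel
  section at \<open>t\<close>.\<close>

lemma transform_approximation: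
  assumes total: "\<forall>p\<in>X. (\<forall>t. transform p t = 0) \<longrightarrow> ip_norm xip p = 0"
    and f: "f \<in> X"
  shows "\<exists>w. (\<forall>n. w n \<in> fun_span UNIV \<eta>) \<and> X.converges_to w f \<and>
     hilbert.converges_to (\<lambda>n. transform (w n)) (transform f)"
proof -
  obtain w where w: "\<And>n. w n \<in> fun_span UNIV \<eta>" "X.converges_to w f"
    using X.total_imp_dense[of UNIV \<eta> f] feature_in total f unfolding transform_def by blast
  have wX: "w n \<in> X" for n by (rule span_in[OF w(1)])
  have "\<exists>g. hilbert.converges_to (\<lambda>n. transform (w n)) g"
  proof (rule hilbert.converges_to_if_Cauchy)
    fix \<epsilon> :: real assume "\<epsilon> > 0"
    from X.Cauchy_if_converges_to[OF w(2) this]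
    obtain N where N: "\<And>m n. m \<ge> N \<Longrightarrow> n \<ge> N \<Longrightarrow> ip_norm xip (\<lambda>x. w m x - w n x) < \<epsilon>"
      by blast
    have "ip_norm ip (\<lambda>t. transform (w m) t - transform (w n) t) = ip_norm xip (\<lambda>x. w m x - w n x)"
      for m n
    proof -
      have "(\<lambda>x. w m x + (- 1) * w n x) \<in> fun_span UNIV \<eta>"
        by (intro fun_span_add fun_span_scale w)
      hence d: "(\<lambda>x. w m x - w n x) \<in> fun_span UNIV \<eta>" by simp
      show ?thesis
        unfolding transform_diff[OF wX wX, symmetric] ip_norm_def transform_span_isometric[OF d d] ..
    qed
    thus "\<exists>N. \<forall>m\<ge>N. \<forall>n\<ge>N. ip_norm ip (\<lambda>t. transform (w m) t - transform (w n) t) < \<epsilon>"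
      by (intro exI[of _ N]) (simp add: N)
  qed (rule transform_span_in[OF w(1)])
  then obtain g where g: "hilbert.converges_to (\<lambda>n. transform (w n)) g" by blast
  have gH: "g \<in> H" using g by (simp add: hilbert.converges_to_def)
  have "g t = transform f t" for t
  proof (rule LIMSEQ_unique)
    have "(\<lambda>n. ip (\<lambda>s. k s t) (transform (w n))) \<longlonglongrightarrow> ip (\<lambda>s. k s t) g"
      by (rule hilbert.converges_to_ip[OF hilbert.converges_to_const[OF kernel_mem] g])
    thus "(\<lambda>n. transform (w n) t) \<longlonglongrightarrow> g t"
      by (simp add: reproducing transform_span_in[OF w(1)] gH)
    show "(\<lambda>n. transform (w n) t) \<longlonglongrightarrow> transform f t"
      unfolding transform_def
      by (rule X.converges_to_ip[OF X.converges_to_const[OF feature_in] w(2)])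
  qed
  hence "g = transform f" by (rule ext)
  thus ?thesis using w g by blast
qed

lemma transform_isometric:
  assumes total: "\<forall>p\<in>X. (\<forall>t. transform p t = 0) \<longrightarrow> ip_norm xip p = 0"
    and f: "f \<in> X" and g: "g \<in> X"
  shows "transform f \<in> H" "ip (transform f) (transform g) = xip f g"
proof -
  obtain v where v: "\<And>n. v n \<in> fun_span UNIV \<eta>" "X.converges_to v f"
      "hilbert.converges_to (\<lambda>n. transform (v n)) (transform f)"
    using transform_approximation[OF total f] by blast
  obtain w where w: "\<And>n. w n \<in> fun_span UNIV \<eta>" "X.converges_to w g"
      "hilbert.converges_to (\<lambda>n. transform (w n)) (transform g)"
    using transform_approximation[OF total g] by blast
  show "transform f \<in> H" using v(3) by (simp add: hilbert.converges_to_def)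
  have "(\<lambda>n. xip (v n) (w n)) \<longlonglongrightarrow> ip (transform f) (transform g)"
    using hilbert.converges_to_ip[OF v(3) w(3)] by (simp add: transform_span_isometric v w)
  thus "ip (transform f) (transform g) = xip f g"
    using X.converges_to_ip[OF v(2) w(2)] LIMSEQ_unique by blast
qed

text \<open>Orthonormality is isometry. For density it is enough that an element \<open>p\<close> of \<open>H\<close> orthogonal to all
  transformed basis vectors vanishes: each kernel section is the transform of a feature vector,
  hence a limit of combinations of them, and \<open>p\<close> takes at \<open>t\<close> the value of its inner product with
  the kernel section at \<open>t\<close>.\<close>

theorem transform_orthonormal_basis:
  assumes total: "\<forall>p\<in>X. (\<forall>t. transform p t = 0) \<longrightarrow> ip_norm xip p = 0"
    and onb: "orthonormal_basis X xip I e"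
  shows "orthonormal_basis H ip I (\<lambda>m. transform (e m))"
proof -
  note isom = transform_isometric[OF total]
  have e: "e m \<in> X" if "m \<in> I" for m by (rule orthonormal_basisD(1)[OF onb that])
  have Te: "transform (e m) \<in> H" if "m \<in> I" for m by (rule isom(1)[OF e[OF that] e[OF that]])
  have ortho: "ip (transform (e m)) (transform (e n)) = (if m = n then 1 else 0)"
    if "m \<in> I" "n \<in> I" for m n
    unfolding isom(2)[OF e[OF that(1)] e[OF that(2)]]
    by (rule orthonormal_basisD(2)[OF onb that])
  have "ip_norm ip p = 0" if p: "p \<in> H" "\<forall>m\<in>I. ip (transform (e m)) p = 0" for p
  proof -
    have "p t = 0" for t
    proof -
      have "cmod (p t) \<le> \<delta> * ip_norm ip p" if \<delta>: "\<delta> > 0" for \<delta>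
      proof -
        obtain J c where J: "finite J" "J \<subseteq> I"
            "ip_norm xip (\<lambda>x. \<eta> t x - (\<Sum>m\<in>J. c m * e m x)) < \<delta>"
          using orthonormal_basisD(3)[OF onb feature_in[of t] \<delta>] by blast
        define v where "v = (\<lambda>x. \<Sum>m\<in>J. c m * e m x)"
        have eJ: "e m \<in> X" "transform (e m) \<in> H" if "m \<in> J" for m using e Te J(2) that by blast+
        have v: "v \<in> X" unfolding v_def by (rule X.lincomb_in[OF J(1) eJ(1)])
        have d: "(\<lambda>x. \<eta> t x - v x) \<in> X" by (rule X.diff_in[OF feature_in v])
        have "transform v = (\<lambda>x. \<Sum>m\<in>J. c m * transform (e m) x)"
          unfolding v_def by (rule transform_lincomb) (fact J(1) eJ(1))+
        moreover have "ip (\<lambda>x. \<Sum>m\<in>J. c m * transform (e m) x) p =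
            (\<Sum>m\<in>J. cnj (c m) * ip (transform (e m)) p)"
          by (rule hilbert.lincomb_left) (fact J(1) eJ(2) p(1))+
        ultimately have "ip (transform v) p = (\<Sum>m\<in>J. cnj (c m) * ip (transform (e m)) p)"
          by (simp only:)
        also have "\<dots> = 0" using p(2) J(2) by (intro sum.neutral) auto
        finally have v0: "ip (transform v) p = 0" .
        have "ip (transform (\<lambda>x. \<eta> t x - v x)) p = p t - ip (transform v) p"
          unfolding transform_diff[OF feature_in v] transform_feature
          using hilbert.diff_left[OF p(1) kernel_mem[of t] isom(1)[OF v v]] reproducing[OF p(1)]
          by simp
        hence "p t = ip (transform (\<lambda>x. \<eta> t x - v x)) p" using v0 by simp
        hence "cmod (p t) \<le> ip_norm ip (transform (\<lambda>x. \<eta> t x - v x)) * ip_norm ip p"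
          using hilbert.Cauchy_Schwarz[OF isom(1)[OF d d] p(1)] by simp
        also have "ip_norm ip (transform (\<lambda>x. \<eta> t x - v x)) = ip_norm xip (\<lambda>x. \<eta> t x - v x)"
          unfolding ip_norm_def isom(2)[OF d d] ..
        also have "\<dots> * ip_norm ip p \<le> \<delta> * ip_norm ip p"
          using J(3) hilbert.norm_nonneg[OF p(1)] unfolding v_def by (intro mult_right_mono) auto
        finally show ?thesis .
      qed
      note bound = this
      have "cmod (p t) \<le> \<epsilon>" if \<epsilon>: "\<epsilon> > 0" for \<epsilon>
      proof -
        have n: "ip_norm ip p \<ge> 0" by (rule hilbert.norm_nonneg[OF p(1)])
        have "cmod (p t) \<le> \<epsilon> / (1 + ip_norm ip p) * ip_norm ip p"
          by (rule bound) (use \<epsilon> n in auto)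
        also have "\<dots> \<le> \<epsilon>" using \<epsilon> n by (simp add: field_simps)
        finally show ?thesis .
      qed
      hence "cmod (p t) \<le> 0" by (rule field_le_epsilon[of _ 0, simplified])
      thus ?thesis by simp
    qed
    hence "p = (\<lambda>t. 0)" by (rule ext)
    thus ?thesis using hilbert.zero_left[OF zero_mem] by (simp add: ip_norm_def)
  qed
  hence H_total: "\<forall>p\<in>H. (\<forall>m\<in>I. ip (transform (e m)) p = 0) \<longrightarrow> ip_norm ip p = 0" by blast
  have "\<exists>J c. finite J \<and> J \<subseteq> I \<and> ip_norm ip (\<lambda>x. f x - (\<Sum>m\<in>J. c m * transform (e m) x)) < \<epsilon>"
    if f: "f \<in> H" and \<epsilon>: "\<epsilon> > 0" for f \<epsilon>
  proof -
    obtain v where v: "\<And>n. v n \<in> fun_span I (\<lambda>m. transform (e m))" "hilbert.converges_to v f"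
      using hilbert.total_imp_dense[OF _ H_total f] Te by blast
    have "\<forall>\<^sub>F n in sequentially. ip_norm ip (\<lambda>x. v n x - f x) < \<epsilon>"
      using v(2) \<epsilon> by (intro order_tendstoD(2)[where y = 0]) (auto simp: hilbert.converges_to_def)
    then obtain n where n: "ip_norm ip (\<lambda>x. v n x - f x) < \<epsilon>"
      by (auto simp: eventually_sequentially)
    have "v n \<in> H" using v(2) by (simp add: hilbert.converges_to_def)
    hence "ip_norm ip (\<lambda>x. f x - v n x) < \<epsilon>" using n by (simp only: hilbert.norm_minus_commute[OF f])
    moreover obtain J c where "finite J" "J \<subseteq> I" "v n = (\<lambda>x. \<Sum>m\<in>J. c m * transform (e m) x)"
      using fun_span_imp_lincomb[OF v(1)[of n]] by blast
    ultimately show ?thesis by (intro exI[of _ J] exI[of _ c] conjI) simp_all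
  qed
  thus ?thesis unfolding orthonormal_basis_def by (intro conjI ballI allI impI Te ortho)
qed

end

section \<open>The space of square-integrable functions\<close>

lemma measurable_lebesgueI: "f \<in> borel_measurable borel \<Longrightarrow> f \<in> borel_measurable lebesgue"
  by (simp add: measurable_completion)

lemma measurable_cnj [measurable (raw)]:
  "f \<in> borel_measurable M \<Longrightarrow> (\<lambda>x. cnj (f x)) \<in> borel_measurable M"
  by (rule measurable_compose[where g =
      cnj]) (auto intro: borel_measurable_continuous_onI continuous_intros)

lemma measurable_exp_i_lebesgue [measurable]:
  "(\<lambda>t. exp (\<i> * complex_of_real (\<omega> * t))) \<in> borel_measurable lebesgue"
  by (rule measurable_lebesgueI) measurable

lemma l2_spaceD:
  assumes "f \<in> l2_space"
  shows "f \<in> borel_measurable lebesgue" "integrable lebesgue (\<lambda>t. (cmod (f t))\<^sup>2)"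
  using assms by (auto simp: l2_space_def)

lemma l2_product_integrable:
  assumes f: "f \<in> l2_space" and g: "g \<in> l2_space"
  shows "integrable lebesgue (\<lambda>t. f t * g t)" "integrable lebesgue (\<lambda>t. cnj (f t) * g t)"
proof -
  have [measurable]: "f \<in> borel_measurable lebesgue" "g \<in> borel_measurable lebesgue"
    using f g by (auto simp: l2_space_def)
  have int: "integrable lebesgue (\<lambda>t. (cmod (f t))\<^sup>2 + (cmod (g t))\<^sup>2)"
    by (intro Bochner_Integration.integrable_add l2_spaceD f g)
  have bd: "cmod (f t) * cmod (g t) \<le> (cmod (f t))\<^sup>2 + (cmod (g t))\<^sup>2" for t
  proof -
    have "2 * (cmod (f t) * cmod (g t)) \<le> (cmod (f t))\<^sup>2 + (cmod (g t))\<^sup>2"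
      using sum_squares_bound[of "cmod (f t)" "cmod (g t)"] by simp
    moreover have "0 \<le> cmod (f t) * cmod (g t)" by simp
    ultimately show ?thesis by linarith
  qed
  show "integrable lebesgue (\<lambda>t. f t * g t)" "integrable lebesgue (\<lambda>t. cnj (f t) * g t)"
    by (rule Bochner_Integration.integrable_bound[OF int]; use bd in \<open>simp add: norm_mult\<close>)+
qed

lemma l2_space_bounded:
  assumes "f \<in> borel_measurable lebesgue" "g \<in> l2_space"
    and "AE t in lebesgue. cmod (f t) \<le> C * cmod (g t)"
  shows "f \<in> l2_space"
proof -
  have [measurable]: "f \<in> borel_measurable lebesgue" by fact
  have "integrable lebesgue (\<lambda>t. C\<^sup>2 * (cmod (g t))\<^sup>2)"
    by (intro integrable_mult_right l2_spaceD assms)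
  hence "integrable lebesgue (\<lambda>t. (cmod (f t))\<^sup>2)"
  proof (rule Bochner_Integration.integrable_bound)
    show "AE t in lebesgue. norm ((cmod (f t))\<^sup>2) \<le> norm (C\<^sup>2 * (cmod (g t))\<^sup>2)"
      using assms(3)
    proof eventually_elim
      case (elim t)
      hence "(cmod (f t))\<^sup>2 \<le> (C * cmod (g t))\<^sup>2" by (intro power_mono) auto
      thus ?case by (simp add: power_mult_distrib)
    qed
  qed measurable
  thus ?thesis by (simp add: l2_space_def)
qed

lemma l2_space_add:
  assumes f: "f \<in> l2_space" and g: "g \<in> l2_space"
  shows "(\<lambda>t. f t + g t) \<in> l2_space"
proof -
  have [measurable]: "f \<in> borel_measurable lebesgue" "g \<in> borel_measurable lebesgue"
    using f g by (auto simp: l2_space_def)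
  have "integrable lebesgue (\<lambda>t. 2 * (cmod (f t))\<^sup>2 + 2 * (cmod (g t))\<^sup>2)"
    by (intro Bochner_Integration.integrable_add integrable_mult_right l2_spaceD f g)
  hence "integrable lebesgue (\<lambda>t. (cmod (f t + g t))\<^sup>2)"
  proof (rule Bochner_Integration.integrable_bound)
    show "AE t in lebesgue. norm ((cmod (f t + g t))\<^sup>2)
        \<le> norm (2 * (cmod (f t))\<^sup>2 + 2 * (cmod (g t))\<^sup>2)"
    proof (rule AE_I2)
      fix t
      have "(cmod (f t + g t))\<^sup>2 \<le> (cmod (f t) + cmod (g t))\<^sup>2"
        by (intro power_mono norm_triangle_ineq) auto
      also have "\<dots> \<le> 2 * (cmod (f t))\<^sup>2 + 2 * (cmod (g t))\<^sup>2"
        using sum_squares_bound[of "cmod (f t)" "cmod (g t)"] by (simp add: power2_sum)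
      finally show "norm ((cmod (f t + g t))\<^sup>2) \<le> norm (2 * (cmod (f t))\<^sup>2 + 2 * (cmod (g t))\<^sup>2)"
        by simp
    qed
  qed measurable
  thus ?thesis by (simp add: l2_space_def)
qed

lemma l2_inner_self: "l2_inner f f = of_real (LINT t|lebesgue. (cmod (f t))\<^sup>2)"
proof -
  have "cnj z * z = of_real ((cmod z)\<^sup>2)" for z
    using complex_norm_square[of z] by (simp add: mult.commute)
  thus ?thesis unfolding l2_inner_def by (simp only: integral_complex_of_real)
qed

lemma l2_norm_sq: "(ip_norm l2_inner f)\<^sup>2 = (LINT t|lebesgue. (cmod (f t))\<^sup>2)"
  unfolding ip_norm_def l2_inner_self Re_complex_of_real
      by (intro real_sqrt_pow2 integral_nonneg_AE) simp

lemma l2_scale: "f \<in> l2_space \<Longrightarrow> (\<lambda>t. c * f t) \<in> l2_space"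
  by (rule l2_space_bounded[of _ f "cmod c"]) (auto simp: l2_space_def norm_mult)

lemma l2_semi_inner_space: "semi_inner_space l2_space l2_inner"
proof
  show "(\<lambda>t. 0) \<in> l2_space" by (simp add: l2_space_def)
  show "(\<lambda>t. f t + g t) \<in> l2_space" if "f \<in> l2_space" "g \<in> l2_space" for f g
    by (rule l2_space_add[OF that])
  show "(\<lambda>t. c * f t) \<in> l2_space" if "f \<in> l2_space" for c f by (rule l2_scale[OF that])
  show "l2_inner f g = cnj (l2_inner g f)" for f g
    unfolding l2_inner_def Bochner_Integration.integral_cnj[symmetric] by (simp add: mult.commute)
  show "l2_inner f (\<lambda>t. g t + g' t) = l2_inner f g + l2_inner f g'"
    if "f \<in> l2_space" "g \<in> l2_space" "g' \<in> l2_space" for f g g'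
    unfolding l2_inner_def using l2_product_integrable(2)[OF that(1,2)]
      l2_product_integrable(2)[OF that(1,3)] by (simp add: distrib_left)
  show "l2_inner f (\<lambda>t. c * g t) = c * l2_inner f g"
    if "f \<in> l2_space" "g \<in> l2_space" for f g c
    unfolding l2_inner_def by (simp add: mult.left_commute)
  show "Re (l2_inner f f) \<ge> 0" for f
    unfolding l2_inner_self by simp
qed

lemma AE_zero_if_l2_norm_zero:
  assumes "f \<in> l2_space" "ip_norm l2_inner f = 0"
  shows "AE t in lebesgue. f t = 0"
proof -
  have "(LINT t|lebesgue. (cmod (f t))\<^sup>2) = 0"
    using assms(2) l2_norm_sq[of f] by simp
  hence "AE t in lebesgue. (cmod (f t))\<^sup>2 = 0"
    by (subst (asm) integral_nonneg_eq_0_iff_AE) (auto intro: l2_spaceD assms)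
  thus ?thesis by eventually_elim simp
qed

lemma l2_inner_cong_AE:
  assumes "f \<in> borel_measurable lebesgue" "g \<in> borel_measurable lebesgue"
    "f' \<in> borel_measurable lebesgue" "g' \<in> borel_measurable lebesgue"
    "AE t in lebesgue. f t = f' t" "AE t in lebesgue. g t = g' t"
  shows "l2_inner f g = l2_inner f' g'"
proof -
  note [measurable] = assms(1-4)
  show ?thesis unfolding l2_inner_def
  proof (rule integral_cong_AE)
    show "AE t in lebesgue. cnj (f t) * g t = cnj (f' t) * g' t"
      using assms(5,6) by eventually_elim simp
  qed measurable
qed

text \<open>With \<open>d k\<close> the increments, the series of \<open>2 ^ k * \<bar>d k\<bar>\<^sup>2\<close> has integral at most the sum of
  \<open>2 ^ k * 4 ^ - k\<close>, so it converges almost everywhere. There \<open>\<bar>d k\<bar>\<close> is eventually below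
  \<open>2 ^ (- k / 2)\<close>, and the telescoping series of increments converges.\<close>

lemma l2_fast_Cauchy_converges_AE:
  fixes g :: "nat \<Rightarrow> real \<Rightarrow> complex"
  assumes g: "\<And>k. g k \<in> l2_space"
    and fast: "\<And>k. ip_norm l2_inner (\<lambda>t. g (Suc k) t - g k t) \<le> (1/2) ^ k"
  shows "AE t in lebesgue. convergent (\<lambda>k. g k t)"
proof -
  interpret L2_semi: semi_inner_space l2_space l2_inner by (rule l2_semi_inner_space)
  have [measurable]: "g k \<in> borel_measurable lebesgue" for k by (rule l2_spaceD[OF g])
  define d where "d = (\<lambda>k t. g (Suc k) t - g k t)"
  have [measurable]: "d k \<in> borel_measurable lebesgue" for k unfolding d_def by measurable
  have d: "d k \<in> l2_space" for k unfolding d_def by (rule L2_semi.diff_in[OF g g])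
  have "(\<integral>\<^sup>+t. (\<Sum>k. ennreal (2 ^ k * (cmod (d k t))\<^sup>2)) \<partial>lebesgue)
      = (\<Sum>k. (\<integral>\<^sup>+t. ennreal (2 ^ k * (cmod (d k t))\<^sup>2) \<partial>lebesgue))"
    by (rule nn_integral_suminf) measurable
  also have "\<dots> \<le> (\<Sum>k. ennreal ((1/2) ^ k))"
  proof (rule suminf_le)
    fix k
    have "(\<integral>\<^sup>+t. ennreal (2 ^ k * (cmod (d k t))\<^sup>2) \<partial>lebesgue)
        = ennreal (LINT t|lebesgue. 2 ^ k * (cmod (d k t))\<^sup>2)"
      by (rule nn_integral_eq_integral) (auto intro: l2_spaceD d)
    also have "(LINT t|lebesgue. 2 ^ k * (cmod (d k t))\<^sup>2) = 2 ^ k * (ip_norm l2_inner (d k))\<^sup>2"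
      by (simp add: l2_norm_sq)
    also have "\<dots> \<le> 2 ^ k * ((1/2) ^ k)\<^sup>2"
      using fast[of k] L2_semi.norm_nonneg[OF d[of k]] unfolding d_def
      by (intro mult_left_mono power_mono) auto
    also have "\<dots> = (1/2) ^ k" by (simp add: power2_eq_square power_divide)
    finally show "(\<integral>\<^sup>+t. ennreal (2 ^ k * (cmod (d k t))\<^sup>2) \<partial>lebesgue) \<le> ennreal ((1/2) ^ k)"
      by (simp add: ennreal_leI)
  qed auto
  also have "\<dots> < \<infinity>" by (subst suminf_ennreal2) auto
  finally have "AE t in lebesgue. (\<Sum>k. ennreal (2 ^ k * (cmod (d k t))\<^sup>2)) \<noteq> \<infinity>"
    by (intro nn_integral_PInf_AE) auto
  thus ?thesis
  proof eventually_elim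
    case (elim t)
    have "summable (\<lambda>k. 2 ^ k * (cmod (d k t))\<^sup>2)"
      by (rule summable_suminf_not_top) (use elim in auto)
    hence "(\<lambda>k. 2 ^ k * (cmod (d k t))\<^sup>2) \<longlonglongrightarrow> 0" by (rule summable_LIMSEQ_zero)
    hence "\<forall>\<^sub>F k in sequentially. 2 ^ k * (cmod (d k t))\<^sup>2 < 1" by (rule order_tendstoD) simp
    hence ev: "\<forall>\<^sub>F k in sequentially. norm (d k t) \<le> (sqrt (1/2)) ^ k"
    proof eventually_elim
      case (elim k)
      hence "(cmod (d k t))\<^sup>2 \<le> (1/2) ^ k" by (simp add: field_simps power_divide)
      hence "sqrt ((cmod (d k t))\<^sup>2) \<le> sqrt ((1/2) ^ k)" by (simp only: real_sqrt_le_iff)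
      thus ?case by (simp add: real_sqrt_power)
    qed
    have "sqrt (1/2) < sqrt 1" by (simp only: real_sqrt_less_iff)
    hence "summable (\<lambda>k. (sqrt (1/2)) ^ k)" by (intro summable_geometric) simp
    from summable_comparison_test_ev[OF ev this]
    have "summable (\<lambda>k. d k t)" .
    hence "convergent (\<lambda>n. \<Sum>k<n. d k t)" by (simp add: summable_iff_convergent)
    moreover have "(\<Sum>k<n. d k t) = g n t - g 0 t" for n
      unfolding d_def by (rule sum_lessThan_telescope)
    ultimately have "convergent (\<lambda>n. g n t + (- g 0 t))" by simp
    thus ?case by (simp only: convergent_add_const_right_iff)
  qed
qed

text \<open>A fast Cauchy subsequence converges almost everywhere, and Fatou's lemma transfers the Cauchy
  estimate to the pointwise limit.\<close>

lemma l2_complete: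
  fixes s :: "nat \<Rightarrow> real \<Rightarrow> complex"
  assumes s: "\<And>n. s n \<in> l2_space"
    and Cauchy: "\<And>\<epsilon>. \<epsilon> > 0 \<Longrightarrow> \<exists>N. \<forall>m\<ge>N. \<forall>n\<ge>N. ip_norm l2_inner (\<lambda>x. s m x - s n x) < \<epsilon>"
  shows "\<exists>f\<in>l2_space. (\<lambda>n. ip_norm l2_inner (\<lambda>x. s n x - f x)) \<longlonglongrightarrow> 0"
proof -
  interpret L2_semi: semi_inner_space l2_space l2_inner by (rule l2_semi_inner_space)
  have "\<exists>N. \<forall>m\<ge>N. \<forall>n\<ge>N. ip_norm l2_inner (\<lambda>x. s m x - s n x) < (1/2) ^ k" for k :: nat
    by (rule Cauchy) simp
  then obtain N where N: "\<And>k m n. m \<ge> N k \<Longrightarrow> n \<ge> N k \<Longrightarrow>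
      ip_norm l2_inner (\<lambda>x. s m x - s n x) < (1/2) ^ k" by metis
  \<comment> \<open>a partial sum dominates all the thresholds that it contains\<close>
  define r where "r = (\<lambda>k. \<Sum>j\<le>k. N j)"
  have r_ge: "r k \<ge> N j" if "j \<le> k" for j k
    unfolding r_def using that by (intro member_le_sum) auto
  define g where "g = (\<lambda>k. s (r k))"
  have g: "g k \<in> l2_space" for k by (simp add: g_def s)
  have conv: "AE t in lebesgue. convergent (\<lambda>k. g k t)"
  proof (rule l2_fast_Cauchy_converges_AE[OF g])
    fix k show "ip_norm l2_inner (\<lambda>t. g (Suc k) t - g k t) \<le> (1/2) ^ k"
      unfolding g_def by (rule less_imp_le, rule N) (auto intro: r_ge)
  qed
  define f where "f = (\<lambda>t. lim (\<lambda>k. g k t))"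
  have [measurable]: "g k \<in> borel_measurable lebesgue" "s k \<in> borel_measurable lebesgue" for k
    by (rule l2_spaceD[OF g], rule l2_spaceD[OF s])
  have [measurable]: "f \<in> borel_measurable lebesgue" unfolding f_def by measurable
  have bound: "(\<lambda>t. s m t - f t) \<in> l2_space \<and> ip_norm l2_inner (\<lambda>t. s m t - f t) \<le> (1/2) ^ k"
    if m: "m \<ge> N k" for m k
  proof -
    have "(\<integral>\<^sup>+t. ennreal ((cmod (s m t - f t))\<^sup>2) \<partial>lebesgue)
        = (\<integral>\<^sup>+t. liminf (\<lambda>j. ennreal ((cmod (s m t - g j t))\<^sup>2)) \<partial>lebesgue)"
    proof (rule nn_integral_cong_AE)
      show "AE t in lebesgue. ennreal ((cmod (s m t - f t))\<^sup>2) =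
          liminf (\<lambda>j. ennreal ((cmod (s m t - g j t))\<^sup>2))"
        using conv
      proof eventually_elim
        case (elim t)
        hence "(\<lambda>j. g j t) \<longlonglongrightarrow> f t" unfolding f_def by (simp add: convergent_LIMSEQ_iff)
        hence "(\<lambda>j. ennreal ((cmod (s m t - g j t))\<^sup>2)) \<longlonglongrightarrow> ennreal ((cmod (s m t - f t))\<^sup>2)"
          by (intro tendsto_intros)
        thus ?case by (intro lim_imp_Liminf[symmetric]) simp_all
      qed
    qed
    also have "\<dots> \<le> liminf (\<lambda>j. (\<integral>\<^sup>+t. ennreal ((cmod (s m t - g j t))\<^sup>2) \<partial>lebesgue))"
      by (rule nn_integral_liminf) measurable
    also have "\<dots> \<le> ennreal (((1/2) ^ k)\<^sup>2)"
    proof (rule Liminf_le)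
      show "\<forall>\<^sub>F j in sequentially. (\<integral>\<^sup>+t. ennreal ((cmod (s m t - g j t))\<^sup>2) \<partial>lebesgue)
          \<le> ennreal (((1/2) ^ k)\<^sup>2)"
        using eventually_ge_at_top[of k]
      proof eventually_elim
        case (elim j)
        have d: "(\<lambda>t. s m t - g j t) \<in> l2_space" by (rule L2_semi.diff_in[OF s g])
        have "(\<integral>\<^sup>+t. ennreal ((cmod (s m t - g j t))\<^sup>2) \<partial>lebesgue)
            = ennreal ((ip_norm l2_inner (\<lambda>t. s m t - g j t))\<^sup>2)"
          unfolding l2_norm_sq by (rule nn_integral_eq_integral) (use l2_spaceD(2)[OF d] in auto)
        also have "\<dots> \<le> ennreal (((1/2) ^ k)\<^sup>2)"
          unfolding g_def using L2_semi.norm_nonneg[OF d] N[OF m r_ge[OF elim]]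
          by (intro ennreal_leI power_mono) (auto simp: g_def)
        finally show ?case .
      qed
    qed simp
    finally have fin: "(\<integral>\<^sup>+t. ennreal ((cmod (s m t - f t))\<^sup>2) \<partial>lebesgue) \<le> ennreal (((1/2) ^ k)\<^sup>2)" .
    have "integrable lebesgue (\<lambda>t. (cmod (s m t - f t))\<^sup>2)"
      by (rule integrableI_nonneg) (use fin in \<open>auto intro: le_less_trans\<close>)
    hence in_l2: "(\<lambda>t. s m t - f t) \<in> l2_space" by (simp add: l2_space_def)
    have "(ip_norm l2_inner (\<lambda>t. s m t - f t))\<^sup>2 \<le> ((1/2) ^ k)\<^sup>2"
      unfolding l2_norm_sq by (rule integral_real_bounded[OF _ fin]) simp
    hence "ip_norm l2_inner (\<lambda>t. s m t - f t) \<le> (1/2) ^ k"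
      by (rule power2_le_imp_le) simp
    thus ?thesis using in_l2 by blast
  qed
  have "f \<in> l2_space"
    using L2_semi.diff_in[OF s[of "N 0"] conjunct1[OF bound[of 0 "N 0"]]] by simp
  moreover have "(\<lambda>n. ip_norm l2_inner (\<lambda>x. s n x - f x)) \<longlonglongrightarrow> 0"
  proof (rule LIMSEQ_I)
    fix \<epsilon> :: real assume "\<epsilon> > 0"
    then obtain k where k: "(1/2) ^ k < \<epsilon>" using real_arch_pow_inv[of \<epsilon> "1/2"] by auto
    have "norm (ip_norm l2_inner (\<lambda>x. s n x - f x) - 0) < \<epsilon>" if "n \<ge> N k" for n
      using bound[OF that] k L2_semi.norm_nonneg[of "\<lambda>x. s n x - f x"] by auto
    thus "\<exists>M. \<forall>n\<ge>M. norm (ip_norm l2_inner (\<lambda>x. s n x - f x) - 0) < \<epsilon>" by blast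
  qed
  ultimately show ?thesis by blast
qed

interpretation L2: semi_hilbert_space l2_space l2_inner
  by (rule semi_hilbert_space.intro[OF l2_semi_inner_space semi_hilbert_space_axioms.intro])
    (rule l2_complete)

section \<open>Uniqueness of the Fourier integral\<close>

text \<open>The positive and the negative part of \<open>p\<close> have the same mass (frequency zero). Normalised by it,
  they are probability densities with equal characteristic functions, so they agree by Levy's
  uniqueness theorem.\<close>

lemma real_AE_zero_if_Fourier_zero:
  fixes p :: "real \<Rightarrow> real"
  assumes p: "integrable lebesgue p"
    and zero: "\<And>\<omega>. (LINT t|lebesgue. of_real (p t) * exp (\<i> * of_real (\<omega> * t))) = (0 :: complex)"
  shows "AE t in lebesgue. p t = 0"
proof -
  have [measurable]: "p \<in> borel_measurable lebesgue" using p by simp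
  obtain q where q[measurable]: "q \<in> borel_measurable lborel" and pq: "AE t in lborel. p t = q t"
    using completion_ex_borel_measurable_real[of p lborel] by auto
  have [measurable]: "q \<in> borel_measurable lebesgue"
    using q by (simp add: measurable_completion)
  have pq': "AE t in lebesgue. p t = q t" using pq by (rule AE_completion)
  have "integrable lebesgue q"
    by (rule Bochner_Integration.integrable_cong_AE_imp[OF p]) (use pq' in auto)
  hence qi: "integrable lborel q" using integrable_completion[OF q] by simp
  have zero_q: "(LINT t|lborel. of_real (q t) * iexp (\<omega> * t)) = 0" for \<omega>
  proof -
    have "(LINT t|lborel. of_real (q t) * iexp (\<omega> * t)) =
        (LINT t|lebesgue. of_real (q t) * iexp (\<omega> * t))"
      by (rule integral_completion[symmetric]) measurable
    also have "\<dots> = (LINT t|lebesgue. of_real (p t) * iexp (\<omega> * t))"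
      by (rule integral_cong_AE; measurable?) (use pq' in \<open>auto simp del: of_real_mult\<close>)
    finally show ?thesis using zero[of \<omega>] by (simp only:)
  qed
  define P where "P = (\<lambda>t. max 0 (q t))"
  define Q where "Q = (\<lambda>t. max 0 (- q t))"
  have [measurable]: "P \<in> borel_measurable lborel" "Q \<in> borel_measurable lborel"
    unfolding P_def Q_def by measurable
  have PQ: "q t = P t - Q t" "P t \<ge> 0" "Q t \<ge> 0" for t by (auto simp: P_def Q_def)
  have Pi: "integrable lborel P" and Qi: "integrable lborel Q"
    unfolding P_def Q_def using qi by auto
  have int_exp: "integrable lborel (\<lambda>t. of_real (R t) * iexp (\<omega> * t))"
    if "integrable lborel R" for R :: "real \<Rightarrow> real" and \<omega>
  proof (rule Bochner_Integration.integrable_bound[OF that])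
    have [measurable]: "R \<in> borel_measurable lborel" using that by simp
    show "(\<lambda>t. of_real (R t) * iexp (\<omega> * t)) \<in> borel_measurable lborel" by measurable
    have "cmod (iexp (\<omega> * t)) = 1" for t by (rule norm_exp_i_times)
    thus "AE t in lborel. norm (of_real (R t) * iexp (\<omega> * t)) \<le> norm (R t)"
      by (simp add: norm_mult del: of_real_mult)
  qed
  have same: "(LINT t|lborel. of_real (P t) * iexp (\<omega> * t)) =
      (LINT t|lborel. of_real (Q t) * iexp (\<omega> * t))" for \<omega>
  proof -
    have "(LINT t|lborel. of_real (P t) * iexp (\<omega> * t)) - (LINT t|lborel. of_real (Q t) * iexp
        (\<omega> * t)) =
        (LINT t|lborel. of_real (P t) * iexp (\<omega> * t) - of_real (Q t) * iexp (\<omega> * t))"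
      by (rule Bochner_Integration.integral_diff[symmetric]) (intro int_exp Pi Qi)+
    also have "\<dots> = 0" using zero_q[of \<omega>] by (simp add: PQ(1) left_diff_distrib)
    finally show ?thesis by simp
  qed
  define c where "c = (LINT t|lborel. P t)"
  have cQ: "c = (LINT t|lborel. Q t)"
  proof -
    have "complex_of_real (LINT t|lborel. P t) = complex_of_real (LINT t|lborel. Q t)"
      using same[of 0] by (simp flip: integral_complex_of_real)
    thus ?thesis by (simp add: c_def)
  qed
  have "AE t in lborel. P t = Q t"
  proof (cases "c = 0")
    case True
    have "AE t in lborel. P t = 0"
      by (subst integral_nonneg_eq_0_iff_AE[symmetric]) (use True Pi PQ c_def in auto)
    moreover have "AE t in lborel. Q t = 0"
      by (subst integral_nonneg_eq_0_iff_AE[symmetric]) (use True Qi PQ cQ in auto)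
    ultimately show ?thesis by eventually_elim simp
  next
    case False
    have "c \<ge> 0" unfolding c_def by (rule integral_nonneg_AE) (simp add: PQ)
    hence c: "c > 0" using False by simp
    have dist: "real_distribution (density lborel (\<lambda>t. ennreal (R t / c)))"
      if R: "integrable lborel R" "\<And>t. R t \<ge> 0" "(LINT t|lborel. R t) = c" for R
    proof -
      have [measurable]: "R \<in> borel_measurable lborel" using R(1) by simp
      have "prob_space (density lborel (\<lambda>t. ennreal (R t / c)))"
      proof
        have "emeasure (density lborel (\<lambda>t. ennreal (R t / c))) UNIV =
            (\<integral>\<^sup>+t. ennreal (R t / c) \<partial>lborel)"
          by (simp add: emeasure_density)
        also have "\<dots> = ennreal (LINT t|lborel. R t / c)"
          by (rule nn_integral_eq_integral) (use R c in auto)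
        also have "\<dots> = 1" using R(3) c by simp
        finally show "emeasure (density lborel (\<lambda>t. ennreal (R t / c))) (space (density lborel
            (\<lambda>t. ennreal (R t / c)))) = 1"
          by simp
      qed
      thus ?thesis by (auto simp: real_distribution_def real_distribution_axioms_def)
    qed
    have char: "char (density lborel (\<lambda>t. ennreal (R t / c))) \<omega> =
        (LINT t|lborel. of_real (R t) * iexp (\<omega> * t)) / c"
      if R: "integrable lborel R" "\<And>t. R t \<ge> 0" for R \<omega>
    proof -
      have [measurable]: "R \<in> borel_measurable lborel" using R(1) by simp
      have "char (density lborel (\<lambda>t. ennreal (R t / c))) \<omega> =
          (LINT t|lborel. (R t / c) *\<^sub>R iexp (\<omega> * t))"
        unfolding char_def by (rule integral_density) (use R c in auto)
      also have "\<dots> = (LINT t|lborel. (of_real (R t) * iexp (\<omega> * t)) / of_real c)"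
        by (simp add: scaleR_conv_of_real)
      finally show ?thesis by simp
    qed
    have "density lborel (\<lambda>t. ennreal (P t / c)) = density lborel (\<lambda>t. ennreal (Q t / c))"
    proof (rule Levy_uniqueness[OF dist[OF Pi PQ(2) c_def[symmetric]] dist[OF Qi PQ(3) cQ[symmetric]]])
      show "char (density lborel (\<lambda>t. ennreal (P t / c))) =
          char (density lborel (\<lambda>t. ennreal (Q t / c)))"
        by (rule ext) (simp add: char Pi Qi PQ same del: of_real_mult)
    qed
    hence "AE t in lborel. ennreal (P t / c) = ennreal (Q t / c)"
      by (intro sigma_finite_measure.density_unique[OF sigma_finite_lborel]) auto
    thus ?thesis by eventually_elim (use c PQ in \<open>auto simp: ennreal_inj\<close>)
  qed
  hence "AE t in lborel. q t = 0" by eventually_elim (simp add: PQ)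
  hence "AE t in lebesgue. q t = 0" by (rule AE_completion)
  thus ?thesis using pq' by eventually_elim simp
qed

text \<open>The conjugate of \<open>q\<close> has the conjugated transform at the opposite frequency, which vanishes too;
  therefore so do the transforms of the real and the imaginary part.\<close>

lemma AE_zero_if_Fourier_zero:
  fixes q :: "real \<Rightarrow> complex"
  assumes q: "integrable lebesgue q"
    and zero: "\<And>\<omega>. (LINT t|lebesgue. q t * exp (\<i> * of_real (\<omega> * t))) = 0"
  shows "AE t in lebesgue. q t = 0"
proof -
  let ?e = "\<lambda>\<omega> t. exp (\<i> * complex_of_real (\<omega> * t))"
  have [measurable]: "q \<in> borel_measurable lebesgue" using q by simp
  have cnj_e: "cnj (?e \<omega> t) = ?e (-\<omega>) t" for \<omega> t by (simp add: exp_cnj)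
  have int: "integrable lebesgue (\<lambda>t. q t * ?e \<omega> t)" "integrable lebesgue (\<lambda>t. cnj
      (q t) * ?e \<omega> t)" for \<omega>
  proof -
    have "norm (?e \<omega> t) = 1" for t by (rule norm_exp_i_times)
    thus "integrable lebesgue (\<lambda>t. q t * ?e \<omega> t)" "integrable lebesgue (\<lambda>t. cnj (q t) * ?e \<omega> t)"
      by - (rule Bochner_Integration.integrable_bound[OF q]; simp add: norm_mult del: of_real_mult)+
  qed
  have zero': "(LINT t|lebesgue. cnj (q t) * ?e \<omega> t) = 0" for \<omega>
  proof -
    have "(LINT t|lebesgue. cnj (q t) * ?e \<omega> t) = (LINT t|lebesgue. cnj (q t * ?e (-\<omega>) t))"
      using cnj_e[of "-\<omega>"] by (simp only: complex_cnj_mult minus_minus)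
    also have "\<dots> = 0" using zero[of "-\<omega>"]
        by (simp only: Bochner_Integration.integral_cnj complex_cnj_zero)
    finally show ?thesis .
  qed
  have "AE t in lebesgue. Re (q t) = 0"
  proof (rule real_AE_zero_if_Fourier_zero)
    fix \<omega>
    have "of_real (Re z) = (z + cnj z) / 2" for z by (simp add: complex_add_cnj)
    hence "(LINT t|lebesgue. of_real (Re (q t)) * ?e \<omega> t) =
        (LINT t|lebesgue. (q t * ?e \<omega> t + cnj (q t) * ?e \<omega> t) / 2)"
      by (simp only: distrib_right times_divide_eq_left)
    also have "\<dots> = 0"
      using Bochner_Integration.integral_add[OF int(1)[of \<omega>] int(2)[of \<omega>]] zero[of \<omega>] zero'[of \<omega>]
      by (simp del: of_real_mult)
    finally show "(LINT t|lebesgue. of_real (Re (q t)) * ?e \<omega> t) = 0" .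
  qed (use q in simp)
  moreover have "AE t in lebesgue. Im (q t) = 0"
  proof (rule real_AE_zero_if_Fourier_zero)
    fix \<omega>
    have "of_real (Im z) = (z - cnj z) / (2 * \<i>)" for z
      by (simp add: complex_eq_iff)
    hence "(LINT t|lebesgue. of_real (Im (q t)) * ?e \<omega> t) =
        (LINT t|lebesgue. (q t * ?e \<omega> t - cnj (q t) * ?e \<omega> t) / (2 * \<i>))"
      by (simp only: left_diff_distrib times_divide_eq_left)
    also have "\<dots> = 0"
      using Bochner_Integration.integral_diff[OF int(1)[of \<omega>] int(2)[of \<omega>]] zero[of \<omega>] zero'[of \<omega>]
      by (simp del: of_real_mult)
    finally show "(LINT t|lebesgue. of_real (Im (q t)) * ?e \<omega> t) = 0" .
  qed (use q in simp)
  ultimately show ?thesis by eventually_elim (simp add: complex_eq_iff)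
qed

section \<open>Gaussians and the multiplication formula\<close>

text \<open>The Fourier integral exchanges these two families, modulated and translated Gaussians, up to
  the factor \<open>sqrt (2 * pi)\<close>. Modulations make pairings into Fourier integrals, to which
  uniqueness applies.\<close>

definition gauss_mod :: "real \<Rightarrow> real \<Rightarrow> complex" where
  "gauss_mod a t = of_real (exp (- t\<^sup>2 / 2)) * exp (\<i> * of_real (a * t))"

definition gauss_shift :: "real \<Rightarrow> real \<Rightarrow> complex" where
  "gauss_shift b t = of_real (exp (- (t - b)\<^sup>2 / 2))"

lemma fourier_integral_alt:
  "fourier_integral f \<omega> = (LINT t|lebesgue. f t * exp (\<i> * of_real (- \<omega> * t)))"
  by (simp add: fourier_integral_def mult.assoc)

lemma exp_i_add:
  "exp (\<i> * complex_of_real (x + y)) = exp (\<i> * of_real x) * exp (\<i> * of_real y)"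
  by (simp add: distrib_left exp_add)

lemma integrable_mult_unimodular:
  fixes f :: "real \<Rightarrow> complex"
  assumes f: "integrable lebesgue f"
  shows "integrable lebesgue (\<lambda>t. f t * exp (\<i> * of_real (\<omega> * t)))"
proof (rule Bochner_Integration.integrable_bound[OF f])
  have [measurable]: "f \<in> borel_measurable lebesgue" using f by simp
  show "(\<lambda>t. f t * exp (\<i> * of_real (\<omega> * t))) \<in> borel_measurable lebesgue" by measurable
  have "norm (exp (\<i> * complex_of_real (\<omega> * t))) = 1" for t by (rule norm_exp_i_times)
  thus "AE t in lebesgue. norm (f t * exp (\<i> * of_real (\<omega> * t))) \<le> norm (f t)"
    by (simp add: norm_mult del: of_real_mult)
qed

text \<open>The Gaussian is a multiple of the standard normal density, whose characteristic function is
  known.\<close>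

lemma std_gaussian_Fourier:
  shows "integrable lebesgue (\<lambda>t. complex_of_real (exp (- t\<^sup>2 / 2)))"
    and "(LINT t|lebesgue. of_real (exp (- t\<^sup>2 / 2)) * exp (\<i> * of_real (\<omega> * t))) =
      complex_of_real (sqrt (2 * pi) * exp (- \<omega>\<^sup>2 / 2))"
proof -
  have dens: "exp (- t\<^sup>2 / 2) = sqrt (2 * pi) * std_normal_density t" for t :: real
    by (simp add: std_normal_density_def)
  have "integrable lborel (\<lambda>t. exp (- t\<^sup>2 / 2) :: real)"
    unfolding dens by (intro integrable_mult_right integrable_normal_density) simp_all
  hence "integrable lebesgue (\<lambda>t. exp (- t\<^sup>2 / 2) :: real)"
    by (subst integrable_completion) auto
  thus "integrable lebesgue (\<lambda>t. complex_of_real (exp (- t\<^sup>2 / 2)))"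
    by (rule integrable_of_real)
  have "(LINT t|lebesgue. of_real (exp (- t\<^sup>2 / 2)) * iexp (\<omega> * t)) =
      (LINT t|lborel. of_real (exp (- t\<^sup>2 / 2)) * iexp (\<omega> * t))"
    by (rule integral_completion) measurable
  also have "\<dots> = (LINT t|lborel. of_real (sqrt (2 * pi)) * (std_normal_density t *\<^sub>R iexp (\<omega> * t)))"
    unfolding dens by (simp add: scaleR_conv_of_real mult.assoc)
  also have "\<dots> = of_real (sqrt (2 * pi)) * (LINT t|lborel. std_normal_density t *\<^sub>R iexp (\<omega> * t))"
    by (rule integral_mult_right_zero)
  also have "(LINT t|lborel. std_normal_density t *\<^sub>R iexp (\<omega> * t)) = char std_normal_distribution \<omega>"
    unfolding char_def by (rule integral_density[symmetric]) auto
  also have "\<dots> = of_real (exp (- \<omega>\<^sup>2 / 2))" by (simp add: char_std_normal_distribution)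
  finally show "(LINT t|lebesgue. of_real (exp (- t\<^sup>2 / 2)) * iexp (\<omega> * t)) =
      complex_of_real (sqrt (2 * pi) * exp (- \<omega>\<^sup>2 / 2))" by (simp only: of_real_mult)
qed

lemma gaussian_Fourier:
  assumes \<sigma>: "\<sigma> > 0"
  shows "integrable lebesgue (\<lambda>t. complex_of_real (exp (- \<sigma> * t\<^sup>2 / 2)))"
    and "(LINT t|lebesgue. of_real (exp (- \<sigma> * t\<^sup>2 / 2)) * exp (\<i> * of_real (\<omega> * t))) =
      complex_of_real (sqrt (2 * pi / \<sigma>) * exp (- \<omega>\<^sup>2 / (2 * \<sigma>)))"
proof -
  define c where "c = sqrt \<sigma>"
  have c: "c > 0" "c\<^sup>2 = \<sigma>" using \<sigma> by (simp_all add: c_def)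
  have eq: "- (0 + c * t)\<^sup>2 / 2 = - \<sigma> * t\<^sup>2 / 2" for t
    by (simp add: power_mult_distrib c(2))
  have eq': "\<omega> / c * (0 + c * t) = \<omega> * t" for t using c(1) by simp
  show "integrable lebesgue (\<lambda>t. complex_of_real (exp (- \<sigma> * t\<^sup>2 / 2)))"
    using lebesgue_integrable_real_affine[OF std_gaussian_Fourier(1), of c 0] c(1)
    unfolding eq by simp
  have "complex_of_real (sqrt (2 * pi) * exp (- (\<omega> / c)\<^sup>2 / 2)) =
      \<bar>c\<bar> *\<^sub>R (LINT t|lebesgue. of_real (exp (- (0 + c * t)\<^sup>2 / 2)) * iexp (\<omega> / c * (0 + c * t)))"
    unfolding std_gaussian_Fourier(2)[symmetric]
    by (rule lebesgue_integral_real_affine) (use c in simp)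
  hence "(LINT t|lebesgue. of_real (exp (- \<sigma> * t\<^sup>2 / 2)) * iexp (\<omega> * t)) =
      complex_of_real (sqrt (2 * pi) * exp (- (\<omega> / c)\<^sup>2 / 2)) / of_real c"
    unfolding eq eq' using c(1) by (simp add: scaleR_conv_of_real)
  also have "\<dots> = of_real (sqrt (2 * pi) / c * exp (- (\<omega> / c)\<^sup>2 / 2))" by simp
  also have "sqrt (2 * pi) / c = sqrt (2 * pi / \<sigma>)" unfolding c_def
      by (rule real_sqrt_divide[symmetric])
  also have "- (\<omega> / c)\<^sup>2 / 2 = - \<omega>\<^sup>2 / (2 * \<sigma>)" by (simp add: power_divide c(2))
  finally show "(LINT t|lebesgue. of_real (exp (- \<sigma> * t\<^sup>2 / 2)) * iexp (\<omega> * t)) =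
      complex_of_real (sqrt (2 * pi / \<sigma>) * exp (- \<omega>\<^sup>2 / (2 * \<sigma>)))" .
qed

lemma gauss_measurable [measurable]:
  "gauss_mod a \<in> borel_measurable lebesgue" "gauss_shift b \<in> borel_measurable lebesgue"
proof -
  have "gauss_mod a \<in> borel_measurable borel" "gauss_shift b \<in> borel_measurable borel"
    unfolding gauss_mod_def[abs_def] gauss_shift_def[abs_def] by measurable
  thus "gauss_mod a \<in> borel_measurable lebesgue" "gauss_shift b \<in> borel_measurable lebesgue"
    by (auto intro: measurable_lebesgueI)
qed

lemma cmod_gauss:
  "cmod (gauss_mod a t) = exp (- t\<^sup>2 / 2)" "cmod (gauss_shift b t) = exp (- (t - b)\<^sup>2 / 2)"
proof -
  have "norm (exp (\<i> * complex_of_real (a * t))) = 1" by (rule norm_exp_i_times)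
  thus "cmod (gauss_mod a t) = exp (- t\<^sup>2 / 2)" by (simp add: gauss_mod_def norm_mult del: of_real_mult)
qed (simp add: gauss_shift_def)

lemma gauss_shift_integrable: "integrable lebesgue (gauss_shift b)"
  using lebesgue_integrable_real_affine[OF std_gaussian_Fourier(1), of 1 "-b"]
  by (simp add: gauss_shift_def[abs_def])

lemma gauss_mod_integrable: "integrable lebesgue (gauss_mod a)"
  unfolding gauss_mod_def[abs_def] by (rule integrable_mult_unimodular[OF std_gaussian_Fourier(1)])

lemma l2_space_if_bounded_integrable:
  assumes f: "integrable lebesgue f" and B: "\<And>t. cmod (f t) \<le> B"
  shows "f \<in> l2_space"
proof -
  have [measurable]: "f \<in> borel_measurable lebesgue" using f by simp
  have "integrable lebesgue (\<lambda>t. (cmod (f t))\<^sup>2)"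
  proof (rule Bochner_Integration.integrable_bound)
    show "integrable lebesgue (\<lambda>t. B * cmod (f t))" using f by simp
    have "(cmod (f t))\<^sup>2 \<le> B * cmod (f t)" for t
      unfolding power2_eq_square by (rule mult_right_mono[OF B]) simp
    thus "AE t in lebesgue. norm ((cmod (f t))\<^sup>2) \<le> norm (B * cmod (f t))"
      by (intro AE_I2) (simp add: order_trans[OF _ abs_ge_self])
  qed measurable
  thus ?thesis by (simp add: l2_space_def)
qed

lemma gauss_l2: "gauss_mod a \<in> l2_space" "gauss_shift b \<in> l2_space"
  by (rule l2_space_if_bounded_integrable[of _ 1];
      simp add: gauss_mod_integrable gauss_shift_integrable cmod_gauss)+

lemma cnj_gauss: "cnj (gauss_mod a t) = gauss_mod (- a) t" "cnj (gauss_shift b t) = gauss_shift b t"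
  by (simp_all add: gauss_mod_def gauss_shift_def exp_cnj)

lemma gauss_reflect: "gauss_mod a (- t) = gauss_mod (- a) t" "gauss_shift b (- t) = gauss_shift (- b) t"
  by (simp_all add: gauss_mod_def gauss_shift_def power2_commute add.commute minus_diff_commute power2_eq_square algebra_simps)

lemma fourier_gauss_mod:
  "fourier_integral (gauss_mod a) \<omega> = of_real (sqrt (2 * pi)) * gauss_shift a \<omega>"
proof -
  have "fourier_integral (gauss_mod a) \<omega> =
      (LINT t|lebesgue. of_real (exp (- t\<^sup>2 / 2)) * iexp ((a - \<omega>) * t))"
  proof -
    have "iexp (a * t) * iexp (- \<omega> * t) = iexp ((a - \<omega>) * t)" for t
      unfolding exp_i_add[symmetric] by (simp add: left_diff_distrib)
    thus ?thesis unfolding fourier_integral_alt gauss_mod_def by (simp only: mult.assoc)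
  qed
  also have "\<dots> = of_real (sqrt (2 * pi)) * gauss_shift a \<omega>"
    unfolding std_gaussian_Fourier(2) gauss_shift_def power2_commute[of a \<omega>] by (rule of_real_mult)
  finally show ?thesis .
qed

lemma fourier_gauss_shift:
  "fourier_integral (gauss_shift b) \<omega> = of_real (sqrt (2 * pi)) * gauss_mod (- b) \<omega>"
proof -
  have "fourier_integral (gauss_shift b) \<omega> =
      \<bar>1\<bar> *\<^sub>R (LINT t|lebesgue. gauss_shift b (b + 1 * t) * iexp (- \<omega> * (b + 1 * t)))"
    unfolding fourier_integral_alt by (rule lebesgue_integral_real_affine) simp
  also have "\<dots> = (LINT t|lebesgue. iexp (- \<omega> * b) * (of_real (exp (- t\<^sup>2 / 2)) * iexp (- \<omega> * t)))"
  proof -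
    have "gauss_shift b (b + 1 * t) = of_real (exp (- t\<^sup>2 / 2))" for t by (simp add: gauss_shift_def)
    moreover have "iexp (- \<omega> * (b + 1 * t)) = iexp (- \<omega> * b) * iexp (- \<omega> * t)" for t
      unfolding exp_i_add[symmetric] by (simp add: algebra_simps)
    ultimately have "gauss_shift b (b + 1 * t) * iexp (- \<omega> * (b + 1 * t)) =
        iexp (- \<omega> * b) * (of_real (exp (- t\<^sup>2 / 2)) * iexp (- \<omega> * t))" for t
      by (simp only: mult.left_commute)
    thus ?thesis by (simp only: abs_one scaleR_one)
  qed
  also have "\<dots> = iexp (- \<omega> * b) * (LINT t|lebesgue. of_real (exp (- t\<^sup>2 / 2)) * iexp (- \<omega> * t))"
    by (rule integral_mult_right_zero)
  also have "\<dots> = of_real (sqrt (2 * pi)) * gauss_mod (- b) \<omega>"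
    unfolding std_gaussian_Fourier(2) gauss_mod_def by (simp add: mult_ac)
  finally show ?thesis .
qed

text \<open>Together with the same value for translated Gaussians below, this is Plancherel's identity on
  generators.\<close>

lemma l2_inner_gauss_mod:
  "l2_inner (gauss_mod a) (gauss_mod b) = of_real (sqrt pi * exp (- (b - a)\<^sup>2 / 4))"
proof -
  have "cnj (gauss_mod a t) * gauss_mod b t = of_real (exp (- 2 * t\<^sup>2 / 2)) * iexp ((b - a) * t)" for t
  proof -
    have "complex_of_real (exp (- t\<^sup>2 / 2)) * of_real (exp (- t\<^sup>2 / 2)) = of_real (exp (- 2 * t\<^sup>2 / 2))"
      by (simp flip: of_real_mult exp_add)
    moreover have "iexp (- a * t) * iexp (b * t) = iexp ((b - a) * t)"
      by (simp flip: exp_add add: algebra_simps)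
    moreover have "cnj (gauss_mod a t) * gauss_mod b t =
        (complex_of_real (exp (- t\<^sup>2 / 2)) * of_real (exp (- t\<^sup>2 / 2))) * (iexp (- a * t) * iexp
            (b * t))"
      unfolding cnj_gauss unfolding gauss_mod_def by (simp only: mult_ac)
    ultimately show ?thesis by (simp only:)
  qed
  thus ?thesis unfolding l2_inner_def using gaussian_Fourier(2)[of 2 "b - a"] by simp
qed

text \<open>Centred at the midpoint \<open>m\<close>, the product of the two Gaussians is again a Gaussian.\<close>

lemma l2_inner_gauss_shift:
  "l2_inner (gauss_shift a) (gauss_shift b) = of_real (sqrt pi * exp (- (b - a)\<^sup>2 / 4))"
proof -
  define m where "m = (a + b) / 2"
  have "l2_inner (gauss_shift a) (gauss_shift b) =
      \<bar>1\<bar> *\<^sub>R (LINT t|lebesgue. gauss_shift a (m + 1 * t) * gauss_shift b (m + 1 * t))"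
    unfolding l2_inner_def cnj_gauss by (rule lebesgue_integral_real_affine) simp
  also have "\<dots> = (LINT t|lebesgue. of_real (exp (- (b - a)\<^sup>2 / 4)) * (of_real (exp
      (- 2 * t\<^sup>2 / 2)) * iexp (0 * t)))"
  proof -
    have "- (m + t - a)\<^sup>2 / 2 + - (m + t - b)\<^sup>2 / 2 = - (b - a)\<^sup>2 / 4 + - 2 * t\<^sup>2 / 2" for t
      unfolding m_def by (simp add: power2_eq_square field_simps)
    hence "exp (- (m + t - a)\<^sup>2 / 2) * exp (- (m + t - b)\<^sup>2 / 2) =
        exp (- (b - a)\<^sup>2 / 4) * exp (- 2 * t\<^sup>2 / 2)" for t
      by (simp only: exp_add[symmetric])
    hence "gauss_shift a (m + t) * gauss_shift b (m + t) =
        of_real (exp (- (b - a)\<^sup>2 / 4)) * of_real (exp (- 2 * t\<^sup>2 / 2))" for t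
      unfolding gauss_shift_def by (simp only: of_real_mult[symmetric])
    thus ?thesis by simp
  qed
  also have "\<dots> = of_real (exp (- (b - a)\<^sup>2 / 4)) * (LINT t|lebesgue. of_real (exp
      (- 2 * t\<^sup>2 / 2)) * iexp (0 * t))"
    by (rule integral_mult_right_zero)
  also have "\<dots> = of_real (sqrt pi * exp (- (b - a)\<^sup>2 / 4))"
    using gaussian_Fourier(2)[of 2 0] by simp
  finally show ?thesis .
qed

lemma fourier_integral_bounded: "cmod (fourier_integral f \<omega>) \<le> (LINT t|lebesgue. cmod (f t))"
proof -
  have "norm (exp (\<i> * complex_of_real (- \<omega> * t))) = 1" for t by (rule norm_exp_i_times)
  thus ?thesis
    unfolding fourier_integral_alt
    using integral_norm_bound[of lebesgue "\<lambda>t. f t * iexp (- \<omega> * t)"]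
    by (simp add: norm_mult del: of_real_mult)
qed

lemma fourier_integral_continuous:
  assumes f: "integrable lebesgue f"
  shows "continuous_on UNIV (fourier_integral f)"
  unfolding continuous_on_eq_continuous_at[OF open_UNIV] continuous_at_sequentially o_def
proof (intro ballI allI impI)
  fix \<omega> and x :: "nat \<Rightarrow> real" assume x: "x \<longlonglongrightarrow> \<omega>"
  have [measurable]: "f \<in> borel_measurable lebesgue" using f by simp
  show "(\<lambda>n. fourier_integral f (x n)) \<longlonglongrightarrow> fourier_integral f \<omega>"
    unfolding fourier_integral_alt
  proof (rule integral_dominated_convergence[where w = "\<lambda>t. cmod (f t)"])
    have "norm (exp (\<i> * complex_of_real (- x n * t))) = 1" for n t by (rule norm_exp_i_times)
    thus "AE t in lebesgue. norm (f t * iexp (- x n * t)) \<le> cmod (f t)" for n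
      by (simp add: norm_mult del: of_real_mult)
    show "AE t in lebesgue. (\<lambda>n. f t * iexp (- x n * t)) \<longlonglongrightarrow> f t * iexp (- \<omega> * t)"
      by (intro AE_I2 tendsto_intros x)
    show "(\<lambda>t. f t * iexp (- \<omega> * t)) \<in> borel_measurable lebesgue"
      "\<And>n. (\<lambda>t. f t * iexp (- x n * t)) \<in> borel_measurable lebesgue" by measurable
  qed (use f in simp)
qed

lemma fourier_integral_measurable:
  "integrable lebesgue f \<Longrightarrow> fourier_integral f \<in> borel_measurable lebesgue"
  by (intro measurable_lebesgueI borel_measurable_continuous_onI fourier_integral_continuous)

lemma sigma_finite_lebesgue: "sigma_finite_measure (lebesgue :: real measure)"
proof
  obtain A :: "real set set" where A: "countable A" "A \<subseteq> sets lborel" "\<Union>A = space lborel"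
      "\<forall>a\<in>A. emeasure lborel a \<noteq> \<infinity>"
    using sigma_finite_measure.sigma_finite_countable[OF sigma_finite_lborel] by blast
  show "\<exists>A. countable A \<and> A \<subseteq> sets lebesgue \<and> \<Union>A = space lebesgue \<and>
      (\<forall>a\<in>A. emeasure (lebesgue :: real measure) a \<noteq> \<infinity>)"
    using A by (intro exI[of _ A]) auto
qed

text \<open>Both sides are the double integral of \<open>f s * g t * exp (- i s t)\<close>.\<close>

lemma fourier_multiplication:
  assumes f: "integrable lebesgue f" and g: "integrable lebesgue g"
  shows "(LINT t|lebesgue. fourier_integral f t * g t) = (LINT t|lebesgue. f t * fourier_integral g t)"
proof -
  interpret pair_sigma_finite "lebesgue :: real measure" "lebesgue :: real measure"
    by (intro pair_sigma_finite.intro sigma_finite_lebesgue)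
  have [measurable]: "f \<in> borel_measurable lebesgue" "g \<in> borel_measurable lebesgue" using f g
      by simp_all
  have id_meas: "(\<lambda>x. x) \<in> borel_measurable (lebesgue :: real measure)"
    by (rule measurable_lebesgueI) simp
  have [measurable]: "(\<lambda>(s, t). iexp (- t * s)) \<in> borel_measurable (lebesgue \<Otimes>\<^sub>M lebesgue)"
  proof -
    have [measurable]: "fst \<in> borel_measurable ((lebesgue :: real measure) \<Otimes>\<^sub>M
        (lebesgue :: real measure))"
      by (rule measurable_compose[OF measurable_fst id_meas])
    have [measurable]: "snd \<in> borel_measurable ((lebesgue :: real measure) \<Otimes>\<^sub>M
        (lebesgue :: real measure))"
      by (rule measurable_compose[OF measurable_snd id_meas])
    show ?thesis unfolding split_beta' by measurable
  qed
  have unit: "norm (exp (\<i> * complex_of_real x)) = 1" for x by (rule norm_exp_i_times)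
  have int: "integrable (lebesgue \<Otimes>\<^sub>M lebesgue) (\<lambda>(s, t). f s * g t * iexp (- t * s))"
  proof (rule Fubini_integrable)
    show "(\<lambda>(s, t). f s * g t * iexp (- t * s)) \<in> borel_measurable (lebesgue \<Otimes>\<^sub>M lebesgue)"
      by measurable
    show "integrable lebesgue (\<lambda>s. LINT t|lebesgue. norm (case (s, t) of (s,
        t) \<Rightarrow> f s * g t * iexp (- t * s)))"
      using f by (simp add: norm_mult unit mult.assoc del: of_real_mult)
    show "AE s in lebesgue. integrable lebesgue (\<lambda>t. case (s, t) of (s,
        t) \<Rightarrow> f s * g t * iexp (- t * s))"
    proof (rule AE_I2)
      fix s
      show "integrable lebesgue (\<lambda>t. case (s, t) of (s, t) \<Rightarrow> f s * g t * iexp (- t * s))"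
        using integrable_mult_right[OF integrable_mult_unimodular[OF g, of "-s"], of "f s"]
        by (simp add: mult_ac)
    qed
  qed
  have "(LINT t|lebesgue. fourier_integral f t * g t) =
      (LINT t|lebesgue. LINT s|lebesgue. f s * g t * iexp (- t * s))"
  proof (rule Bochner_Integration.integral_cong[OF refl])
    fix t
    have "fourier_integral f t * g t = (LINT s|lebesgue. f s * iexp (- t * s) * g t)"
      unfolding fourier_integral_alt by (rule integral_mult_left_zero[symmetric])
    thus "fourier_integral f t * g t = (LINT s|lebesgue. f s * g t * iexp (- t * s))"
      by (simp add: mult_ac)
  qed
  also have "\<dots> = (LINT s|lebesgue. LINT t|lebesgue. f s * g t * iexp (- t * s))"
    by (rule Fubini_integral[OF int])
  also have "\<dots> = (LINT s|lebesgue. f s * fourier_integral g s)"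
  proof (rule Bochner_Integration.integral_cong[OF refl])
    fix s
    have "f s * fourier_integral g s = (LINT t|lebesgue. f s * (g t * iexp (- s * t)))"
      unfolding fourier_integral_alt by (rule integral_mult_right_zero[symmetric])
    moreover have "f s * (g t * iexp (- s * t)) = f s * g t * iexp (- t * s)" for t
      by (simp add: mult_ac)
    ultimately show "(LINT t|lebesgue. f s * g t * iexp (- t * s)) = f s * fourier_integral g s"
      by (simp only:)
  qed
  finally show ?thesis .
qed

text \<open>The pairings of \<open>q\<close> with all modulated Gaussians are the Fourier integrals of \<open>q\<close> times a fixed
  Gaussian, which has no zeros. This is how functions are identified below: they are equal once
  their pairings with modulated Gaussians agree.\<close>

lemma AE_zero_if_gauss_mod_zero:
  assumes q: "integrable lebesgue (\<lambda>t. gauss_mod 0 t * q t)"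
    and zero: "\<And>a. (LINT t|lebesgue. gauss_mod a t * q t) = 0"
  shows "AE t in lebesgue. q t = 0"
proof -
  have "AE t in lebesgue. gauss_mod 0 t * q t = 0"
  proof (rule AE_zero_if_Fourier_zero[OF q])
    fix a
    show "(LINT t|lebesgue. gauss_mod 0 t * q t * iexp (a * t)) = 0"
      using zero[of a] by (simp add: gauss_mod_def mult_ac)
  qed
  thus ?thesis by eventually_elim (simp add: gauss_mod_def)
qed

lemma gauss_mod_total:
  assumes p: "p \<in> l2_space" and zero: "\<And>a. l2_inner (gauss_mod a) p = 0"
  shows "AE t in lebesgue. p t = 0"
proof (rule AE_zero_if_gauss_mod_zero)
  show "integrable lebesgue (\<lambda>t. gauss_mod 0 t * p t)" by (rule l2_product_integrable[OF gauss_l2(1) p])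
  show "(LINT t|lebesgue. gauss_mod a t * p t) = 0" for a
    using zero[of "-a"] by (simp add: l2_inner_def cnj_gauss)
qed

lemma l2_norm_zero_if_AE_zero:
  assumes "AE t in lebesgue. f t = 0"
  shows "ip_norm l2_inner f = 0"
proof -
  have "(LINT t|lebesgue. (cmod (f t))\<^sup>2) = 0"
    by (rule integral_eq_zero_AE) (use assms in \<open>eventually_elim, simp\<close>)
  thus ?thesis using l2_norm_sq[of f] by simp
qed

section \<open>Plancherel's theorem\<close>

lemma fourier_integral_lincomb:
  assumes "integrable lebesgue f" "integrable lebesgue g"
  shows "fourier_integral (\<lambda>t. f t + c * g t) = (\<lambda>\<omega>. fourier_integral f \<omega> + c * fourier_integral g \<omega>)"
proof
  fix \<omega>
  note f = integrable_mult_unimodular[OF assms(1), of "-\<omega>"]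
    and g = integrable_mult_unimodular[OF assms(2), of "-\<omega>"]
  have "fourier_integral (\<lambda>t. f t + c * g t) \<omega> =
      (LINT t|lebesgue. f t * iexp (- \<omega> * t) + c * (g t * iexp (- \<omega> * t)))"
    unfolding fourier_integral_alt by (simp only: distrib_right mult.assoc)
  also have "\<dots> = (LINT t|lebesgue. f t * iexp (- \<omega> * t))
      + (LINT t|lebesgue. c * (g t * iexp (- \<omega> * t)))"
    by (rule Bochner_Integration.integral_add[OF f integrable_mult_right[OF g]])
  also have "(LINT t|lebesgue. c * (g t * iexp (- \<omega> * t))) =
      c * (LINT t|lebesgue. g t * iexp (- \<omega> * t))"
    by (rule integral_mult_right_zero)
  finally show "fourier_integral (\<lambda>t. f t + c * g t) \<omega> =
      fourier_integral f \<omega> + c * fourier_integral g \<omega>"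
    unfolding fourier_integral_alt .
qed

lemma fourier_integral_diff:
  assumes "integrable lebesgue f" "integrable lebesgue g"
  shows "fourier_integral (\<lambda>t. f t - g t) = (\<lambda>\<omega>. fourier_integral f \<omega> - fourier_integral g \<omega>)"
  using fourier_integral_lincomb[OF assms, of "-1"] by simp

abbreviation gauss_span :: "(real \<Rightarrow> complex) set" where
  "gauss_span \<equiv> fun_span UNIV gauss_mod"

lemma gauss_span_l2: "w \<in> gauss_span \<Longrightarrow> w \<in> l2_space"
  using L2.fun_span_subset[of UNIV gauss_mod] gauss_l2(1) by blast

lemma gauss_span_integrable: "w \<in> gauss_span \<Longrightarrow> integrable lebesgue w"
proof (induction rule: fun_span.induct)
  case (step w a c)
  show ?case
    by (rule Bochner_Integration.integrable_add[OF step.IH integrable_mult_right[OF gauss_mod_integrable]])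
qed simp

lemma fourier_gauss_mod_l2: "fourier_integral (gauss_mod a) \<in> l2_space"
  unfolding fourier_gauss_mod[abs_def] by (rule L2.scale_in[OF gauss_l2(2)])

lemma fourier_gauss_span_l2: "w \<in> gauss_span \<Longrightarrow> fourier_integral w \<in> l2_space"
proof (induction rule: fun_span.induct)
  case zero
  show ?case using L2.zero_in by (simp add: fourier_integral_def[abs_def])
next
  case (step w a c)
  show ?case
    unfolding fourier_integral_lincomb[OF gauss_span_integrable[OF step.hyps(1)] gauss_mod_integrable]
    by (rule L2.add_in[OF step.IH L2.scale_in[OF fourier_gauss_mod_l2]])
qed

lemma gauss_span_Plancherel:
  assumes w: "w \<in> gauss_span" and w': "w' \<in> gauss_span"
  shows "l2_inner (fourier_integral w) (fourier_integral w') = of_real (2 * pi) * l2_inner w w'"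
proof -
  have FT0: "fourier_integral (\<lambda>t. 0) = (\<lambda>\<omega>. 0)" by (simp add: fourier_integral_def[abs_def])
  have base: "l2_inner (fourier_integral (gauss_mod a)) (fourier_integral (gauss_mod b)) =
      of_real (2 * pi) * l2_inner (gauss_mod a) (gauss_mod b)" for a b
    unfolding fourier_gauss_mod[abs_def] L2.scale_right[OF L2.scale_in[OF gauss_l2(2)] gauss_l2(2)]
      L2.scale_left[OF gauss_l2(2) gauss_l2(2)] l2_inner_gauss_mod l2_inner_gauss_shift
    by (simp flip: of_real_mult)
  have left: "l2_inner (fourier_integral v) (fourier_integral (gauss_mod b)) =
      of_real (2 * pi) * l2_inner v (gauss_mod b)" if "v \<in> gauss_span" for v b
    using that
  proof induction
    case zero
    show ?case unfolding FT0 L2.zero_left[OF fourier_gauss_mod_l2] L2.zero_left[OF gauss_l2(1)] by simp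
  next
    case (step v a c)
    show ?case
      unfolding fourier_integral_lincomb[OF gauss_span_integrable[OF step.hyps(1)] gauss_mod_integrable]
        L2.add_left[OF fourier_gauss_mod_l2 fourier_gauss_span_l2[OF step.hyps(1)]
            L2.scale_in[OF fourier_gauss_mod_l2]]
        L2.add_left[OF gauss_l2(1) gauss_span_l2[OF step.hyps(1)] L2.scale_in[OF gauss_l2(1)]]
        L2.scale_left[OF fourier_gauss_mod_l2 fourier_gauss_mod_l2]
            L2.scale_left[OF gauss_l2(1) gauss_l2(1)]
        step.IH base by (simp add: distrib_left mult.left_commute)
  qed
  show ?thesis using w'
  proof induction
    case zero
    show ?case unfolding FT0 L2.zero_right[OF fourier_gauss_span_l2[OF w]]
        L2.zero_right[OF gauss_span_l2[OF w]]
      by simp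
  next
    case (step v a c)
    show ?case
      unfolding fourier_integral_lincomb[OF gauss_span_integrable[OF step.hyps(1)] gauss_mod_integrable]
        L2.add_right[OF fourier_gauss_span_l2[OF w] fourier_gauss_span_l2[OF step.hyps(1)]
            L2.scale_in[OF fourier_gauss_mod_l2]]
        L2.add_right[OF gauss_span_l2[OF w] gauss_span_l2[OF step.hyps(1)] L2.scale_in[OF gauss_l2(1)]]
        L2.scale_right[OF fourier_gauss_span_l2[OF w] fourier_gauss_mod_l2]
            L2.scale_right[OF gauss_span_l2[OF w] gauss_l2(1)]
        step.IH left[OF w] by (simp add: distrib_left mult.left_commute)
  qed
qed

lemma gauss_span_diff: "v \<in> gauss_span \<Longrightarrow> w \<in> gauss_span \<Longrightarrow> (\<lambda>x. v x - w x) \<in> gauss_span"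
  using fun_span_add[OF fun_span_scale[of w UNIV gauss_mod "-1"], of v] by simp

text \<open>Modulated Gaussians are total, hence have dense span; transforms of approximants are Cauchy
  because the transform preserves norms on the span up to the factor \<open>sqrt (2 * pi)\<close>.\<close>

lemma gauss_span_approximation:
  assumes f: "f \<in> l2_space"
  shows "\<exists>w F. (\<forall>n. w n \<in> gauss_span) \<and> L2.converges_to w f \<and>
    L2.converges_to (\<lambda>n. fourier_integral (w n)) F"
proof -
  have "\<forall>p\<in>l2_space. (\<forall>a\<in>UNIV. l2_inner (gauss_mod a) p = 0) \<longrightarrow> ip_norm l2_inner p = 0"
    using gauss_mod_total l2_norm_zero_if_AE_zero by blast
  then obtain w where w: "\<And>n. w n \<in> gauss_span" "L2.converges_to w f"
    using L2.total_imp_dense[of UNIV gauss_mod f] gauss_l2(1) f by blast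
  have "\<exists>F. L2.converges_to (\<lambda>n. fourier_integral (w n)) F"
  proof (rule L2.converges_to_if_Cauchy)
    fix \<epsilon> :: real assume e: "\<epsilon> > 0"
    have "\<epsilon> / sqrt (2 * pi) > 0" using e by simp
    from L2.Cauchy_if_converges_to[OF w(2) this] obtain N where
      N: "\<And>m n. m \<ge> N \<Longrightarrow> n \<ge> N \<Longrightarrow> ip_norm l2_inner (\<lambda>x. w m x - w n x) < \<epsilon> / sqrt (2 * pi)"
      by blast
    have "ip_norm l2_inner (\<lambda>x. fourier_integral (w m) x - fourier_integral (w n) x) < \<epsilon>"
      if "m \<ge> N" "n \<ge> N" for m n
    proof -
      note d = gauss_span_diff[OF w(1)[of m] w(1)[of n]]
      have "ip_norm l2_inner (\<lambda>x. fourier_integral (w m) x - fourier_integral (w n) x) =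
          sqrt (2 * pi) * ip_norm l2_inner (\<lambda>x. w m x - w n x)"
        unfolding fourier_integral_diff[OF gauss_span_integrable[OF w(1)]
            gauss_span_integrable[OF w(1)], symmetric]
          ip_norm_def gauss_span_Plancherel[OF d d]
        by (simp add: real_sqrt_mult)
      thus ?thesis using N[OF that] by (simp add: field_simps)
    qed
    thus "\<exists>N. \<forall>m\<ge>N. \<forall>n\<ge>N. ip_norm l2_inner (\<lambda>x. fourier_integral (w m) x - fourier_integral
        (w n) x) < \<epsilon>"
      by blast
  qed (rule fourier_gauss_span_l2[OF w(1)])
  thus ?thesis using w by blast
qed

text \<open>\<open>F\<close> is the Plancherel transform of \<open>f\<close>, obtained by continuous extension from combinations of
  modulated Gaussians. For square-integrable \<open>f\<close> it is shown below to be the same notion as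
  \<^const>\<open>has_fourier_transform\<close>, whose truncations are harder to compute with.\<close>

definition plancherel_pair :: "(real \<Rightarrow> complex) \<Rightarrow> (real \<Rightarrow> complex) \<Rightarrow> bool" where
  "plancherel_pair f F \<longleftrightarrow> (\<exists>w. (\<forall>n. w n \<in> gauss_span) \<and> L2.converges_to w f \<and>
    L2.converges_to (\<lambda>n. fourier_integral (w n)) F)"

lemma plancherel_pair_l2: "plancherel_pair f F \<Longrightarrow> f \<in> l2_space" "plancherel_pair f F \<Longrightarrow> F \<in> l2_space"
  by (auto simp: plancherel_pair_def L2.converges_to_def)

lemma plancherel_pair_exists: "f \<in> l2_space \<Longrightarrow> \<exists>F. plancherel_pair f F"
  unfolding plancherel_pair_def using gauss_span_approximation by blast

lemma Plancherel:
  assumes "plancherel_pair f F" "plancherel_pair g G"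
  shows "l2_inner F G = of_real (2 * pi) * l2_inner f g"
proof -
  obtain v where v: "\<And>n. v n \<in> gauss_span" "L2.converges_to v f"
    "L2.converges_to (\<lambda>n. fourier_integral (v n)) F" using assms(1) unfolding plancherel_pair_def
        by blast
  obtain w where w: "\<And>n. w n \<in> gauss_span" "L2.converges_to w g"
    "L2.converges_to (\<lambda>n. fourier_integral (w n)) G" using assms(2) unfolding plancherel_pair_def
        by blast
  have "(\<lambda>n. of_real (2 * pi) * l2_inner (v n) (w n)) \<longlonglongrightarrow> l2_inner F G"
    using L2.converges_to_ip[OF v(3) w(3)] by (simp only: gauss_span_Plancherel[OF v(1) w(1)])
  moreover have "(\<lambda>n. of_real (2 * pi) * l2_inner (v n) (w n)) \<longlonglongrightarrow> of_real (2 * pi) * l2_inner f g"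
    by (intro tendsto_intros L2.converges_to_ip v w)
  ultimately show ?thesis by (rule LIMSEQ_unique)
qed

lemma Plancherel_norm:
  assumes "plancherel_pair f F"
  shows "ip_norm l2_inner F = sqrt (2 * pi) * ip_norm l2_inner f"
  unfolding ip_norm_def Plancherel[OF assms assms] by (simp add: real_sqrt_mult)

lemma plancherel_pair_diff:
  assumes "plancherel_pair f F" "plancherel_pair g G"
  shows "plancherel_pair (\<lambda>t. f t - g t) (\<lambda>\<omega>. F \<omega> - G \<omega>)"
proof -
  obtain v where v: "\<And>n. v n \<in> gauss_span" "L2.converges_to v f"
    "L2.converges_to (\<lambda>n. fourier_integral (v n)) F" using assms(1) unfolding plancherel_pair_def
        by blast
  obtain w where w: "\<And>n. w n \<in> gauss_span" "L2.converges_to w g"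
    "L2.converges_to (\<lambda>n. fourier_integral (w n)) G" using assms(2) unfolding plancherel_pair_def
        by blast
  have "L2.converges_to (\<lambda>n. fourier_integral (\<lambda>x. v n x - w n x)) (\<lambda>\<omega>. F \<omega> - G \<omega>)"
    unfolding fourier_integral_diff[OF gauss_span_integrable[OF v(1)] gauss_span_integrable[OF w(1)]]
    by (rule L2.converges_to_diff[OF v(3) w(3)])
  thus ?thesis unfolding plancherel_pair_def
    by (intro exI[of _ "\<lambda>n x. v n x - w n x"] conjI allI gauss_span_diff v w L2.converges_to_diff)
qed

lemma l2_converges_to_cong_AE:
  assumes "L2.converges_to s F" "AE \<omega> in lebesgue. F' \<omega> = F \<omega>"
  shows "L2.converges_to s F'"
proof -
  have s: "s n \<in> l2_space" and F: "F \<in> l2_space" for n using assms(1)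
      by (auto simp: L2.converges_to_def)
  have F'_meas: "F' \<in> borel_measurable lebesgue"
    by (rule borel_measurable_AE[OF l2_spaceD(1)[OF F]]) (use assms(2) in \<open>eventually_elim, simp\<close>)
  have F': "F' \<in> l2_space"
    by (rule l2_space_bounded[OF F'_meas F, of 1]) (use assms(2) in \<open>eventually_elim, simp\<close>)
  have "ip_norm l2_inner (\<lambda>x. s n x - F' x) = ip_norm l2_inner (\<lambda>x. s n x - F x)" for n
    unfolding ip_norm_def
  proof (intro arg_cong[where f = "\<lambda>z. sqrt (Re z)"] l2_inner_cong_AE)
    show "AE x in lebesgue. s n x - F' x = s n x - F x" "AE x in lebesgue. s n x - F' x = s n x - F x"
      using assms(2) by (eventually_elim, simp)+
  qed (rule l2_spaceD(1)[OF L2.diff_in], fact s, (fact F' F)+)+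
  thus ?thesis using assms(1) F' s by (simp add: L2.converges_to_def)
qed

lemma plancherel_pair_cong_AE:
  assumes "plancherel_pair f F" "AE \<omega> in lebesgue. F' \<omega> = F \<omega>"
  shows "plancherel_pair f F'"
  using assms l2_converges_to_cong_AE unfolding plancherel_pair_def by blast

text \<open>The transform preserves distances up to the factor \<open>sqrt (2 * pi)\<close>, so the \<open>S n\<close> also converge
  to a transform of \<open>f\<close>: its graph is closed.\<close>

lemma plancherel_pair_limit:
  assumes pair: "\<And>n. plancherel_pair (s n) (S n)"
    and s: "L2.converges_to s f" and S: "L2.converges_to S F"
  shows "plancherel_pair f F"
proof -
  have f: "f \<in> l2_space" and F: "F \<in> l2_space" using s S by (auto simp: L2.converges_to_def)
  obtain G where G: "plancherel_pair f G" using plancherel_pair_exists[OF f] by blast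
  note G2 = plancherel_pair_l2(2)[OF G] and S2 = plancherel_pair_l2(2)[OF pair]
  have "(\<lambda>n. sqrt (2 * pi) * ip_norm l2_inner (\<lambda>t. s n t - f t)) \<longlonglongrightarrow> sqrt (2 * pi) * 0"
    using s by (intro tendsto_intros) (simp add: L2.converges_to_def)
  hence "(\<lambda>n. ip_norm l2_inner (\<lambda>\<omega>. S n \<omega> - G \<omega>)) \<longlonglongrightarrow> 0"
    unfolding Plancherel_norm[OF plancherel_pair_diff[OF pair G]] by simp
  moreover have "(\<lambda>n. ip_norm l2_inner (\<lambda>\<omega>. S n \<omega> - G \<omega>)) \<longlonglongrightarrow> ip_norm l2_inner (\<lambda>\<omega>. F \<omega> - G \<omega>)"
    by (intro L2.converges_to_norm L2.converges_to_diff S L2.converges_to_const G2)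
  ultimately have "ip_norm l2_inner (\<lambda>\<omega>. F \<omega> - G \<omega>) = 0" using LIMSEQ_unique by blast
  from AE_zero_if_l2_norm_zero[OF L2.diff_in[OF F G2] this]
  have "AE \<omega> in lebesgue. F \<omega> = G \<omega>" by eventually_elim simp
  thus ?thesis by (rule plancherel_pair_cong_AE[OF G])
qed

text \<open>The multiplication formula, carried from the Gaussian approximants to the limit. Since the
  pairings on the left determine \<open>F\<close>, it characterises \<open>F\<close> by \<open>f\<close>.\<close>

lemma plancherel_pair_gauss_pairing:
  assumes "plancherel_pair f F"
  shows "(LINT \<omega>|lebesgue. gauss_mod a \<omega> * F \<omega>) = of_real (sqrt (2 * pi)) * l2_inner (gauss_shift a) f"
proof -
  obtain w where w: "\<And>n. w n \<in> gauss_span" "L2.converges_to w f"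
    "L2.converges_to (\<lambda>n. fourier_integral (w n)) F" using assms unfolding plancherel_pair_def by blast
  have inner: "l2_inner (gauss_mod (- a)) G = (LINT \<omega>|lebesgue. gauss_mod a \<omega> * G \<omega>)" for G
    by (simp add: l2_inner_def cnj_gauss)
  have "l2_inner (gauss_mod (- a)) (fourier_integral (w n)) =
      of_real (sqrt (2 * pi)) * l2_inner (gauss_shift a) (w n)" for n
    unfolding inner fourier_multiplication[OF gauss_mod_integrable gauss_span_integrable[OF w(1)],
        symmetric]
      fourier_gauss_mod l2_inner_def cnj_gauss mult.assoc minus_minus by (rule integral_mult_right_zero)
  hence "(\<lambda>n. of_real (sqrt (2 * pi)) * l2_inner (gauss_shift a) (w n)) \<longlonglongrightarrow> l2_inner (gauss_mod (- a)) F"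
    using L2.converges_to_ip[OF L2.converges_to_const[OF gauss_l2(1)[of "- a"]] w(3)] by (simp only:)
  moreover have "(\<lambda>n. of_real (sqrt (2 * pi)) * l2_inner (gauss_shift a) (w n)) \<longlonglongrightarrow>
      of_real (sqrt (2 * pi)) * l2_inner (gauss_shift a) f"
    by (intro tendsto_intros L2.converges_to_ip L2.converges_to_const gauss_l2 w)
  ultimately show ?thesis unfolding inner by (rule LIMSEQ_unique)
qed

lemma integrable_gauss_pairing:
  assumes "integrable lebesgue f"
  shows "(LINT \<omega>|lebesgue. gauss_mod a \<omega> * fourier_integral f \<omega>) =
      of_real (sqrt (2 * pi)) * (LINT t|lebesgue. gauss_shift a t * f t)"
  unfolding fourier_multiplication[OF gauss_mod_integrable assms,
      symmetric] fourier_gauss_mod mult.assoc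
  by (rule integral_mult_right_zero)

lemma gauss_times_bounded_integrable:
  assumes [measurable]: "q \<in> borel_measurable lebesgue" and B: "\<And>t. cmod (q t) \<le> B"
  shows "integrable lebesgue (\<lambda>t. gauss_mod a t * q t)"
proof (rule Bochner_Integration.integrable_bound)
  show "integrable lebesgue (\<lambda>t. of_real B * gauss_mod a t)"
    by (rule integrable_mult_right[OF gauss_mod_integrable])
  show "AE t in lebesgue. norm (gauss_mod a t * q t) \<le> norm (of_real B * gauss_mod a t)"
  proof (rule AE_I2)
    fix t
    have "cmod (q t) \<le> \<bar>B\<bar>" using B[of t] by linarith
    thus "norm (gauss_mod a t * q t) \<le> norm (of_real B * gauss_mod a t)"
      by (simp add: norm_mult mult.commute mult_right_mono)
  qed
qed measurable

text \<open>The Fourier integral of \<open>f\<close> is bounded and obeys the multiplication formula, so it has the same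
  pairings with modulated Gaussians as the Plancherel transform of \<open>f\<close>.\<close>

lemma plancherel_pair_fourier_integral:
  assumes f: "integrable lebesgue f" "f \<in> l2_space"
  shows "plancherel_pair f (fourier_integral f)"
proof -
  obtain F where F: "plancherel_pair f F" using plancherel_pair_exists[OF f(2)] by blast
  note F2 = plancherel_pair_l2(2)[OF F] and fm = fourier_integral_measurable[OF f(1)]
  have i1: "integrable lebesgue (\<lambda>t. gauss_mod a t * fourier_integral f t)" for a
    by (rule gauss_times_bounded_integrable[OF fm fourier_integral_bounded])
  have i2: "integrable lebesgue (\<lambda>t. gauss_mod a t * F t)" for a
    by (rule l2_product_integrable(1)[OF gauss_l2(1) F2])
  have "AE \<omega> in lebesgue. fourier_integral f \<omega> - F \<omega> = 0"
  proof (rule AE_zero_if_gauss_mod_zero)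
    show "integrable lebesgue (\<lambda>t. gauss_mod 0 t * (fourier_integral f t - F t))"
      unfolding right_diff_distrib by (rule Bochner_Integration.integrable_diff[OF i1 i2])
    fix a
    have "l2_inner (gauss_shift a) f = (LINT t|lebesgue. gauss_shift a t * f t)"
      by (simp add: l2_inner_def cnj_gauss)
    thus "(LINT t|lebesgue. gauss_mod a t * (fourier_integral f t - F t)) = 0"
      unfolding right_diff_distrib Bochner_Integration.integral_diff[OF i1 i2]
        integrable_gauss_pairing[OF f(1)] plancherel_pair_gauss_pairing[OF F] by simp
  qed
  hence "AE \<omega> in lebesgue. fourier_integral f \<omega> = F \<omega>" by eventually_elim simp
  thus ?thesis by (rule plancherel_pair_cong_AE[OF F])
qed

lemma truncation:
  assumes f: "f \<in> l2_space"
  defines "s \<equiv> \<lambda>n::nat. \<lambda>t. indicator {- real n..real n} t * f t"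
  shows "integrable lebesgue (s n)" "L2.converges_to s f"
proof -
  have [measurable]: "f \<in> borel_measurable lebesgue" using f by (rule l2_spaceD)
  have ind_meas [measurable]: "(\<lambda>t. indicator {- real n..real n} t :: complex) \<in> borel_measurable lebesgue" for n
    by (rule measurable_lebesgueI) measurable
  have [measurable]: "s n \<in> borel_measurable lebesgue" for n unfolding s_def by measurable
  have le: "cmod (s n t) \<le> cmod (f t)" for n t by (simp add: s_def indicator_def norm_mult)
  have s: "s n \<in> l2_space" for n
    by (rule l2_space_bounded[of _ f 1]) (use le f in auto)
  have "(\<lambda>t. indicator {- real n..real n} t :: complex) \<in> l2_space"
  proof -
    have "integrable lborel (indicator {- real n..real n} :: real \<Rightarrow> real)"
      by (intro integrable_real_indicator) auto
    hence "integrable lebesgue (indicator {- real n..real n} :: real \<Rightarrow> real)"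
      by (subst integrable_completion) auto
    moreover have "(cmod (indicator {- real n..real n} t))\<^sup>2 =
        indicator {- real n..real n} t" for t :: real
      by (simp add: indicator_def)
    ultimately show ?thesis using ind_meas by (simp add: l2_space_def)
  qed
  from l2_product_integrable(1)[OF this f] show "integrable lebesgue (s n)" unfolding s_def .
  have d: "(\<lambda>t. s n t - f t) \<in> l2_space" for n by (rule L2.diff_in[OF s f])
  have "(\<lambda>n. (LINT t|lebesgue. (cmod (s n t - f t))\<^sup>2)) \<longlonglongrightarrow> (LINT t|(lebesgue :: real measure). 0)"
  proof (rule integral_dominated_convergence[where w = "\<lambda>t. (cmod (f t))\<^sup>2"])
    show "integrable lebesgue (\<lambda>t. (cmod (f t))\<^sup>2)" by (rule l2_spaceD[OF f])
    show "AE t in lebesgue. norm ((cmod (s n t - f t))\<^sup>2) \<le> (cmod (f t))\<^sup>2" for n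
      by (rule AE_I2) (simp add: s_def indicator_def)
    show "AE t in lebesgue. (\<lambda>n. (cmod (s n t - f t))\<^sup>2) \<longlonglongrightarrow> 0"
    proof (rule AE_I2, rule tendsto_eventually)
      fix t :: real
      obtain N :: nat where N: "\<bar>t\<bar> \<le> real N" using real_arch_simple by blast
      show "\<forall>\<^sub>F n in sequentially. (cmod (s n t - f t))\<^sup>2 = 0"
        using eventually_ge_at_top[of N]
      proof eventually_elim
        case (elim n)
        hence "\<bar>t\<bar> \<le> real n" using N by linarith
        hence "t \<in> {- real n..real n}" by auto
        thus ?case by (simp add: s_def)
      qed
    qed
  qed measurable
  hence "(\<lambda>n. sqrt (LINT t|lebesgue. (cmod (s n t - f t))\<^sup>2)) \<longlonglongrightarrow> sqrt 0"
    by (intro tendsto_real_sqrt) simp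
  moreover have "ip_norm l2_inner g = sqrt (LINT t|lebesgue. (cmod (g t))\<^sup>2)" for g
    by (simp add: ip_norm_def l2_inner_self)
  ultimately show "L2.converges_to s f" using s f by (simp add: L2.converges_to_def)
qed

text \<open>The transforms of the truncations are at distance \<open>sqrt (2 * pi)\<close> times that of the truncations
  themselves.\<close>

lemma has_fourier_transform_if_plancherel_pair:
  assumes "plancherel_pair f F"
  shows "has_fourier_transform f F"
proof -
  note f = plancherel_pair_l2(1)[OF assms] and F = plancherel_pair_l2(2)[OF assms]
  define s where "s = (\<lambda>n::nat. \<lambda>t. indicator {- real n..real n} t * f t)"
  have s: "integrable lebesgue (s n)" "L2.converges_to s f" for n
    unfolding s_def by (rule truncation[OF f])+
  have s2: "s n \<in> l2_space" for n using s(2) by (simp add: L2.converges_to_def)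
  have eq: "(LINT \<omega>|lebesgue. (cmod (F \<omega> - fourier_integral (s n) \<omega>))\<^sup>2) =
      2 * pi * (ip_norm l2_inner (\<lambda>t. s n t - f t))\<^sup>2" for n
  proof -
    have "plancherel_pair (\<lambda>t. f t - s n t) (\<lambda>\<omega>. F \<omega> - fourier_integral (s n) \<omega>)"
      by (rule plancherel_pair_diff[OF assms plancherel_pair_fourier_integral[OF s(1) s2]])
    from Plancherel_norm[OF this] show ?thesis
      unfolding l2_norm_sq[symmetric] L2.norm_minus_commute[OF s2 f] by (simp add: power_mult_distrib)
  qed
  have "(\<lambda>n. 2 * pi * (ip_norm l2_inner (\<lambda>t. s n t - f t))\<^sup>2) \<longlonglongrightarrow> 2 * pi * 0\<^sup>2"
    using s(2) by (intro tendsto_intros) (simp add: L2.converges_to_def)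
  thus ?thesis using f F eq unfolding has_fourier_transform_def s_def by simp
qed

text \<open>The truncations are integrable, so their Fourier integrals are their transforms, and the graph is
  closed. If the transform is given by the Fourier integral of \<open>f\<close> itself, no limit occurs.\<close>

lemma plancherel_pair_if_has_fourier_transform:
  assumes f: "f \<in> l2_space" and F: "has_fourier_transform f F"
  shows "plancherel_pair f F"
proof (cases "integrable lebesgue f \<and> (AE \<omega> in lebesgue. F \<omega> = fourier_integral f \<omega>)")
  case True
  thus ?thesis
    using plancherel_pair_cong_AE[OF plancherel_pair_fourier_integral[OF _ f]] by blast
next
  case False
  define s where "s = (\<lambda>n::nat. \<lambda>t. indicator {- real n..real n} t * f t)"
  have F2: "F \<in> l2_space"
    and lim: "(\<lambda>n. LINT \<omega>|lebesgue. (cmod (F \<omega> - fourier_integral (s n) \<omega>))\<^sup>2) \<longlonglongrightarrow> 0"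
    using False F unfolding has_fourier_transform_def s_def by blast+
  have s: "integrable lebesgue (s n)" "L2.converges_to s f" for n
    unfolding s_def by (rule truncation[OF f])+
  have s2: "s n \<in> l2_space" for n using s(2) by (simp add: L2.converges_to_def)
  note sp = plancherel_pair_fourier_integral[OF s(1) s2]
  note sF2 = plancherel_pair_l2(2)[OF sp]
  have "(\<lambda>n. sqrt (LINT \<omega>|lebesgue. (cmod (F \<omega> - fourier_integral (s n) \<omega>))\<^sup>2)) \<longlonglongrightarrow> sqrt 0"
    by (rule tendsto_real_sqrt[OF lim])
  moreover have "ip_norm l2_inner (\<lambda>\<omega>. fourier_integral (s n) \<omega> - F \<omega>) =
      sqrt (LINT \<omega>|lebesgue. (cmod (F \<omega> - fourier_integral (s n) \<omega>))\<^sup>2)" for n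
    unfolding L2.norm_minus_commute[OF sF2 F2] by (simp add: ip_norm_def l2_inner_self)
  ultimately have "L2.converges_to (\<lambda>n. fourier_integral (s n)) F"
    using sF2 F2 by (simp add: L2.converges_to_def)
  thus ?thesis by (rule plancherel_pair_limit[OF sp s(2)])
qed

section \<open>Inversion and convolution\<close>

lemma lebesgue_measurable_affine:
  fixes f :: "real \<Rightarrow> complex"
  assumes "f \<in> borel_measurable lebesgue" "c \<noteq> 0"
  shows "(\<lambda>x. f (a + c * x)) \<in> borel_measurable lebesgue"
proof -
  have "(\<lambda>x. a + c * x) \<in> lebesgue \<rightarrow>\<^sub>M lebesgue"
    using lebesgue_affine_measurable[where c = "\<lambda>x::real. c"] assms(2) by simp
  thus ?thesis using assms(1) by (rule measurable_compose)
qed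

lemma l2_reflect:
  assumes f: "f \<in> l2_space"
  shows "(\<lambda>x. f (a - x)) \<in> l2_space"
    and "ip_norm l2_inner (\<lambda>x. f (a - x)) = ip_norm l2_inner f"
proof -
  have "(\<lambda>x. f (a - x)) \<in> borel_measurable lebesgue"
    using lebesgue_measurable_affine[OF l2_spaceD(1)[OF f], of "-1" a] by simp
  moreover have "integrable lebesgue (\<lambda>x. (cmod (f (a - x)))\<^sup>2)"
    using lebesgue_integrable_real_affine[OF l2_spaceD(2)[OF f], of "-1" a] by simp
  ultimately show "(\<lambda>x. f (a - x)) \<in> l2_space" by (simp add: l2_space_def)
  show "ip_norm l2_inner (\<lambda>x. f (a - x)) = ip_norm l2_inner f"
    unfolding ip_norm_def l2_inner_self
    using lebesgue_integral_real_affine[of "-1" "\<lambda>x. (cmod (f x))\<^sup>2" a] by simp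
qed

lemma l2_cnj:
  assumes f: "f \<in> l2_space"
  shows "(\<lambda>x. cnj (f x)) \<in> l2_space"
    and "ip_norm l2_inner (\<lambda>x. cnj (f x)) = ip_norm l2_inner f"
proof -
  have [measurable]: "f \<in> borel_measurable lebesgue" by (rule l2_spaceD[OF f])
  show "(\<lambda>x. cnj (f x)) \<in> l2_space" by (rule l2_space_bounded[OF _ f, of _ 1]) simp_all
  show "ip_norm l2_inner (\<lambda>x. cnj (f x)) = ip_norm l2_inner f"
    by (simp add: ip_norm_def l2_inner_self)
qed

lemma l2_modulate:
  assumes f: "f \<in> l2_space"
  shows "(\<lambda>x. f x * exp (\<i> * of_real (a * x))) \<in> l2_space"
    and "ip_norm l2_inner (\<lambda>x. f x * exp (\<i> * of_real (a * x))) = ip_norm l2_inner f"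
proof -
  have [measurable]: "f \<in> borel_measurable lebesgue" by (rule l2_spaceD[OF f])
  have "norm (exp (\<i> * complex_of_real (a * x))) = 1" for x by (rule norm_exp_i_times)
  hence eq: "cmod (f x * exp (\<i> * of_real (a * x))) = cmod (f x)" for x
    by (simp add: norm_mult del: of_real_mult)
  show "(\<lambda>x. f x * exp (\<i> * of_real (a * x))) \<in> l2_space"
    by (rule l2_space_bounded[OF _ f, of _ 1]) (simp_all add: eq del: of_real_mult)
  show "ip_norm l2_inner (\<lambda>x. f x * exp (\<i> * of_real (a * x))) = ip_norm l2_inner f"
    by (simp add: ip_norm_def l2_inner_self eq del: of_real_mult)
qed

text \<open>The vector with which the convolution at \<open>t\<close> is an inner product; it is the feature vector of the
  kernel.\<close>

definition reflected_conjugate :: "(real \<Rightarrow> complex) \<Rightarrow> real \<Rightarrow> real \<Rightarrow> complex" where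
  "reflected_conjugate h t \<tau> = cnj (h (t - \<tau>))"

lemma reflected_conjugate_l2:
  assumes "h \<in> l2_space"
  shows "reflected_conjugate h t \<in> l2_space"
    and "ip_norm l2_inner (reflected_conjugate h t) = ip_norm l2_inner h"
  unfolding reflected_conjugate_def[abs_def]
  using l2_cnj[OF l2_reflect(1)[OF assms]] l2_reflect(2)[OF assms] by simp_all

lemma convolution_eq_l2_inner: "convolution h f t = l2_inner (reflected_conjugate h t) f"
  by (simp add: convolution_def l2_inner_def reflected_conjugate_def)

lemma fourier_reflected_conjugate:
  assumes h: "integrable lebesgue h"
  shows "integrable lebesgue (reflected_conjugate h t)"
    and "fourier_integral (reflected_conjugate h t) =
      (\<lambda>\<omega>. cnj (fourier_integral h \<omega>) * exp (\<i> * of_real (- t * \<omega>)))"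
proof -
  show "integrable lebesgue (reflected_conjugate h t)"
    using integrable_cnj[OF lebesgue_integrable_real_affine[OF h, of "-1" t]]
    by (simp add: reflected_conjugate_def[abs_def])
  show "fourier_integral (reflected_conjugate h t) =
      (\<lambda>\<omega>. cnj (fourier_integral h \<omega>) * exp (\<i> * of_real (- t * \<omega>)))"
  proof
    fix \<omega>
    have e: "cnj (iexp x) = iexp (- x)" for x by (simp add: exp_cnj)
    have "fourier_integral (reflected_conjugate h t) \<omega> =
        \<bar>- 1\<bar> *\<^sub>R (LINT \<tau>|lebesgue. reflected_conjugate h t (t + - 1 * \<tau>) * iexp (- \<omega> * (t + - 1 * \<tau>)))"
      unfolding fourier_integral_alt by (rule lebesgue_integral_real_affine) simp
    also have "\<dots> = (LINT \<tau>|lebesgue. cnj (h \<tau> * iexp (- \<omega> * \<tau>)) * iexp (- t * \<omega>))"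
    proof -
      have "iexp (- \<omega> * (t + - 1 * \<tau>)) = cnj (iexp (- \<omega> * \<tau>)) * iexp (- t * \<omega>)" for \<tau>
        unfolding e exp_i_add[symmetric] by (simp add: algebra_simps)
      moreover have "reflected_conjugate h t (t + - 1 * \<tau>) = cnj (h \<tau>)" for \<tau>
        by (simp add: reflected_conjugate_def)
      ultimately show ?thesis
          by (simp only: complex_cnj_mult mult.assoc abs_minus_cancel abs_one scaleR_one)
    qed
    also have "\<dots> = cnj (fourier_integral h \<omega>) * iexp (- t * \<omega>)"
      unfolding fourier_integral_alt Bochner_Integration.integral_cnj[symmetric]
      by (rule integral_mult_left_zero)
    finally show "fourier_integral (reflected_conjugate h t) \<omega> =
        cnj (fourier_integral h \<omega>) * exp (\<i> * of_real (- t * \<omega>))" .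
  qed
qed

text \<open>For integrable functions this is a substitution in the Fourier integral. Reflection, conjugation
  and modulation preserve norms, so the formula passes to limits of Gaussian combinations.\<close>

lemma plancherel_pair_reflected_conjugate:
  assumes "plancherel_pair h h_hat"
  shows "plancherel_pair (reflected_conjugate h t) (\<lambda>\<omega>. cnj (h_hat \<omega>) * exp (\<i> * of_real (- t * \<omega>)))"
proof -
  obtain w where w: "\<And>n. w n \<in> gauss_span" "L2.converges_to w h"
    "L2.converges_to (\<lambda>n. fourier_integral (w n)) h_hat" using assms unfolding plancherel_pair_def
        by blast
  note h = plancherel_pair_l2[OF assms] and wi = gauss_span_integrable[OF w(1)]
    and w2 = gauss_span_l2[OF w(1)] and W2 = fourier_gauss_span_l2[OF w(1)]
  show ?thesis
  proof (rule plancherel_pair_limit)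
    fix n
    show "plancherel_pair (reflected_conjugate (w n) t)
        (\<lambda>\<omega>. cnj (fourier_integral (w n) \<omega>) * iexp (- t * \<omega>))"
      unfolding fourier_reflected_conjugate(2)[OF wi, symmetric]
      by (rule plancherel_pair_fourier_integral[OF fourier_reflected_conjugate(1)[OF wi]
          reflected_conjugate_l2(1)[OF w2]])
  next
    have "(\<lambda>\<tau>. reflected_conjugate (w n) t \<tau> - reflected_conjugate h t \<tau>) =
        reflected_conjugate (\<lambda>x. w n x - h x) t" for n
      by (simp add: reflected_conjugate_def fun_eq_iff)
    thus "L2.converges_to (\<lambda>n. reflected_conjugate (w n) t) (reflected_conjugate h t)"
      using w(2) reflected_conjugate_l2(1)[OF w2] reflected_conjugate_l2(1)[OF h(1)]
      by (simp add: L2.converges_to_def reflected_conjugate_l2(2)[OF L2.diff_in[OF w2 h(1)]])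
  next
    let ?M = "\<lambda>F \<omega>. cnj (F \<omega>) * iexp (- t * \<omega>)"
    have "(\<lambda>\<omega>. ?M (fourier_integral (w n)) \<omega> - ?M h_hat \<omega>) =
        ?M (\<lambda>\<omega>. fourier_integral (w n) \<omega> - h_hat \<omega>)" for n
      by (simp add: left_diff_distrib)
    moreover have "?M F \<in> l2_space" "ip_norm l2_inner (?M F) =
        ip_norm l2_inner F" if "F \<in> l2_space" for F
      using l2_modulate[OF l2_cnj(1)[OF that], of "- t"] l2_cnj(2)[OF that] by (simp_all only:)
    ultimately show "L2.converges_to (\<lambda>n. ?M (fourier_integral (w n))) (?M h_hat)"
      using w(3) W2 h(2) L2.diff_in[OF W2 h(2)] by (simp only: L2.converges_to_def simp_thms)
  qed
qed

definition inverse_fourier :: "(real \<Rightarrow> complex) \<Rightarrow> real \<Rightarrow> complex" where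
  "inverse_fourier G t = of_real (1 / (2 * pi)) * fourier_integral G (- t)"

text \<open>By the multiplication formula, \<open>G\<close> and the Plancherel transform of \<open>inverse_fourier G\<close> have the
  same inner products with modulated Gaussians.\<close>

lemma plancherel_pair_inverse_fourier:
  assumes G: "integrable lebesgue G" "G \<in> l2_space"
  shows "plancherel_pair (inverse_fourier G) G"
proof -
  have g2: "inverse_fourier G \<in> l2_space"
    unfolding inverse_fourier_def[abs_def]
    using L2.scale_in[OF l2_reflect(1)[OF plancherel_pair_l2(2)[OF plancherel_pair_fourier_integral[OF G]], of 0],
        of "of_real (1 / (2 * pi))"]
    by (simp only: diff_0)
  obtain F where F: "plancherel_pair (inverse_fourier G) F" using plancherel_pair_exists[OF g2] by blast
  note F2 = plancherel_pair_l2(2)[OF F]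
  have "l2_inner (gauss_mod a) F = l2_inner (gauss_mod a) G" for a
  proof -
    have "l2_inner (gauss_mod a) F = (LINT \<omega>|lebesgue. gauss_mod (- a) \<omega> * F \<omega>)"
      by (simp add: l2_inner_def cnj_gauss)
    also have "\<dots> = of_real (sqrt (2 * pi)) * l2_inner (gauss_shift (- a)) (inverse_fourier G)"
      by (rule plancherel_pair_gauss_pairing[OF F])
    also have "l2_inner (gauss_shift (- a)) (inverse_fourier G) =
        (LINT t|lebesgue. of_real (1 / (2 * pi)) * (gauss_shift (- a) t * fourier_integral G (- t)))"
      unfolding l2_inner_def cnj_gauss inverse_fourier_def by (simp only: mult.left_commute)
    also have "\<dots> = of_real (1 / (2 * pi)) * (LINT t|lebesgue. gauss_shift
        (- a) t * fourier_integral G (- t))"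
      by (rule integral_mult_right_zero)
    also have "(LINT t|lebesgue. gauss_shift (- a) t * fourier_integral G (- t)) =
        \<bar>- 1\<bar> *\<^sub>R (LINT t|lebesgue. gauss_shift (- a) (0 + - 1 * t) * fourier_integral G (- (0
            + - 1 * t)))"
      by (rule lebesgue_integral_real_affine) simp
    also have "\<dots> = (LINT t|lebesgue. gauss_shift a t * fourier_integral G t)"
      by (simp add: gauss_reflect)
    also have "\<dots> = (LINT t|lebesgue. fourier_integral (gauss_shift a) t * G t)"
      by (rule fourier_multiplication[OF gauss_shift_integrable G(1), symmetric])
    also have "\<dots> = of_real (sqrt (2 * pi)) * l2_inner (gauss_mod a) G"
      unfolding fourier_gauss_shift l2_inner_def cnj_gauss mult.assoc by (rule integral_mult_right_zero)
    finally have "l2_inner (gauss_mod a) F =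
        of_real (sqrt (2 * pi) * (1 / (2 * pi)) * sqrt (2 * pi)) * l2_inner (gauss_mod a) G"
      by (simp only: of_real_mult mult.assoc)
    also have "sqrt (2 * pi) * (1 / (2 * pi)) * sqrt (2 * pi) = 1" by simp
    finally show ?thesis by simp
  qed
  hence "AE \<omega> in lebesgue. G \<omega> - F \<omega> = 0"
    by (intro gauss_mod_total[OF L2.diff_in[OF G(2) F2]])
        (simp add: L2.diff_right[OF gauss_l2(1) G(2) F2])
  hence "AE \<omega> in lebesgue. G \<omega> = F \<omega>" by eventually_elim simp
  thus ?thesis by (rule plancherel_pair_cong_AE[OF F])
qed

text \<open>The reflected Plancherel transform of the Fourier integral of \<open>h\<close> is a square-integrable candidate
  \<open>f\<close> for \<open>h\<close>; two uses of the multiplication formula show that \<open>f\<close> and \<open>h\<close> have the same pairings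
  with modulated Gaussians.\<close>

lemma l2_if_fourier_integral_l2:
  assumes h: "integrable lebesgue h" and H: "fourier_integral h \<in> l2_space"
  shows "h \<in> l2_space"
proof -
  obtain G where G: "plancherel_pair (fourier_integral h) G" using plancherel_pair_exists[OF H] by blast
  note G2 = plancherel_pair_l2(2)[OF G]
  define f where "f = (\<lambda>t. of_real (1 / (2 * pi)) * G (0 - t))"
  have f2: "f \<in> l2_space" unfolding f_def by (rule L2.scale_in[OF l2_reflect(1)[OF G2]])
  have i1: "integrable lebesgue (\<lambda>t. gauss_mod a t * f t)" for a
    by (rule l2_product_integrable(1)[OF gauss_l2(1) f2])
  have i2: "integrable lebesgue (\<lambda>t. gauss_mod a t * h t)" for a
  proof (rule Bochner_Integration.integrable_bound[OF h])
    have [measurable]: "h \<in> borel_measurable lebesgue" using h by simp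
    show "(\<lambda>t. gauss_mod a t * h t) \<in> borel_measurable lebesgue" by measurable
    show "AE t in lebesgue. norm (gauss_mod a t * h t) \<le> norm (h t)"
      by (rule AE_I2) (simp add: norm_mult cmod_gauss mult_left_le_one_le)
  qed
  have pairing: "(LINT t|lebesgue. gauss_mod a t * f t) = (LINT t|lebesgue. gauss_mod a t * h t)" for a
  proof -
    have "(LINT t|lebesgue. gauss_mod a t * f t) =
        (LINT t|lebesgue. of_real (1 / (2 * pi)) * (gauss_mod a t * G (0 - t)))"
      unfolding f_def by (simp only: mult.left_commute)
    also have "\<dots> = of_real (1 / (2 * pi)) * (LINT t|lebesgue. gauss_mod a t * G (0 - t))"
      by (rule integral_mult_right_zero)
    also have "(LINT t|lebesgue. gauss_mod a t * G (0 - t)) =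
        \<bar>- 1\<bar> *\<^sub>R (LINT t|lebesgue. gauss_mod a (0 + - 1 * t) * G (0 - (0 + - 1 * t)))"
      by (rule lebesgue_integral_real_affine) simp
    also have "\<dots> = (LINT t|lebesgue. gauss_mod (- a) t * G t)" by (simp add: gauss_reflect)
    also have "\<dots> = of_real (sqrt (2 * pi)) * l2_inner (gauss_shift (- a)) (fourier_integral h)"
      by (rule plancherel_pair_gauss_pairing[OF G])
    also have "l2_inner (gauss_shift (- a)) (fourier_integral h) =
        (LINT t|lebesgue. fourier_integral (gauss_shift (- a)) t * h t)"
      unfolding l2_inner_def cnj_gauss
          by (rule fourier_multiplication[OF gauss_shift_integrable h, symmetric])
    also have "\<dots> = of_real (sqrt (2 * pi)) * (LINT t|lebesgue. gauss_mod a t * h t)"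
      unfolding fourier_gauss_shift mult.assoc minus_minus by (rule integral_mult_right_zero)
    finally have "(LINT t|lebesgue. gauss_mod a t * f t) =
        of_real (1 / (2 * pi) * sqrt (2 * pi) * sqrt (2 * pi)) * (LINT t|lebesgue. gauss_mod a t * h t)"
      by (simp only: of_real_mult mult.assoc)
    also have "1 / (2 * pi) * sqrt (2 * pi) * sqrt (2 * pi) = 1" by simp
    finally show ?thesis by simp
  qed
  have "AE t in lebesgue. h t - f t = 0"
  proof (rule AE_zero_if_gauss_mod_zero)
    show "integrable lebesgue (\<lambda>t. gauss_mod 0 t * (h t - f t))"
      unfolding right_diff_distrib by (rule Bochner_Integration.integrable_diff[OF i2 i1])
    show "(LINT t|lebesgue. gauss_mod a t * (h t - f t)) = 0" for a
      unfolding right_diff_distrib Bochner_Integration.integral_diff[OF i2 i1] pairing by simp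
  qed
  hence "AE t in lebesgue. cmod (h t) \<le> 1 * cmod (f t)" by eventually_elim simp
  thus ?thesis by (rule l2_space_bounded[OF borel_measurable_integrable[OF h] f2])
qed

text \<open>Damp the transform
    by \<open>exp (- \<sigma> \<omega>\<^sup>2 / 2)\<close>. By the multiplication formula its integral becomes that of
  \<open>f\<close> against a positive Gaussian of mass \<open>2 * pi\<close>, which is at most \<open>2 * pi * M\<close> whatever \<open>\<sigma>\<close> is. By
  Fatou's lemma the bound survives as \<open>\<sigma>\<close> tends to 0.\<close>

lemma nonneg_fourier_integral_integrable:
  assumes f: "integrable lebesgue f" and M: "\<And>t. cmod (f t) \<le> M"
    and p: "AE \<omega> in lebesgue. fourier_integral f \<omega> = of_real (p \<omega>)" "\<And>\<omega>. p \<omega> \<ge> 0"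
  shows "integrable lebesgue (fourier_integral f)"
proof -
  note fm [measurable] = fourier_integral_measurable[OF f]
  define P where "P = (\<lambda>\<omega>. cmod (fourier_integral f \<omega>))"
  have [measurable]: "P \<in> borel_measurable lebesgue" unfolding P_def by measurable
  have "M \<ge> 0" using M[of 0] norm_ge_zero order_trans by blast
  define g where "g = (\<lambda>\<sigma> \<omega>. complex_of_real (exp (- \<sigma> * \<omega>\<^sup>2 / 2)))"
  have gm [measurable]: "g \<sigma> \<in> borel_measurable lebesgue" for \<sigma>
    unfolding g_def by (rule measurable_lebesgueI) measurable
  have bound: "(\<integral>\<^sup>+\<omega>. ennreal (P \<omega> * exp (- \<sigma> * \<omega>\<^sup>2 / 2)) \<partial>lebesgue) \<le> ennreal (2 * pi * M)"
    if \<sigma>: "\<sigma> > 0" for \<sigma> :: real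
  proof -
    have gi: "integrable lebesgue (g \<sigma>)" unfolding g_def by (rule gaussian_Fourier(1)[OF \<sigma>])
    have gF: "fourier_integral (g \<sigma>) t = of_real (sqrt (2 * pi / \<sigma>) * exp (- (1 / \<sigma>) * t\<^sup>2 / 2))" for t
      using gaussian_Fourier(2)[OF \<sigma>, of "- t"] unfolding fourier_integral_alt g_def by simp
    have Pi: "integrable lebesgue (\<lambda>\<omega>. P \<omega> * exp (- \<sigma> * \<omega>\<^sup>2 / 2))"
    proof (rule Bochner_Integration.integrable_bound)
      show "integrable lebesgue (\<lambda>\<omega>. (LINT t|lebesgue. cmod (f t)) * cmod (g \<sigma> \<omega>))" using gi by simp
      show "(\<lambda>\<omega>. P \<omega> * exp (- \<sigma> * \<omega>\<^sup>2 / 2)) \<in> borel_measurable lebesgue"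
      proof -
        have "(\<lambda>\<omega>. P \<omega> * cmod (g \<sigma> \<omega>)) \<in> borel_measurable lebesgue" by measurable
        thus ?thesis by (simp add: g_def)
      qed
      show "AE \<omega> in lebesgue. norm (P \<omega> * exp (- \<sigma> * \<omega>\<^sup>2 / 2))
          \<le> norm ((LINT t|lebesgue. cmod (f t)) * cmod (g \<sigma> \<omega>))"
        by (intro AE_I2) (auto simp: P_def g_def abs_mult intro!: mult_right_mono
            fourier_integral_bounded)
    qed
    have "complex_of_real (LINT \<omega>|lebesgue. P \<omega> * exp (- \<sigma> * \<omega>\<^sup>2 / 2)) =
        (LINT \<omega>|lebesgue. of_real (P \<omega> * exp (- \<sigma> * \<omega>\<^sup>2 / 2)))"
      by (rule integral_complex_of_real[symmetric])
    also have "\<dots> = (LINT \<omega>|lebesgue. fourier_integral f \<omega> * g \<sigma> \<omega>)"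
    proof (rule integral_cong_AE)
      show "AE \<omega> in lebesgue. of_real (P \<omega> * exp (- \<sigma> * \<omega>\<^sup>2 / 2)) = fourier_integral f \<omega> * g \<sigma> \<omega>"
        using p(1) by eventually_elim (simp add: P_def g_def p(2))
      show "(\<lambda>\<omega>. complex_of_real (P \<omega> * exp (- \<sigma> * \<omega>\<^sup>2 / 2))) \<in> borel_measurable lebesgue"
        by (rule measurable_compose[OF borel_measurable_integrable[OF Pi]]) measurable
    qed measurable
    also have "\<dots> = (LINT t|lebesgue. f t * fourier_integral (g \<sigma>) t)"
      by (rule fourier_multiplication[OF f gi])
    finally have "(LINT \<omega>|lebesgue. P \<omega> * exp (- \<sigma> * \<omega>\<^sup>2 / 2))
        \<le> cmod (LINT t|lebesgue. f t * fourier_integral (g \<sigma>) t)"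
      by (metis abs_ge_self norm_of_real)
    also have "\<dots> \<le> (LINT t|lebesgue. cmod (f t * fourier_integral (g \<sigma>) t))"
        by (rule integral_norm_bound)
    also have "\<dots> \<le> (LINT t|lebesgue. M * (sqrt (2 * pi / \<sigma>) * exp (- (1 / \<sigma>) * t\<^sup>2 / 2)))"
    proof (rule integral_mono_AE')
      have "integrable lebesgue (\<lambda>t. exp (- (1 / \<sigma>) * t\<^sup>2 / 2))"
        using integrable_norm[OF gaussian_Fourier(1)[of "1 / \<sigma>"]] \<sigma> by simp
      thus "integrable lebesgue (\<lambda>t. M * (sqrt (2 * pi / \<sigma>) * exp (- (1 / \<sigma>) * t\<^sup>2 / 2)))" by simp
      show "AE t in lebesgue. cmod (f t * fourier_integral (g \<sigma>) t)
          \<le> M * (sqrt (2 * pi / \<sigma>) * exp (- (1 / \<sigma>) * t\<^sup>2 / 2))"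
        unfolding gF norm_mult norm_of_real using \<sigma> by (intro AE_I2 mult_mono M) (auto simp: \<open>M \<ge> 0\<close>)
    qed (use \<sigma> \<open>M \<ge> 0\<close> in \<open>auto intro!: AE_I2 mult_nonneg_nonneg\<close>)
    also have "\<dots> = M * (sqrt (2 * pi / \<sigma>) * (LINT t|lebesgue. exp (- (1 / \<sigma>) * t\<^sup>2 / 2)))" by simp
    also have "(LINT t|lebesgue. exp (- (1 / \<sigma>) * t\<^sup>2 / 2)) = sqrt (2 * pi / (1 / \<sigma>))"
    proof -
      have "complex_of_real (LINT t|lebesgue. exp (- (1 / \<sigma>) * t\<^sup>2 / 2)) =
          (LINT t|lebesgue. complex_of_real (exp (- (1 / \<sigma>) * t\<^sup>2 / 2)))"
        by (rule integral_complex_of_real[symmetric])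
      also have "\<dots> = complex_of_real (sqrt (2 * pi / (1 / \<sigma>)))"
        using gaussian_Fourier(2)[of "1 / \<sigma>" 0] \<sigma> by simp
      finally show ?thesis by (simp only: of_real_eq_iff)
    qed
    also have "sqrt (2 * pi / \<sigma>) * sqrt (2 * pi / (1 / \<sigma>)) = 2 * pi"
    proof -
      have "2 * pi / \<sigma> * (2 * pi / (1 / \<sigma>)) = (2 * pi)\<^sup>2" using \<sigma> by (simp add: power2_eq_square)
      thus ?thesis by (simp only: real_sqrt_mult[symmetric] real_sqrt_abs) simp
    qed
    finally have le: "(LINT \<omega>|lebesgue. P \<omega> * exp (- \<sigma> * \<omega>\<^sup>2 / 2)) \<le> 2 * pi * M"
        by (simp add: mult.commute)
    have "(\<integral>\<^sup>+\<omega>. ennreal (P \<omega> * exp (- \<sigma> * \<omega>\<^sup>2 / 2)) \<partial>lebesgue) =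
        ennreal (LINT \<omega>|lebesgue. P \<omega> * exp (- \<sigma> * \<omega>\<^sup>2 / 2))"
      by (rule nn_integral_eq_integral[OF Pi]) (simp add: P_def)
    thus ?thesis using le by (simp add: ennreal_leI)
  qed
  define \<sigma> where "\<sigma> = (\<lambda>n. inverse (real (Suc n)))"
  have "(\<integral>\<^sup>+\<omega>. ennreal (P \<omega>) \<partial>lebesgue) =
      (\<integral>\<^sup>+\<omega>. liminf (\<lambda>n. ennreal (P \<omega> * exp (- \<sigma> n * \<omega>\<^sup>2 / 2))) \<partial>lebesgue)"
  proof (rule nn_integral_cong)
    fix \<omega>
    have "(\<lambda>n. P \<omega> * exp (- \<sigma> n * \<omega>\<^sup>2 / 2)) \<longlonglongrightarrow> P \<omega> * exp (- 0 * \<omega>\<^sup>2 / 2)"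
      unfolding \<sigma>_def by (intro tendsto_intros LIMSEQ_inverse_real_of_nat) simp
    hence "(\<lambda>n. ennreal (P \<omega> * exp (- \<sigma> n * \<omega>\<^sup>2 / 2))) \<longlonglongrightarrow> ennreal (P \<omega>)"
      by (intro tendsto_ennrealI) simp
    thus "ennreal (P \<omega>) = liminf (\<lambda>n. ennreal (P \<omega> * exp (- \<sigma> n * \<omega>\<^sup>2 / 2)))"
      by (intro lim_imp_Liminf[symmetric]) simp_all
  qed
  also have "\<dots> \<le> liminf (\<lambda>n. (\<integral>\<^sup>+\<omega>. ennreal (P \<omega> * exp (- \<sigma> n * \<omega>\<^sup>2 / 2)) \<partial>lebesgue))"
  proof (rule nn_integral_liminf)
    fix n
    have "(\<lambda>\<omega>. ennreal (P \<omega> * cmod (g (\<sigma> n) \<omega>))) \<in> borel_measurable lebesgue" by measurable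
    thus "(\<lambda>\<omega>. ennreal (P \<omega> * exp (- \<sigma> n * \<omega>\<^sup>2 / 2))) \<in> borel_measurable lebesgue" by (simp add: g_def)
  qed
  also have "\<dots> \<le> ennreal (2 * pi * M)"
    by (intro Liminf_le always_eventually allI bound) (simp_all add: \<sigma>_def)
  finally have "(\<integral>\<^sup>+\<omega>. ennreal (norm (fourier_integral f \<omega>)) \<partial>lebesgue) < \<infinity>"
    by (simp add: P_def le_less_trans)
  thus ?thesis using fm by (intro integrableI_bounded)
qed

lemma continuous_AE_eq_imp_eq:
  fixes f g :: "real \<Rightarrow> complex"
  assumes "continuous_on UNIV f" "continuous_on UNIV g" "AE t in lebesgue. f t = g t"
  shows "f = g"
proof -
  have "open {t. f t \<noteq> g t}" using assms(1,2) by (rule open_Collect_neq)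
  moreover have "negligible {t. f t \<noteq> g t}"
    using assms(3) by (simp add: negligible_iff_null_sets completion.AE_iff_null_sets)
  ultimately have "{t. f t \<noteq> g t} = {}" using open_not_negligible by blast
  thus ?thesis by auto
qed

text \<open>Plancherel's identity for the inner product of \<open>f\<close> with the reflected conjugate of \<open>h\<close>.\<close>

lemma convolution_fourier:
  assumes h: "plancherel_pair h h_hat" and f: "plancherel_pair f f_hat"
  shows "convolution h f = inverse_fourier (\<lambda>\<omega>. h_hat \<omega> * f_hat \<omega>)"
proof
  fix t
  have e: "cnj (iexp x) = iexp (- x)" for x by (simp add: exp_cnj)
  have "of_real (2 * pi) * convolution h f t =
      l2_inner (\<lambda>\<omega>. cnj (h_hat \<omega>) * iexp (- t * \<omega>)) f_hat"
    unfolding convolution_eq_l2_inner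
    by (rule Plancherel[OF plancherel_pair_reflected_conjugate[OF h] f, symmetric])
  also have "\<dots> = fourier_integral (\<lambda>\<omega>. h_hat \<omega> * f_hat \<omega>) (- t)"
  proof -
    have "cnj (cnj (h_hat \<omega>) * iexp (- t * \<omega>)) * f_hat \<omega> = h_hat \<omega> * f_hat \<omega> * iexp (- (- t) * \<omega>)" for \<omega>
      unfolding complex_cnj_mult e complex_cnj_cnj by (simp add: mult_ac)
    thus ?thesis unfolding l2_inner_def fourier_integral_alt by (simp only:)
  qed
  finally show "convolution h f t = inverse_fourier (\<lambda>\<omega>. h_hat \<omega> * f_hat \<omega>) t"
    unfolding inverse_fourier_def by (simp add: field_simps)
qed

lemma plancherel_pair_convolution:
  assumes h: "plancherel_pair h h_hat" and f: "plancherel_pair f f_hat"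
    and bounded: "AE \<omega> in lebesgue. cmod (h_hat \<omega>) \<le> C"
  shows "plancherel_pair (convolution h f) (\<lambda>\<omega>. h_hat \<omega> * f_hat \<omega>)"
  unfolding convolution_fourier[OF h f]
proof (rule plancherel_pair_inverse_fourier)
  note h2 = plancherel_pair_l2(2)[OF h] and f2 = plancherel_pair_l2(2)[OF f]
  show "integrable lebesgue (\<lambda>\<omega>. h_hat \<omega> * f_hat \<omega>)" by (rule l2_product_integrable(1)[OF h2 f2])
  have [measurable]: "h_hat \<in> borel_measurable lebesgue" "f_hat \<in> borel_measurable lebesgue"
    by (rule l2_spaceD[OF h2], rule l2_spaceD[OF f2])
  show "(\<lambda>\<omega>. h_hat \<omega> * f_hat \<omega>) \<in> l2_space"
  proof (rule l2_space_bounded[OF _ f2])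
    show "AE \<omega> in lebesgue. cmod (h_hat \<omega> * f_hat \<omega>) \<le> C * cmod (f_hat \<omega>)"
      using bounded by eventually_elim (simp add: norm_mult mult_right_mono)
  qed measurable
qed

section \<open>Translation-invariant kernels\<close>

text \<open>Test positive definiteness on the two points \<open>0\<close> and \<open>t\<close> with the weights \<open>(1, 1)\<close> and \<open>(1, -1)\<close>.\<close>

lemma positive_definite_bounded:
  fixes r :: "real \<Rightarrow> real \<Rightarrow> real"
  assumes trans: "\<And>t u. r t u = \<Phi> (t - u)" and sym: "symmetric_kernel r"
    and pd: "positive_definite_kernel r"
  shows "\<bar>\<Phi> t\<bar> \<le> \<Phi> 0"
proof (cases "t = 0")
  case True
  have "(\<Sum>x\<in>{0}. \<Sum>y\<in>{0}. 1 * 1 * r x y) \<ge> 0"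
    by (rule pd[unfolded positive_definite_kernel_def, rule_format]) simp
  thus ?thesis using True by (simp add: trans)
next
  case False
  have even: "\<Phi> (- t) = \<Phi> t" using sym trans[of 0 t] trans[of t 0] by (simp add: symmetric_kernel_def)
  have nonneg: "0 \<le> (\<Sum>x\<in>{0, t}. \<Sum>y\<in>{0, t}. a x * a y * r x y)" for a
    by (rule pd[unfolded positive_definite_kernel_def, rule_format]) simp
  from nonneg[of "\<lambda>_. 1"] nonneg[of "\<lambda>x. if x = 0 then 1 else - 1"]
  show ?thesis using False by (simp add: trans even abs_le_iff)
qed

text \<open>The difference of the two sides has Plancherel transform zero, so they agree almost everywhere,
  and both are continuous.\<close>

lemma Fourier_inversion:
  assumes f: "integrable lebesgue f" "f \<in> l2_space" "continuous_on UNIV f"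
    and F: "integrable lebesgue (fourier_integral f)"
  shows "inverse_fourier (fourier_integral f) = f"
proof (rule continuous_AE_eq_imp_eq)
  note p = plancherel_pair_fourier_integral[OF f(1,2)]
  note q = plancherel_pair_inverse_fourier[OF F plancherel_pair_l2(2)[OF p]]
  note d = plancherel_pair_diff[OF q p]
  have "sqrt (2 * pi) * ip_norm l2_inner (\<lambda>t. inverse_fourier (fourier_integral f) t - f t) = 0"
    unfolding Plancherel_norm[OF d, symmetric] by (rule l2_norm_zero_if_AE_zero) simp
  hence "ip_norm l2_inner (\<lambda>t. inverse_fourier (fourier_integral f) t - f t) = 0" by simp
  from AE_zero_if_l2_norm_zero[OF plancherel_pair_l2(1)[OF d] this]
  show "AE t in lebesgue. inverse_fourier (fourier_integral f) t = f t" by eventually_elim simp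
  have "continuous_on UNIV (\<lambda>t. fourier_integral (fourier_integral f) (- t))"
    by (rule continuous_on_compose2[OF fourier_integral_continuous[OF F]])
        (auto intro!: continuous_intros)
  thus "continuous_on UNIV (inverse_fourier (fourier_integral f))"
    unfolding inverse_fourier_def[abs_def] by (intro continuous_intros)
qed (rule f)

text \<open>If \<open>h\<close> is integrable and its transform is the Fourier integral, that integral has squared modulus
  equal to the transform of \<open>\<Phi>\<close>, which is nonnegative and therefore integrable; so \<open>h\<close> is
  square-integrable in this case as well.\<close>

lemma plancherel_pair_spectral_root:
  fixes \<Phi> :: "real \<Rightarrow> complex"
  assumes \<Phi>: "integrable lebesgue \<Phi>" "\<And>t. cmod (\<Phi> t) \<le> M"
    and h: "has_fourier_transform h h_hat"
    and modulus: "AE \<omega> in lebesgue. fourier_integral \<Phi> \<omega> = of_real ((cmod (h_hat \<omega>))\<^sup>2)"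
  shows "plancherel_pair h h_hat"
proof -
  have "h \<in> l2_space"
  proof (cases "integrable lebesgue h \<and> (AE \<omega> in lebesgue. h_hat \<omega> = fourier_integral h \<omega>)")
    case True
    have "integrable lebesgue (fourier_integral \<Phi>)"
      by (rule nonneg_fourier_integral_integrable[OF \<Phi> modulus]) simp
    hence int: "integrable lebesgue (\<lambda>\<omega>. cmod (fourier_integral \<Phi> \<omega>))" by simp
    note [measurable] = fourier_integral_measurable[OF conjunct1[OF True]]
    have "AE \<omega> in lebesgue. cmod (fourier_integral \<Phi> \<omega>) = (cmod (fourier_integral h \<omega>))\<^sup>2"
      using modulus conjunct2[OF True] by eventually_elim (simp add: norm_power)
    hence "integrable lebesgue (\<lambda>\<omega>. (cmod (fourier_integral h \<omega>))\<^sup>2)"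
      by (intro Bochner_Integration.integrable_cong_AE_imp[OF int]) auto
    hence "fourier_integral h \<in> l2_space" by (simp add: l2_space_def)
    thus ?thesis by (rule l2_if_fourier_integral_l2[OF conjunct1[OF True]])
  next
    case False
    thus ?thesis using h unfolding has_fourier_transform_def by blast
  qed
  thus ?thesis using h by (rule plancherel_pair_if_has_fourier_transform)
qed

text \<open>By Plancherel's identity the inner product is the inverse transform, at \<open>t - u\<close>, of
  \<open>\<bar>h_hat\<bar>\<^sup>2\<close>, which is the transform of \<open>\<Phi>\<close>; inversion returns \<open>\<Phi>\<close>.\<close>

lemma reflected_conjugate_inner:
  assumes \<Phi>: "integrable lebesgue \<Phi>" "\<And>t. cmod (\<Phi> t) \<le> M" "continuous_on UNIV \<Phi>"
    and h: "plancherel_pair h h_hat"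
    and modulus: "AE \<omega> in lebesgue. fourier_integral \<Phi> \<omega> = of_real ((cmod (h_hat \<omega>))\<^sup>2)"
  shows "l2_inner (reflected_conjugate h t) (reflected_conjugate h u) = \<Phi> (t - u)"
proof -
  have e: "cnj (iexp x) = iexp (- x)" for x by (simp add: exp_cnj)
  have inversion: "inverse_fourier (fourier_integral \<Phi>) = \<Phi>"
    by (rule Fourier_inversion[OF \<Phi>(1) l2_space_if_bounded_integrable[OF \<Phi>(1,2)] \<Phi>(3)
          nonneg_fourier_integral_integrable[OF \<Phi>(1,2) modulus]]) simp
  have [measurable]: "h_hat \<in> borel_measurable lebesgue"
      by (rule l2_spaceD[OF plancherel_pair_l2(2)[OF h]])
  have "of_real (2 * pi) * l2_inner (reflected_conjugate h t) (reflected_conjugate h u) =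
      l2_inner (\<lambda>\<omega>. cnj (h_hat \<omega>) * iexp (- t * \<omega>)) (\<lambda>\<omega>. cnj (h_hat \<omega>) * iexp (- u * \<omega>))"
    by (rule Plancherel[symmetric]) (rule plancherel_pair_reflected_conjugate[OF h])+
  also have "\<dots> = fourier_integral (\<lambda>\<omega>. of_real ((cmod (h_hat \<omega>))\<^sup>2)) (- (t - u))"
  proof -
    have "cnj (cnj (h_hat \<omega>) * iexp (- t * \<omega>)) * (cnj (h_hat \<omega>) * iexp (- u * \<omega>)) =
        of_real ((cmod (h_hat \<omega>))\<^sup>2) * iexp (- (- (t - u)) * \<omega>)" for \<omega>
    proof -
      have "cnj (cnj (h_hat \<omega>) * iexp (- t * \<omega>)) * (cnj (h_hat \<omega>) * iexp (- u * \<omega>)) =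
          (h_hat \<omega> * cnj (h_hat \<omega>)) * (iexp (- (- t * \<omega>)) * iexp (- u * \<omega>))"
        unfolding complex_cnj_mult e complex_cnj_cnj by (simp only: mult_ac)
      also have "h_hat \<omega> * cnj (h_hat \<omega>) = of_real ((cmod (h_hat \<omega>))\<^sup>2)"
        by (rule complex_norm_square[symmetric])
      also have "iexp (- (- t * \<omega>)) * iexp (- u * \<omega>) = iexp (- (- (t - u)) * \<omega>)"
        unfolding exp_i_add[symmetric] by (simp add: algebra_simps)
      finally show ?thesis .
    qed
    thus ?thesis unfolding l2_inner_def fourier_integral_alt by (simp only:)
  qed
  also have "\<dots> = fourier_integral (fourier_integral \<Phi>) (- (t - u))"
    unfolding fourier_integral_alt[of _ "- (t - u)"]
  proof (rule integral_cong_AE)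
    show "AE \<omega> in lebesgue. of_real ((cmod (h_hat \<omega>))\<^sup>2) * iexp (- (- (t - u)) * \<omega>) =
        fourier_integral \<Phi> \<omega> * iexp (- (- (t - u)) * \<omega>)"
      using modulus by eventually_elim (simp only:)
    note [measurable] = fourier_integral_measurable[OF \<Phi>(1)]
    show "(\<lambda>\<omega>. fourier_integral \<Phi> \<omega> * iexp (- (- (t - u)) * \<omega>)) \<in> borel_measurable lebesgue"
      "(\<lambda>\<omega>. of_real ((cmod (h_hat \<omega>))\<^sup>2) * iexp (- (- (t - u)) * \<omega>)) \<in> borel_measurable lebesgue"
      by measurable
  qed
  also have "\<dots> = of_real (2 * pi) * inverse_fourier (fourier_integral \<Phi>) (t - u)"
    by (simp add: inverse_fourier_def)
  finally show ?thesis unfolding inversion by simp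
qed

theorem theorem1p1:
  fixes r :: "real \<Rightarrow> real \<Rightarrow> real" and \<Phi> :: "real \<Rightarrow> real"
    and I :: "'i set" and \<phi> :: "'i \<Rightarrow> real \<Rightarrow> complex"
    and h h_hat :: "real \<Rightarrow> complex"
    and H :: "(real \<Rightarrow> complex) set"
    and ip :: "(real \<Rightarrow> complex) \<Rightarrow> (real \<Rightarrow> complex) \<Rightarrow> complex"
    and \<psi> :: "'i \<Rightarrow> real \<Rightarrow> complex"
  assumes translation_invariant: "\<And>t u. r t u = \<Phi> (t - u)"
    and symmetric: "symmetric_kernel r"
    and positive_definite: "positive_definite_kernel r"
    and continuous: "continuous_on UNIV \<Phi>"
    and integrable: "integrable lebesgue \<Phi>"
    and index_countable: "countable I" and index_infinite: "infinite I"
    and basis: "orthonormal_basis l2_space l2_inner I \<phi>"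
    and h_transform: "has_fourier_transform h h_hat"
    and h_modulus: "AE \<omega> in lebesgue.
          complex_of_real (cmod (h_hat \<omega>)) =
          csqrt (fourier_integral (\<lambda>t. complex_of_real (\<Phi> t)) \<omega>)"
    and rkhs: "rkhs H ip (\<lambda>t u. complex_of_real (r t u))"
  defines "\<psi> \<equiv> \<lambda>m. convolution h (\<phi> m)"
  shows "(\<forall>m\<in>I. \<forall>\<phi>_hat. has_fourier_transform (\<phi> m) \<phi>_hat \<longrightarrow>
            has_fourier_transform (\<psi> m) (\<lambda>\<omega>. h_hat \<omega> * \<phi>_hat \<omega>)) \<and>
         ((AE \<omega> in lebesgue. fourier_integral (\<lambda>t. complex_of_real (\<Phi> t)) \<omega> \<noteq> 0) \<longrightarrow>
            orthonormal_basis H ip I \<psi>) \<and>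
         (\<forall>t u. ((\<lambda>m. cnj (\<psi> m t) * \<psi> m u) has_sum complex_of_real (r t u)) I)"
proof -
  define \<Phi>c where "\<Phi>c = (\<lambda>t. complex_of_real (\<Phi> t))"
  have \<Phi>c: "integrable lebesgue \<Phi>c" "\<And>t. cmod (\<Phi>c t) \<le> \<Phi> 0" "continuous_on UNIV \<Phi>c"
    using integrable positive_definite_bounded[OF translation_invariant symmetric positive_definite]
      continuous by (auto simp: \<Phi>c_def intro!: continuous_intros)
  have modulus: "AE \<omega> in lebesgue. fourier_integral \<Phi>c \<omega> = of_real ((cmod (h_hat \<omega>))\<^sup>2)"
    using h_modulus unfolding \<Phi>c_def[symmetric]
  proof eventually_elim
    case (elim \<omega>)
    have "fourier_integral \<Phi>c \<omega> = (csqrt (fourier_integral \<Phi>c \<omega>))\<^sup>2" by simp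
    thus ?case unfolding elim[symmetric] by simp
  qed
  have h: "plancherel_pair h h_hat"
    by (rule plancherel_pair_spectral_root[OF \<Phi>c(1,2) h_transform modulus])
  define C where "C = sqrt (LINT t|lebesgue. cmod (\<Phi>c t))"
  have bounded: "AE \<omega> in lebesgue. cmod (h_hat \<omega>) \<le> C"
    using modulus
  proof eventually_elim
    case (elim \<omega>)
    hence "(cmod (h_hat \<omega>))\<^sup>2 = cmod (fourier_integral \<Phi>c \<omega>)" by (simp add: norm_power)
    hence "(cmod (h_hat \<omega>))\<^sup>2 \<le> (LINT t|lebesgue. cmod (\<Phi>c t))"
      using fourier_integral_bounded[of \<Phi>c \<omega>] by simp
    thus ?case unfolding C_def by (rule real_le_rsqrt)
  qed
  define \<eta> where "\<eta> = reflected_conjugate h"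
  interpret R: rkhs H ip "\<lambda>t u. complex_of_real (r t u)" by (rule rkhs)
  interpret F: feature_map l2_space l2_inner H ip "\<lambda>t u. complex_of_real (r t u)" \<eta>
  proof
    show "\<eta> t \<in> l2_space" for t
      unfolding \<eta>_def by (rule reflected_conjugate_l2(1)[OF plancherel_pair_l2(1)[OF h]])
    show "complex_of_real (r t u) = l2_inner (\<eta> t) (\<eta> u)" for t u
      unfolding \<eta>_def reflected_conjugate_inner[OF \<Phi>c h modulus] by (simp add: \<Phi>c_def translation_invariant)
  qed
  have transform: "F.transform f = convolution h f" for f
    unfolding F.transform_def unfolding \<eta>_def by (rule ext) (rule convolution_eq_l2_inner[symmetric])
  have \<psi>: "\<psi> = (\<lambda>m. F.transform (\<phi> m))" by (simp add: \<psi>_def transform)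
  have part1: "has_fourier_transform (\<psi> m) (\<lambda>\<omega>. h_hat \<omega> * \<phi>_hat \<omega>)"
    if m: "m \<in> I" and \<phi>_hat: "has_fourier_transform (\<phi> m) \<phi>_hat" for m \<phi>_hat
  proof -
    have "plancherel_pair (\<phi> m) \<phi>_hat"
      by (rule plancherel_pair_if_has_fourier_transform[OF orthonormal_basisD(1)[OF basis m] \<phi>_hat])
    from plancherel_pair_convolution[OF h this bounded] show ?thesis
      unfolding \<psi>_def by (rule has_fourier_transform_if_plancherel_pair)
  qed
  have part2: "orthonormal_basis H ip I \<psi>" if nonzero: "AE \<omega> in lebesgue. fourier_integral \<Phi>c \<omega> \<noteq> 0"
    unfolding \<psi>
  proof (rule F.transform_orthonormal_basis[OF _ basis], intro ballI impI)
    fix p assume p: "p \<in> l2_space" and zero: "\<forall>t. F.transform p t = 0"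
    obtain p_hat where p_hat: "plancherel_pair p p_hat" using plancherel_pair_exists[OF p] by blast
    note conv = plancherel_pair_convolution[OF h p_hat bounded]
    have "ip_norm l2_inner (convolution h p) = 0"
      by (rule l2_norm_zero_if_AE_zero) (use zero in \<open>simp add: transform\<close>)
    hence "ip_norm l2_inner (\<lambda>\<omega>. h_hat \<omega> * p_hat \<omega>) = 0" using Plancherel_norm[OF conv] by simp
    from AE_zero_if_l2_norm_zero[OF plancherel_pair_l2(2)[OF conv] this] modulus nonzero
    have "AE \<omega> in lebesgue. p_hat \<omega> = 0" by eventually_elim auto
    hence "ip_norm l2_inner p_hat = 0" by (rule l2_norm_zero_if_AE_zero)
    thus "ip_norm l2_inner p = 0" using Plancherel_norm[OF p_hat] by simp
  qed
  have part3: "((\<lambda>m. cnj (\<psi> m t) * \<psi> m u) has_sum complex_of_real (r t u)) I" for t u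
    using F.kernel_expansion[OF basis, of t u] symmetric unfolding \<psi> symmetric_kernel_def by simp
  show ?thesis using part1 part2 part3 unfolding \<Phi>c_def by blast
qed

end
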